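(* Let $n\geq 1$ and let $\varphi(z)=Az$, where $A:\mathbb{C}^n\to\mathbb{C}^n$ is a non-identity linear map with $\|A\|\leq 1$. Then $C_\varphi$ is uniformly asymptotically Toeplitz on $H^2$ if and only if all eigenvalues of $A$ lie inside the open unit disk.
   Context: $\mathbb{B}_n$ is the open unit ball and $\mathbb{S}_n$ the unit sphere of $\mathbb{C}^n$ (Euclidean norm; $\|A\|$ is the operator norm); $\sigma$ is the normalized surface measure on $\mathbb{S}_n$ ($\sigma(\mathbb{S}_n)=1$). The Hardy space $H^2$ consists of all analytic $h$ on $\mathbb{B}_n$ with $\|h\|^2=\sup_{0<r<1}\int_{\mathbb{S}_n}|h(r\zeta)|^2\,d\sigma(\zeta)<\infty$; via radial boundary limits (which exist a.e.) it is identified with a closed subspace of $L^2(\mathbb{S}_n,d\sigma)$, and $P$ is the orthogonal projection of $L^2(\mathbb{S}_n,d\sigma)$ onto $H^2$. For $f\in L^\infty(\mathbb{S}_n,d\sigma)$ the Toeplitz operator is $T_f h=P(fh)$, $h\in H^2$. For an analytic map $\varphi:\mathbb{B}_n\to\mathbb{B}_n$, the composition operator is $C_\varphi h=h\circ\varphi$. (For $\varphi(z)=Az$ with $\|A\|\leq1$, $C_\varphi$ is known to be bounded on $H^2$.) For a bounded operator $B$ on $H^2$, $\Phi(B)=\sum_{j=1}^n T_{\overline{z}_j}BT_{z_j}$, and $\Phi^m$ is the $m$-fold composition of $\Phi$ with itself. $B$ is uniformly asymptotically Toeplitz (UAT) if $\{\Phi^m(B)\}$ converges in the operator norm. *)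

theory Defs
  imports "HOL-Analysis.Analysis"
begin

text \<open>
  Points of \<open>\<complex>\<^sup>n\<close> are vectors of type \<open>complex ^ 'n\<close> with \<open>n = CARD('n)\<close>; their library norm is the
  Euclidean one, and \<open>ball 0 1\<close>, \<open>sphere 0 1\<close> are the open unit ball and the unit sphere.
\<close>

text \<open>
  Normalized surface measure, as the cone measure: the measure of a Borel subset \<open>E\<close> of the sphere is
  the proportion of the volume of the ball that is occupied by the cone \<open>{r\<zeta> | 0 < r < 1, \<zeta> \<in> E}\<close>.
  By polar coordinates this is the surface area of \<open>E\<close> divided by that of the sphere.
\<close>

definition sphere_measure :: "(complex ^ 'n) measure" where
  "sphere_measure =
     restrict_space (distr (uniform_measure lborel (ball 0 1)) borel sgn) (sphere 0 1)"

lemma space_sphere_measure [simp]: "space (sphere_measure :: (complex ^ 'n) measure) = sphere 0 1"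
  by (simp add: sphere_measure_def space_restrict_space)

lemma sets_sphere_measure [measurable_cong]:
  "sets (sphere_measure :: (complex ^ 'n) measure) = sets (restrict_space borel (sphere 0 1))"
  by (simp add: sphere_measure_def sets_restrict_space)

lemma borel_measurable_sgn_vec: "(sgn :: complex ^ 'n \<Rightarrow> _) \<in> borel_measurable borel"
proof -
  have "(\<lambda>x :: complex ^ 'n. inverse (norm x) *\<^sub>R x) \<in> borel_measurable borel"
    by measurable
  then show ?thesis
    by (simp add: sgn_div_norm [abs_def])
qed

lemma emeasure_sphere_measure:
  assumes "E \<in> sets borel" "E \<subseteq> sphere 0 1"
  shows "emeasure (sphere_measure :: (complex ^ 'n) measure) E =
           emeasure lborel {z \<in> ball 0 1. sgn z \<in> E} / emeasure lborel (ball (0 :: complex ^ 'n) 1)"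
proof -
  note borel_measurable_sgn_vec [measurable]
  have sets: "sgn -` E \<in> sets (borel :: (complex ^ 'n) measure)"
    using measurable_sets [OF borel_measurable_sgn_vec assms(1)] by simp
  have "emeasure (sphere_measure :: (complex ^ 'n) measure) E =
          emeasure (distr (uniform_measure lborel (ball 0 1)) borel sgn) E"
    unfolding sphere_measure_def using assms by (intro emeasure_restrict_space) auto
  also have "\<dots> = emeasure (uniform_measure lborel (ball (0 :: complex ^ 'n) 1)) (sgn -` E)"
    using assms by (subst emeasure_distr) auto
  also have "\<dots> = emeasure lborel (ball (0 :: complex ^ 'n) 1 \<inter> sgn -` E)
                    / emeasure lborel (ball (0 :: complex ^ 'n) 1)"
    using sets by (intro emeasure_uniform_measure) auto
  also have "ball (0 :: complex ^ 'n) 1 \<inter> sgn -` E = {z \<in> ball 0 1. sgn z \<in> E}"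
    by auto
  finally show ?thesis .
qed

lemma emeasure_sphere_measure_sphere:
  "emeasure (sphere_measure :: (complex ^ 'n) measure) (sphere 0 1) = 1"
proof -
  have eq: "{z \<in> ball 0 1. sgn z \<in> sphere 0 1} = ball (0 :: complex ^ 'n) 1 - {0}"
    by (auto simp: norm_sgn)
  have "emeasure lborel (ball (0 :: complex ^ 'n) 1 - {0}) = emeasure lborel (ball (0 :: complex ^ 'n) 1)"
    by (subst emeasure_Diff) auto
  moreover have "emeasure lborel (ball (0 :: complex ^ 'n) 1) \<noteq> 0"
    by (simp add: emeasure_ball less_imp_neq [OF unit_ball_vol_pos, symmetric])
  moreover have "emeasure lborel (ball (0 :: complex ^ 'n) 1) \<noteq> \<infinity>"
    by (simp add: emeasure_ball)
  ultimately show ?thesis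
    by (subst emeasure_sphere_measure, simp, simp, subst eq)
       (simp add: ennreal_divide_self top.not_eq_extremum)
qed

definition l2_inner :: "(complex ^ 'n \<Rightarrow> complex) \<Rightarrow> (complex ^ 'n \<Rightarrow> complex) \<Rightarrow> complex" where
  "l2_inner f g = (LINT \<zeta>|sphere_measure. f \<zeta> * cnj (g \<zeta>))"

definition analytic_on_ball :: "(complex ^ 'n \<Rightarrow> complex) \<Rightarrow> bool" where
  "analytic_on_ball h \<longleftrightarrow>
     (\<forall>z \<in> ball 0 1. \<exists>D. Vector_Spaces.linear (*s) (*) D \<and> (h has_derivative D) (at z))"

definition hardy_norm_sq :: "(complex ^ 'n \<Rightarrow> complex) \<Rightarrow> ennreal" where
  "hardy_norm_sq h =
     (SUP r \<in> {0<..<1::real}. \<integral>\<^sup>+ \<zeta>. ennreal ((cmod (h (r *\<^sub>R \<zeta>)))\<^sup>2) \<partial>sphere_measure)"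

text \<open>
  An element of the Hardy space is a function on the open ball; it is represented by its extension
  by \<open>0\<close> to the whole space, so that equality in \<open>H\<^sup>2\<close> is equality of functions in HOL.
\<close>

definition hardy_space :: "(complex ^ 'n \<Rightarrow> complex) set" where
  "hardy_space =
     {h. analytic_on_ball h \<and> hardy_norm_sq h < \<infinity> \<and> (\<forall>z. z \<notin> ball 0 1 \<longrightarrow> h z = 0)}"

definition hardy_norm :: "(complex ^ 'n \<Rightarrow> complex) \<Rightarrow> real" where
  "hardy_norm h = sqrt (enn2real (hardy_norm_sq h))"

text \<open>The radial boundary limit; at the points where it does not exist the value is irrelevant.\<close>

definition radial_limit :: "(complex ^ 'n \<Rightarrow> complex) \<Rightarrow> complex ^ 'n \<Rightarrow> complex" where
  "radial_limit h \<zeta> = Lim (at_left 1) (\<lambda>r::real. h (r *\<^sub>R \<zeta>))"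

text \<open>
  The orthogonal projection of \<open>L\<^sup>2(\<sigma>)\<close> onto \<open>H\<^sup>2\<close>, where \<open>H\<^sup>2\<close> is regarded as a subspace of \<open>L\<^sup>2(\<sigma>)\<close> via
  radial limits. It is meaningful for square-integrable arguments, and its value is the function on
  the ball (not its boundary function).
\<close>

definition hardy_projection :: "(complex ^ 'n \<Rightarrow> complex) \<Rightarrow> (complex ^ 'n \<Rightarrow> complex)" where
  "hardy_projection f =
     (THE h. h \<in> hardy_space \<and>
        (\<forall>g \<in> hardy_space. l2_inner (\<lambda>\<zeta>. f \<zeta> - radial_limit h \<zeta>) (radial_limit g) = 0))"

type_synonym 'n operator = "(complex ^ 'n \<Rightarrow> complex) \<Rightarrow> (complex ^ 'n \<Rightarrow> complex)"

definition toeplitz :: "(complex ^ 'n \<Rightarrow> complex) \<Rightarrow> 'n::finite operator" where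
  "toeplitz f h = hardy_projection (\<lambda>\<zeta>. f \<zeta> * radial_limit h \<zeta>)"

definition composition_op :: "(complex ^ 'n \<Rightarrow> complex ^ 'n) \<Rightarrow> 'n::finite operator" where
  "composition_op \<phi> h = (\<lambda>z. if z \<in> ball 0 1 then h (\<phi> z) else 0)"

text \<open>
  Operators on \<open>H\<^sup>2\<close> are maps of functions of which only the values on \<open>hardy_space\<close> matter.
\<close>

definition bounded_hardy_op :: "'n::finite operator \<Rightarrow> bool" where
  "bounded_hardy_op B \<longleftrightarrow>
     (\<forall>h \<in> hardy_space. B h \<in> hardy_space) \<and>
     (\<forall>h \<in> hardy_space. \<forall>g \<in> hardy_space. B (\<lambda>z. h z + g z) = (\<lambda>z. B h z + B g z)) \<and>
     (\<forall>h \<in> hardy_space. \<forall>c. B (\<lambda>z. c * h z) = (\<lambda>z. c * B h z)) \<and>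
     (\<exists>K. \<forall>h \<in> hardy_space. hardy_norm (B h) \<le> K * hardy_norm h)"

definition hardy_op_norm :: "'n::finite operator \<Rightarrow> ennreal" where
  "hardy_op_norm B = (SUP h \<in> {h \<in> hardy_space. hardy_norm h \<le> 1}. ennreal (hardy_norm (B h)))"

definition toeplitz_shift :: "'n::finite operator \<Rightarrow> 'n operator" where
  "toeplitz_shift B =
     (\<lambda>h z. \<Sum>j\<in>UNIV. toeplitz (\<lambda>\<zeta>. cnj (\<zeta> $ j)) (B (toeplitz (\<lambda>\<zeta>. \<zeta> $ j) h)) z)"

definition uniformly_asymptotically_toeplitz :: "'n::finite operator \<Rightarrow> bool" where
  "uniformly_asymptotically_toeplitz B \<longleftrightarrow>
     bounded_hardy_op B \<and>
     (\<exists>L. bounded_hardy_op L \<and>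
        (\<lambda>m. hardy_op_norm (\<lambda>h z. (toeplitz_shift ^^ m) B h z - L h z)) \<longlonglongrightarrow> 0)"

end

theory Submission
  imports Defs "HOL-Complex_Analysis.Complex_Analysis"
begin

text \<open>
  For linear \<open>\<phi>(z) = Az\<close> one has \<open>\<Phi>\<^sup>m(C\<^sub>\<phi>) h = P(f\<^sup>m (h \<circ> A))\<close> with \<open>f(\<zeta>) = \<langle>A\<zeta>, \<zeta>\<rangle>\<close>. By the equality
  case of the Cauchy-Schwarz inequality, \<open>|f|\<close> reaches \<open>1\<close> on the sphere only at eigenvectors with
  unimodular eigenvalues. If there are none, then \<open>|f| \<le> q < 1\<close> and \<open>\<parallel>\<Phi>\<^sup>m(C\<^sub>\<phi>)\<parallel> \<le> q\<^sup>m\<close>, since \<open>C\<^sub>\<phi>\<close> is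
  a contraction. If \<open>A\<zeta>\<^sub>0 = c\<zeta>\<^sub>0\<close> with \<open>|c| = 1\<close>, the powers of \<open>\<langle>z, \<zeta>\<^sub>0\<rangle>\<close> are eigenvectors of \<open>C\<^sub>\<phi>\<close> whose mass
  concentrates where \<open>f = c\<close>. Testing the Cauchy condition on them would force \<open>c\<^sup>m - c\<^sup>m\<^sup>+\<^sup>1 \<longlongrightarrow> 0\<close>, which is false for
  \<open>c \<noteq> 1\<close>; if \<open>1\<close> is the only unimodular eigenvalue, then \<open>f\<^sup>m \<longlonglongrightarrow> 0\<close> almost everywhere because \<open>A \<noteq> id\<close>, which is
  incompatible with \<open>\<integral> f\<^sup>m |\<langle>\<zeta>, \<zeta>\<^sub>0\<rangle>|\<^sup>2\<^sup>k d\<sigma>\<close> being close to \<open>\<integral> |\<langle>\<zeta>, \<zeta>\<^sub>0\<rangle>|\<^sup>2\<^sup>k d\<sigma>\<close> for large \<open>k\<close>.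

  Radial limits exist almost everywhere by an \<open>L\<^sup>2\<close> maximal inequality, which is proved by duality
  from the semigroup property of the Poisson kernels on the slices of the sphere. That \<open>C\<^sub>\<phi>\<close> is a
  contraction follows from the maximum principle: the subharmonic function
  \<open>B \<mapsto> \<integral> |h(rB\<zeta>)|\<^sup>2 d\<sigma>(\<zeta>)\<close> on the contractive matrices is largest at unitary ones.
\<close>

subsection \<open>Invariance of the sphere and circle measures\<close>

text \<open>\<open>toeplitz\<close> acts through the projection of boundary values, and
  \<open>hardy_projection\<close> is a \<open>THE\<close>-description, so nothing can be computed
  before the boundary theory of the Hardy space is available: radial limits, the isometry into the
  square-integrable functions, completeness, existence and uniqueness of the projection. All of this
  is reduced to one variable. For \<open>z\<close> on the sphere the slice \<open>h (t *s z)\<close>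
  is holomorphic in \<open>t\<close>, and the rotations \<open>w *s z\<close> with
  \<open>cmod w = 1\<close> preserve the surface measure; hence Poisson means on circles, which have
  mass one, are symmetric and multiply their parameters, take the place of Taylor expansions and
  polar coordinates.

  In the necessity part the order of the choices matters. The Cauchy condition fixes the exponents
  \<open>m\<close> uniformly in the test functions; only then is the power \<open>k\<close> chosen,
  depending on \<open>m\<close>, because \<open>f ^ m\<close> is close to \<open>c ^ m\<close> only
  on a region that shrinks as \<open>m\<close> grows. The argument thus contradicts uniform
  convergence and says nothing against convergence at each fixed function.\<close>

lemma ball_in_borel [measurable]: "ball x r \<in> sets (borel :: 'a::metric_space measure)"
  by simp

lemma sphere_in_borel [measurable]: "sphere x r \<in> sets (borel :: 'a::real_normed_vector measure)"
  unfolding sphere_def by (intro borel_closed closed_Collect_eq continuous_intros)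

lemma nn_integral_lborel_shift:
  fixes f :: "'a::euclidean_space \<Rightarrow> ennreal"
  assumes [measurable]: "f \<in> borel_measurable borel"
  shows "(\<integral>\<^sup>+x. f (c + x) \<partial>lborel) = (\<integral>\<^sup>+x. f x \<partial>lborel)"
proof -
  have "(\<integral>\<^sup>+x. f x \<partial>lborel) = (\<integral>\<^sup>+x. f x \<partial>distr lborel borel ((+) c))"
    by (simp add: lborel_distr_plus)
  also have "\<dots> = (\<integral>\<^sup>+x. f (c + x) \<partial>lborel)"
    by (rule nn_integral_distr) auto
  finally show ?thesis by simp
qed

text \<open>
  Uniqueness of Haar measure, specialized: both iterated integrals of
  \<open>1\<^sub>E (T x) 1\<^sub>B (y - T x)\<close> are evaluated by translation invariance.
\<close>

lemma lborel_distr_isometry: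
  fixes T :: "'a::euclidean_space \<Rightarrow> 'a"
  assumes lin: "linear T" and iso: "\<And>x. norm (T x) = norm x"
  shows "distr lborel borel T = lborel"
proof (rule measure_eqI)
  show "sets (distr lborel borel T) = sets lborel" by simp
  fix E assume "E \<in> sets (distr lborel borel T)"
  then have E[measurable]: "E \<in> sets borel" by simp
  have T[measurable]: "T \<in> borel_measurable borel"
    by (intro borel_measurable_continuous_onI linear_continuous_on linear_conv_bounded_linear[THEN iffD1] lin)
  have "inj T"
    using lin iso by (metis linear_injective_0 norm_eq_zero)
  then have "surj T" using lin linear_injective_imp_surjective by auto
  then obtain S where S: "\<And>y. T (S y) = y" by (metis surjD)
  define B where "B = ball (0::'a) 1"
  have B[measurable]: "B \<in> sets borel" by (simp add: B_def)
  have "emeasure (distr lborel borel T) E * emeasure lborel B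
      = (\<integral>\<^sup>+x. indicator E (T x) * emeasure lborel B \<partial>lborel)"
  proof -
    have "emeasure (distr lborel borel T) E = (\<integral>\<^sup>+x. indicator E x \<partial>distr lborel borel T)"
      by (rule nn_integral_indicator[symmetric]) simp
    also have "\<dots> = (\<integral>\<^sup>+x. indicator E (T x) \<partial>lborel)"
      by (rule nn_integral_distr) auto
    finally show ?thesis by (simp add: nn_integral_multc)
  qed
  also have "\<dots> = (\<integral>\<^sup>+x. \<integral>\<^sup>+y. indicator E (T x) * indicator B (- T x + y) \<partial>lborel \<partial>lborel)"
    by (intro nn_integral_cong, subst nn_integral_cmult, measurable, subst nn_integral_lborel_shift) simp_all
  also have "\<dots> = (\<integral>\<^sup>+y. \<integral>\<^sup>+x. indicator E (T x) * indicator B (- T x + y) \<partial>lborel \<partial>lborel)"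
    by (rule lborel_pair.Fubini') measurable
  also have "\<dots> = (\<integral>\<^sup>+y. \<integral>\<^sup>+x. indicator E (T (S y + x)) * indicator B (- T (S y + x) + y) \<partial>lborel \<partial>lborel)"
    by (intro nn_integral_cong nn_integral_lborel_shift[symmetric]) measurable
  \<comment> \<open>Here the isometry enters: as \<open>B\<close> is a ball about 0,
    \<open>- T x\<close> lies in \<open>B\<close> exactly when \<open>x\<close> does.\<close>
  also have "\<dots> = (\<integral>\<^sup>+y. \<integral>\<^sup>+x. indicator E (T x + y) * indicator B x \<partial>lborel \<partial>lborel)"
    by (intro nn_integral_cong) (simp add: linear_add[OF lin] S B_def iso indicator_def add.commute)
  also have "\<dots> = (\<integral>\<^sup>+x. \<integral>\<^sup>+y. indicator E (T x + y) * indicator B x \<partial>lborel \<partial>lborel)"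
    by (rule lborel_pair.Fubini') measurable
  also have "\<dots> = (\<integral>\<^sup>+x. emeasure lborel E * indicator B x \<partial>lborel)"
    by (subst nn_integral_multc) (simp_all add: nn_integral_lborel_shift)
  also have "\<dots> = emeasure lborel E * emeasure lborel B"
    by (simp add: nn_integral_cmult)
  finally have *: "emeasure (distr lborel borel T) E * emeasure lborel B = emeasure lborel E * emeasure lborel B" .
  have "emeasure lborel B \<noteq> 0" "emeasure lborel B \<noteq> top"
    by (simp_all add: B_def emeasure_ball less_imp_neq [OF unit_ball_vol_pos, symmetric])
  with * show "emeasure (distr lborel borel T) E = emeasure lborel E"
    by (metis ennreal_mult_cancel_left mult.commute)
qed

lemma nn_integral_lborel_isometry:
  fixes T :: "'a::euclidean_space \<Rightarrow> 'a"
  assumes "linear T" "\<And>x. norm (T x) = norm x" and [measurable]: "f \<in> borel_measurable borel"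
  shows "(\<integral>\<^sup>+x. f (T x) \<partial>lborel) = (\<integral>\<^sup>+x. f x \<partial>lborel)"
proof -
  have [measurable]: "T \<in> borel_measurable borel"
    by (intro borel_measurable_continuous_onI linear_continuous_on linear_conv_bounded_linear[THEN iffD1] assms)
  have "(\<integral>\<^sup>+x. f x \<partial>lborel) = (\<integral>\<^sup>+x. f x \<partial>distr lborel borel T)"
    by (simp add: lborel_distr_isometry assms)
  also have "\<dots> = (\<integral>\<^sup>+x. f (T x) \<partial>lborel)"
    by (rule nn_integral_distr) auto
  finally show ?thesis by simp
qed

abbreviation ball_vol :: "'a::euclidean_space itself \<Rightarrow> ennreal" where
  "ball_vol _ \<equiv> emeasure lborel (ball (0::'a) 1)"

lemma ball_vol_finite_pos: "ball_vol TYPE('a::euclidean_space) \<noteq> 0" "ball_vol TYPE('a) \<noteq> top"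
  by (simp_all add: emeasure_ball less_imp_neq [OF unit_ball_vol_pos, symmetric])

lemma measurable_id_sphere_measure [measurable]: "(\<lambda>x. x) \<in> sphere_measure \<rightarrow>\<^sub>M borel"
  by (subst measurable_cong_sets[OF sets_sphere_measure refl]) (rule measurable_restrict_space1, simp)

lemma measurable_sphere_measure:
  "f \<in> borel \<rightarrow>\<^sub>M M \<Longrightarrow> f \<in> sphere_measure \<rightarrow>\<^sub>M M"
  by (subst measurable_cong_sets[OF sets_sphere_measure refl]) (rule measurable_restrict_space1)

lemma finite_measure_sphere_measure: "finite_measure (sphere_measure :: (complex^'n) measure)"
  by (rule finite_measureI) (simp add: emeasure_sphere_measure_sphere)

lemma nn_integral_sphere_measure:
  fixes f :: "complex^'n \<Rightarrow> ennreal"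
  assumes [measurable]: "f \<in> borel_measurable borel"
  shows "(\<integral>\<^sup>+\<zeta>. f \<zeta> \<partial>sphere_measure)
       = (\<integral>\<^sup>+z. f (sgn z) * indicator (ball 0 1) z \<partial>lborel) / ball_vol TYPE(complex^'n)"
proof -
  note borel_measurable_sgn_vec [measurable, simp]
  let ?U = "uniform_measure lborel (ball (0::complex^'n) 1)"
  have [simp]: "sgn \<in> ?U \<rightarrow>\<^sub>M borel"
    by (subst measurable_cong_sets[OF sets_uniform_measure refl]) simp
  have [simp]: "(\<lambda>\<zeta>. f \<zeta> * indicator (sphere 0 1) \<zeta>) \<in> borel_measurable borel"
    by measurable
  \<comment> \<open>The origin must be discarded, since \<open>sgn 0 = 0\<close> is not on the
    sphere.\<close>
  have ae: "AE z in ?U. sgn z \<in> sphere 0 1"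
  proof -
    have "AE z in lborel. z \<noteq> (0::complex^'n)"
      by (rule AE_lborel_singleton)
    then show ?thesis
      by (intro AE_uniform_measureI) (auto simp: norm_sgn)
  qed
  have "(\<integral>\<^sup>+\<zeta>. f \<zeta> \<partial>sphere_measure)
     = (\<integral>\<^sup>+\<zeta>. f \<zeta> * indicator (sphere 0 1) \<zeta> \<partial>distr ?U borel sgn)"
    unfolding sphere_measure_def by (subst nn_integral_restrict_space) auto
  also have "\<dots> = (\<integral>\<^sup>+z. f (sgn z) * indicator (sphere 0 1) (sgn z) \<partial>?U)"
    by (subst nn_integral_distr) simp_all
  also have "\<dots> = (\<integral>\<^sup>+z. f (sgn z) \<partial>?U)"
    by (rule nn_integral_cong_AE) (use ae in auto)
  also have "\<dots> = (\<integral>\<^sup>+z. f (sgn z) * indicator (ball 0 1) z \<partial>lborel) / ball_vol TYPE(complex^'n)"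
    by (rule nn_integral_uniform_measure) auto
  finally show ?thesis .
qed

text \<open>A linear isometry commutes with \<open>sgn\<close> and preserves the ball, so the cone
  measure inherits the invariance of Lebesgue measure.\<close>

lemma nn_integral_sphere_measure_isometry:
  fixes f :: "complex^'n \<Rightarrow> ennreal" and T :: "complex^'n \<Rightarrow> complex^'n"
  assumes T: "linear T" "\<And>x. norm (T x) = norm x" and f[measurable]: "f \<in> borel_measurable borel"
  shows "(\<integral>\<^sup>+\<zeta>. f (T \<zeta>) \<partial>sphere_measure) = (\<integral>\<^sup>+\<zeta>. f \<zeta> \<partial>sphere_measure)"
proof -
  note borel_measurable_sgn_vec [measurable]
  have [measurable]: "T \<in> borel_measurable borel"
    by (intro borel_measurable_continuous_onI linear_continuous_on linear_conv_bounded_linear[THEN iffD1] T)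
  have "(\<integral>\<^sup>+z. f (sgn z) * indicator (ball 0 1) z \<partial>lborel)
     = (\<integral>\<^sup>+z. f (sgn (T z)) * indicator (ball 0 1) (T z) \<partial>lborel)"
    by (rule nn_integral_lborel_isometry[where T=T, OF T, symmetric]) measurable
  also have "\<dots> = (\<integral>\<^sup>+z. f (T (sgn z)) * indicator (ball 0 1) z \<partial>lborel)"
    by (intro nn_integral_cong) (simp add: sgn_div_norm T linear_scale indicator_def)
  finally show ?thesis by (simp add: nn_integral_sphere_measure)
qed

lemma linear_cscale: "linear (\<lambda>z::complex^'n. c *s z)"
  by (rule linearI) (auto simp: vector_add_ldistrib vec_eq_iff algebra_simps)

lemma norm_cscale: "norm (c *s (z::complex^'n)) = cmod c * norm z"
  by (simp add: norm_vec_def L2_set_def norm_mult power_mult_distrib sum_distrib_left[symmetric] real_sqrt_mult)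

lemma continuous_on_cscale [continuous_intros]:
  fixes f :: "'a::topological_space \<Rightarrow> complex" and g :: "'a \<Rightarrow> complex^'n"
  assumes "continuous_on S f" "continuous_on S g"
  shows "continuous_on S (\<lambda>x. f x *s g x)"
  unfolding vector_scalar_mult_def by (intro continuous_intros assms)

lemma borel_measurable_cscale [measurable (raw)]:
  fixes f :: "'a \<Rightarrow> complex" and g :: "'a \<Rightarrow> complex^'n"
  assumes [measurable]: "f \<in> borel_measurable M" "g \<in> borel_measurable M"
  shows "(\<lambda>x. f x *s g x) \<in> borel_measurable M"
  by (rule borel_measurable_continuous_Pair[where H="\<lambda>x y. x *s y"]) (auto intro!: continuous_intros)


section \<open>Normalized arc length on the unit circle\<close>

definition circle_param :: "real \<Rightarrow> complex" where
  "circle_param t = exp (2 * of_real pi * \<i> * of_real t)"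

text \<open>Kept as a Borel measure on all of \<open>complex\<close>, concentrated on the circle, so
  that measurability is that of the ambient space.\<close>

definition circle_measure :: "complex measure" where
  "circle_measure = distr (uniform_measure lborel {0..1}) borel circle_param"

lemma space_circle_measure [simp]: "space circle_measure = UNIV"
  and sets_circle_measure [measurable_cong, simp]: "sets circle_measure = sets borel"
  by (simp_all add: circle_measure_def)

lemma borel_measurable_circle_param: "circle_param \<in> borel_measurable borel"
  unfolding circle_param_def [abs_def] by (intro borel_measurable_continuous_onI continuous_intros)

lemma continuous_on_circle_param: "continuous_on S circle_param"
  unfolding circle_param_def [abs_def] by (intro continuous_intros)

lemma norm_circle_param [simp]: "cmod (circle_param t) = 1"
  by (simp add: circle_param_def)

lemma circle_param_add: "circle_param (s + t) = circle_param s * circle_param t"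
  by (simp add: circle_param_def ring_distribs exp_add)

lemma circle_param_1: "circle_param (t + 1) = circle_param t"
  using exp_plus_2pin[of "2 * of_real pi * \<i> * of_real t" 1] by (simp add: circle_param_def algebra_simps)

lemma nn_integral_circle_measure:
  assumes [measurable]: "f \<in> borel_measurable borel"
  shows "(\<integral>\<^sup>+w. f w \<partial>circle_measure) = (\<integral>\<^sup>+t. f (circle_param t) * indicator {0..<1} t \<partial>lborel)"
proof -
  note borel_measurable_circle_param [measurable, simp]
  have "(\<integral>\<^sup>+w. f w \<partial>circle_measure) = (\<integral>\<^sup>+t. f (circle_param t) \<partial>uniform_measure lborel {0..1})"
    unfolding circle_measure_def
    by (rule nn_integral_distr) (subst measurable_cong_sets[OF sets_uniform_measure refl], auto)
  also have "\<dots> = (\<integral>\<^sup>+t. f (circle_param t) * indicator {0..1} t \<partial>lborel)"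
    by (subst nn_integral_uniform_measure) (auto simp: divide_ennreal_def)
  \<comment> \<open>The endpoint 1 is dropped so that translates of the interval fit together
    without overlap.\<close>
  also have "\<dots> = (\<integral>\<^sup>+t. f (circle_param t) * indicator {0..<1} t \<partial>lborel)"
    by (rule nn_integral_cong_AE, rule AE_mp[OF AE_lborel_singleton[of "1::real"]]) (auto simp: indicator_def)
  finally show ?thesis .
qed

lemma emeasure_circle_measure: "emeasure circle_measure UNIV = 1"
  using nn_integral_circle_measure[of "\<lambda>_. 1"] by simp

lemma finite_measure_circle_measure: "finite_measure circle_measure"
  by (rule finite_measureI) (simp add: emeasure_circle_measure)

lemma AE_circle_measure: "AE w in circle_measure. cmod w = 1"
proof -
  have "(\<integral>\<^sup>+w. indicator {w. cmod w \<noteq> 1} w \<partial>circle_measure) = 0"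
    by (subst nn_integral_circle_measure) auto
  then have "emeasure circle_measure {w. cmod w \<noteq> 1} = 0"
    by (subst (asm) nn_integral_indicator) auto
  then show ?thesis by (auto simp: AE_iff_null_sets intro!: null_setsI AE_I'[of "{w. cmod w \<noteq> 1}"])
qed

text \<open>Rotation by \<open>circle_param s\<close> translates the parameter by \<open>s\<close>;
  the shifted period \<open>{s..<1+s}\<close> is cut at 1 and its second piece is moved back by one
  period.\<close>

lemma nn_integral_circle_rotate:
  assumes [measurable]: "f \<in> borel_measurable borel" and u: "cmod u = 1"
  shows "(\<integral>\<^sup>+w. f (u * w) \<partial>circle_measure) = (\<integral>\<^sup>+w. f w \<partial>circle_measure)"
proof -
  note borel_measurable_circle_param [measurable]
  obtain s where s: "0 \<le> s" "s \<le> 1" "u = circle_param s"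
  proof -
    have "0 \<le> Arg2pi u / (2 * pi)" "Arg2pi u / (2 * pi) \<le> 1"
      using Arg2pi[of u] by (auto simp: less_imp_le)
    moreover have "u = circle_param (Arg2pi u / (2 * pi))"
      using Arg2pi_eq[of u] u by (simp add: circle_param_def mult_ac)
    ultimately show ?thesis by (rule that)
  qed
  let ?G = "\<lambda>t. f (circle_param t)"
  have "(\<integral>\<^sup>+w. f (u * w) \<partial>circle_measure) = (\<integral>\<^sup>+t. ?G (s + t) * indicator {0..<1} t \<partial>lborel)"
    by (subst nn_integral_circle_measure) (simp_all only: s(3) circle_param_add, measurable)
  also have "\<dots> = (\<integral>\<^sup>+t. ?G (s + (-s + t)) * indicator {0..<1} (-s + t) \<partial>lborel)"
    by (rule nn_integral_lborel_shift[symmetric]) simp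
  also have "\<dots> = (\<integral>\<^sup>+t. ?G t * indicator {s..<1} t + ?G t * indicator {1..<1+s} t \<partial>lborel)"
    by (intro nn_integral_cong) (use s in \<open>auto simp: indicator_def\<close>)
  also have "\<dots> = (\<integral>\<^sup>+t. ?G t * indicator {s..<1} t \<partial>lborel) + (\<integral>\<^sup>+t. ?G t * indicator {1..<1+s} t \<partial>lborel)"
    by (rule nn_integral_add) auto
  also have "(\<integral>\<^sup>+t. ?G t * indicator {1..<1+s} t \<partial>lborel)
     = (\<integral>\<^sup>+t. ?G (1 + t) * indicator {1..<1+s} (1 + t) \<partial>lborel)"
    by (rule nn_integral_lborel_shift[symmetric]) simp
  also have "\<dots> = (\<integral>\<^sup>+t. ?G t * indicator {0..<s} t \<partial>lborel)"
    by (intro nn_integral_cong) (auto simp: indicator_def circle_param_1 add.commute[of 1])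
  also have "(\<integral>\<^sup>+t. ?G t * indicator {s..<1} t \<partial>lborel) + (\<integral>\<^sup>+t. ?G t * indicator {0..<s} t \<partial>lborel)
     = (\<integral>\<^sup>+t. ?G t * indicator {s..<1} t + ?G t * indicator {0..<s} t \<partial>lborel)"
    by (rule nn_integral_add[symmetric]) auto
  also have "\<dots> = (\<integral>\<^sup>+t. ?G t * indicator {0..<1} t \<partial>lborel)"
    by (intro nn_integral_cong) (use s in \<open>auto simp: indicator_def\<close>)
  also have "\<dots> = (\<integral>\<^sup>+w. f w \<partial>circle_measure)"
    by (simp add: nn_integral_circle_measure)
  finally show ?thesis .
qed

lemma nn_integral_circle_cnj:
  assumes [measurable]: "f \<in> borel_measurable borel"
  shows "(\<integral>\<^sup>+w. f (cnj w) \<partial>circle_measure) = (\<integral>\<^sup>+w. f w \<partial>circle_measure)"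
proof -
  note borel_measurable_circle_param [measurable]
  have [measurable]: "cnj \<in> borel_measurable borel"
    by (intro borel_measurable_continuous_onI continuous_intros)
  let ?G = "\<lambda>t. f (circle_param t)"
  have cnj: "cnj (circle_param t) = circle_param (-t)" for t
    by (simp add: circle_param_def exp_cnj)
  have "(\<integral>\<^sup>+w. f (cnj w) \<partial>circle_measure) = (\<integral>\<^sup>+t. ?G (-t) * indicator {0..<1} t \<partial>lborel)"
    by (subst nn_integral_circle_measure) (simp_all only: cnj, measurable)
  also have "\<dots> = (\<integral>\<^sup>+t. ?G (-(-t)) * indicator {0..<1} (-t) \<partial>lborel)"
    by (rule nn_integral_lborel_isometry[symmetric]) (auto simp: linear_iff)
  \<comment> \<open>Reflection has produced the parameters with \<open>-1 < t \<le> 0\<close>; a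
    shift by one period brings them to \<open>{0<..1}\<close>.\<close>
  also have "\<dots> = (\<integral>\<^sup>+t. ?G (-1 + t) * indicator {0..<1} (- (-1 + t)) \<partial>lborel)"
    by (simp only: minus_minus) (rule nn_integral_lborel_shift[symmetric], simp)
  also have "\<dots> = (\<integral>\<^sup>+t. ?G t * indicator {0<..1} t \<partial>lborel)"
    using circle_param_1[of "_ - 1"]
    by (intro nn_integral_cong) (auto simp: indicator_def)
  also have "\<dots> = (\<integral>\<^sup>+t. ?G t * indicator {0..<1} t \<partial>lborel)"
    by (rule nn_integral_cong_AE, rule AE_mp[OF AE_lborel_singleton[of "1::real"]],
        rule AE_mp[OF AE_lborel_singleton[of "0::real"]]) (auto simp: indicator_def)
  finally show ?thesis by (simp add: nn_integral_circle_measure)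
qed

text \<open>Bridge between the Bochner integral and the gauge integral in which contour integrals
  are expressed.\<close>

lemma integral_circle_measure:
  fixes f :: "complex \<Rightarrow> complex"
  assumes cont: "continuous_on (sphere 0 1) f" and [measurable]: "f \<in> borel_measurable borel"
  shows "integrable circle_measure f" "(LINT w|circle_measure. f w) = integral {0..1} (\<lambda>t. f (circle_param t))"
proof -
  note borel_measurable_circle_param [measurable]
  have pm: "circle_param \<in> uniform_measure lborel {0..1} \<rightarrow>\<^sub>M borel"
    by (subst measurable_cong_sets[OF sets_uniform_measure refl]) measurable
  have U: "uniform_measure lborel {0..1} = density lborel (indicator {0..1::real})"
    unfolding uniform_measure_def by (rule density_cong) (auto simp: divide_ennreal_def)
  have c: "continuous_on {0..1} (\<lambda>t. f (circle_param t))"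
    by (rule continuous_on_compose2[OF cont continuous_on_circle_param]) auto
  have i: "set_integrable lborel {0..1} (\<lambda>t. f (circle_param t))"
    using borel_integrable_compact[OF _ c] by (auto simp: set_integrable_def indicator_scaleR_eq_if)
  have D: "density lborel (indicator {0..1::real}) = density lborel (\<lambda>x. ennreal (indicator {0..1} x))"
    by (rule density_cong) (auto simp: indicator_def)
  show "integrable circle_measure f"
    unfolding circle_measure_def using i pm
    by (subst integrable_distr_eq) (auto simp: U D integrable_density set_integrable_def)
  have "(LINT w|circle_measure. f w) = (LINT t|uniform_measure lborel {0..1}. f (circle_param t))"
    unfolding circle_measure_def by (rule integral_distr[OF pm]) simp
  also have "\<dots> = (LINT t:{0..1}|lborel. f (circle_param t))"
    by (simp add: U D integral_density set_lebesgue_integral_def)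
  also have "\<dots> = integral {0..1} (\<lambda>t. f (circle_param t))"
    by (rule set_borel_integral_eq_integral[OF i])
  finally show "(LINT w|circle_measure. f w) = integral {0..1} (\<lambda>t. f (circle_param t))" .
qed

text \<open>The Poisson kernel of the disc at the real point \<open>a\<close>: for
  \<open>cmod w = 1\<close> the denominator equals \<open>(cmod (w - a))\<^sup>2\<close>. Points off
  the real axis are reached by rotating the slice.\<close>

definition poisson :: "real \<Rightarrow> complex \<Rightarrow> real" where
  "poisson a w = (1 - a\<^sup>2) / (cmod (1 - a * w))\<^sup>2"

lemma borel_measurable_poisson [measurable]: "poisson a \<in> borel_measurable borel"
  unfolding poisson_def by measurable

lemma poisson_nonneg: "0 \<le> a \<Longrightarrow> a < 1 \<Longrightarrow> 0 \<le> poisson a w"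
  by (simp add: poisson_def power_le_one)

lemma poisson_cnj: "poisson a (cnj w) = poisson a w"
proof -
  have "cmod (1 - a * cnj w) = cmod (cnj (1 - a * w))" by simp
  then show ?thesis by (simp only: poisson_def complex_mod_cnj)
qed

text \<open>As \<open>r \<le> s\<close>, the product \<open>r * s\<close> lies between
  \<open>r\<^sup>2\<close> and \<open>r\<close>. Passing from \<open>r\<close> to
  \<open>r * s\<close> therefore at most doubles the numerator and divides the squared denominator
  by at most 4, whence 8 = 2 * 4.\<close>

lemma poisson_mult_le:
  assumes "0 \<le> r" "r \<le> s" "s < 1" "cmod w = 1"
  shows "poisson (r * s) w \<le> 8 * poisson r w"
proof -
  define q where "q = r * s"
  have q: "0 \<le> q" "q \<le> r" "r\<^sup>2 \<le> q" "q < 1"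
    using assms mult_left_mono[of s 1 r] mult_left_mono[of r s r] by (auto simp: q_def power2_eq_square)
  have pos: "cmod (1 - t * w) \<ge> 1 - t" if "0 \<le> t" for t :: real
    using norm_triangle_ineq2[of 1 "t * w"] that assms(4) by (simp add: norm_mult)
  have "cmod (1 - r * w) \<le> cmod (1 - q * w) + cmod ((q - r) * w)"
    using norm_triangle_ineq[of "1 - q * w" "(q - r) * w"] by (simp add: algebra_simps)
  also have "cmod ((q - r) * w) = r - q"
  proof -
    have "cmod ((q - r) * w) = cmod (complex_of_real (q - r))" using assms(4) by (simp add: norm_mult)
    then show ?thesis using q by (simp del: of_real_diff add: norm_of_real)
  qed
  also have "r - q \<le> cmod (1 - q * w)"
    using pos[of q] q assms by linarith
  finally have le: "cmod (1 - r * w) \<le> 2 * cmod (1 - q * w)" by simp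
  have num: "1 - q\<^sup>2 \<le> 2 * (1 - r\<^sup>2)"
  proof -
    have "(r\<^sup>2)\<^sup>2 \<le> q\<^sup>2" using q by (intro power_mono) auto
    moreover have "r\<^sup>2 \<le> 1" using assms by (simp add: power_le_one)
    then have "(1 - r\<^sup>2) * (1 - r\<^sup>2) \<ge> 0" by simp
    ultimately show ?thesis by (simp add: power2_eq_square algebra_simps)
  qed
  have p1: "0 < cmod (1 - r * w)" using pos[of r] assms by linarith
  have "poisson q w \<le> (2 * (1 - r\<^sup>2)) / (cmod (1 - r * w) / 2)\<^sup>2"
    unfolding poisson_def using p1 le q num by (intro frac_le power_mono) (auto simp: power_le_one)
  also have "\<dots> = 8 * poisson r w" by (simp add: poisson_def power_divide)
  finally show ?thesis by (simp add: q_def)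
qed

subsection \<open>Poisson means on slices\<close>

text \<open>Cauchy's formula at \<open>a\<close>, to which a holomorphic term of integral zero is
  added: on the circle \<open>z / (z - a) + a * z / (1 - a * z)\<close> is the Poisson
  kernel.\<close>

lemma poisson_formula:
  fixes F :: "complex \<Rightarrow> complex"
  assumes hol: "F holomorphic_on ball 0 R" and R: "1 < R" and a: "0 \<le> a" "a < 1"
    and [measurable]: "F \<in> borel_measurable borel"
  shows "integrable circle_measure (\<lambda>w. poisson a w * F w)"
    "(LINT w|circle_measure. poisson a w * F w) = F a"
proof -
  have nz: "1 - a * z \<noteq> 0" if "cmod z \<le> 1" for z :: complex
  proof
    assume "1 - a * z = 0"
    then have "1 = a * z" by (simp only: right_minus_eq)
    then have "cmod (a * z) = 1" by (metis norm_one)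
    moreover have "cmod (a * z) \<le> a * 1" using mult_left_mono[of "cmod z" 1 a] that a by (simp add: norm_mult)
    ultimately show False using a by linarith
  qed
  have sub: "cball 0 1 \<subseteq> ball (0::complex) R" using R by auto
  have hol1: "F holomorphic_on cball 0 1" by (rule holomorphic_on_subset[OF hol sub])
  have c1: "continuous_on (cball 0 1) F" by (rule holomorphic_on_imp_continuous_on[OF hol1])
  have "((\<lambda>z. F z / (z - a)) has_contour_integral (2 * complex_of_real pi * \<i> * F a)) (circlepath 0 1)"
    using a by (intro Cauchy_integral_circlepath c1 holomorphic_on_subset[OF hol1]) auto
  moreover have "((\<lambda>z. F z * a / (1 - a * z)) has_contour_integral 0) (circlepath 0 1)"
  proof -
    \<comment> \<open>The added term has its pole at \<open>1 / a\<close>, outside the closed unit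
      disc; \<open>R'\<close> keeps the disc inside the domain of \<open>F\<close> and away from
      this pole.\<close>
    define R' where "R' = (if a = 0 then R else min R (1 / a))"
    have R': "1 < R'" "R' \<le> R" using R a by (auto simp: R'_def)
    have nz': "1 - a * z \<noteq> 0" if "cmod z < R'" for z :: complex
    proof
      assume eq: "1 - a * z = 0"
      then have "1 = a * z" by (simp only: right_minus_eq)
    then have "cmod (a * z) = 1" by (metis norm_one)
      then have "a * cmod z = 1" "a \<noteq> 0" using a by (auto simp: norm_mult)
      then show False using that by (simp add: R'_def divide_simps mult.commute[of a] split: if_splits)
    qed
    have "(\<lambda>z. F z * a / (1 - a * z)) holomorphic_on ball 0 R'"
      using nz' R' by (intro holomorphic_intros holomorphic_on_subset[OF hol]) auto
    then show ?thesis
      by (rule Cauchy_theorem_disc_simple) (use R' in auto)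
  qed
  ultimately have "((\<lambda>z. F z / (z - a) + F z * a / (1 - a * z)) has_contour_integral (2 * complex_of_real pi * \<i> * F a + 0)) (circlepath 0 1)"
    by (rule has_contour_integral_add)
  then have "((\<lambda>t. (F (circle_param t) / (circle_param t - a) + F (circle_param t) * a / (1 - a * circle_param t))
      * (2 * complex_of_real pi * \<i> * circle_param t)) has_integral (2 * complex_of_real pi * \<i> * F a)) {0..1}"
    unfolding has_contour_integral add_0_right
    by (simp only: vector_derivative_circlepath) (simp add: circlepath circle_param_def)
  moreover have "(F z / (z - a) + F z * a / (1 - a * z)) * (2 * complex_of_real pi * \<i> * z)
     = (2 * complex_of_real pi * \<i>) * (poisson a z * F z)" if z: "cmod z = 1" for z :: complex
  proof -
    have zz: "z * cnj z = 1" using z by (simp add: complex_norm_square[symmetric])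
    have z0: "z \<noteq> 0" "1 - a * z \<noteq> 0" "1 - a * cnj z \<noteq> 0" using nz[of z] nz[of "cnj z"] z by auto
    have za: "z - a = z * (1 - a * cnj z)" using zz by (simp add: algebra_simps)
    have "(cmod (1 - a * z))\<^sup>2 = (1 - a * z) * (1 - a * cnj z)"
      using complex_norm_square[of "1 - a * z"] by simp
    then have "complex_of_real (poisson a z) = (1 - a\<^sup>2) / ((1 - a * z) * (1 - a * cnj z))"
      by (simp add: poisson_def)
    also have "\<dots> = z / (z - a) + a * z / (1 - a * z)"
      unfolding za using z0 zz by (simp add: divide_simps power2_eq_square) (simp add: algebra_simps)
    finally show ?thesis by (simp add: algebra_simps)
  qed
  ultimately have H: "((\<lambda>t. (2 * complex_of_real pi * \<i>) * (poisson a (circle_param t) * F (circle_param t)))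
      has_integral (2 * complex_of_real pi * \<i> * F a)) {0..1}"
    by (elim has_integral_eq[rotated]) simp
  have cancel: "inverse (2 * complex_of_real pi * \<i>) * (2 * complex_of_real pi * \<i> * x) = x" for x
    by (simp add: field_simps)
  have I: "integral {0..1} (\<lambda>t. poisson a (circle_param t) * F (circle_param t)) = F a"
    using has_integral_mult_right[OF H, of "inverse (2 * complex_of_real pi * \<i>)"] unfolding cancel
    by (rule integral_unique)
  have "continuous_on (sphere 0 1) (\<lambda>w. complex_of_real (poisson a w) * F w)"
    unfolding poisson_def using nz
    by (intro continuous_intros continuous_on_subset[OF c1]) auto
  from integral_circle_measure[OF this] I
  show "integrable circle_measure (\<lambda>w. poisson a w * F w)"
    "(LINT w|circle_measure. poisson a w * F w) = F a" by simp_all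
qed


lemma borel_measurable_cnj [measurable]: "cnj \<in> borel_measurable borel"
  by (intro borel_measurable_continuous_onI continuous_intros)

lemma nn_integral_poisson:
  assumes a: "0 \<le> a" "a < 1"
  shows "(\<integral>\<^sup>+w. ennreal (poisson a w) \<partial>circle_measure) = 1"
proof -
  have *: "integrable circle_measure (\<lambda>w. complex_of_real (poisson a w))"
     "(LINT w|circle_measure. complex_of_real (poisson a w)) = 1"
    using poisson_formula[of "\<lambda>_. 1" 2 a] a by simp_all
  then have "integrable circle_measure (poisson a)" "(LINT w|circle_measure. poisson a w) = 1"
    by (simp_all only: complex_of_real_integrable_eq integral_complex_of_real of_real_eq_1_iff)
  then show ?thesis
    by (subst nn_integral_eq_integral) (auto simp: poisson_nonneg a)
qed

text \<open>The semigroup law of the kernels. On the circle \<open>poisson a (cnj v * w)\<close> is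
  the real part of the Herglotz kernel \<open>(1 + a * cnj v * w) / (1 - a * cnj v * w)\<close>, to
  which the Poisson formula at \<open>b\<close> applies.\<close>

lemma poisson_convolution:
  assumes a: "0 \<le> a" "a < 1" and b: "0 \<le> b" "b < 1" and v: "cmod v = 1"
  shows "(\<integral>\<^sup>+w. ennreal (poisson b w * poisson a (cnj v * w)) \<partial>circle_measure) = poisson (b * a) v"
proof -
  define F where "F z = (1 + a * cnj v * z) / (1 - a * cnj v * z)" for z :: complex
  define R where "R = (if a = 0 then 2 else 1 / a)"
  have R: "1 < R" using a by (auto simp: R_def)
  have nz: "1 - a * cnj v * z \<noteq> 0" if "cmod z < R" for z :: complex
  proof
    assume "1 - a * cnj v * z = 0"
    then have "1 = a * cnj v * z" by (simp only: right_minus_eq)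
    then have "cmod (a * cnj v * z) = 1" by (metis norm_one)
    then have "a * cmod z = 1" "a \<noteq> 0" using a v by (auto simp: norm_mult)
    then show False using that by (simp add: R_def divide_simps mult.commute[of a] split: if_splits)
  qed
  \<comment> \<open>Stated on the whole disc and not just on the circle, because it is finally
    evaluated at \<open>b\<close>, where it yields \<open>poisson (b * a)\<close>.\<close>
  have Re_F: "Re (F z) = (1 - a\<^sup>2 * (cmod z)\<^sup>2) / (cmod (1 - a * (cnj v * z)))\<^sup>2" if "cmod z < R" for z
  proof -
    let ?q = "a * cnj v * z"
    have "F z = (1 + ?q) * cnj (1 - ?q) / ((1 - ?q) * cnj (1 - ?q))"
      unfolding F_def using nz[OF that] by (subst mult_divide_mult_cancel_right) (simp_all del: complex_cnj_diff)
    then have "F z = (1 + ?q) * cnj (1 - ?q) / complex_of_real ((cmod (1 - ?q))\<^sup>2)"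
      by (simp only: complex_norm_square)
    then have "Re (F z) = Re ((1 + ?q) * cnj (1 - ?q)) / (cmod (1 - ?q))\<^sup>2"
      by (simp only: Re_divide_of_real)
    also have "Re ((1 + ?q) * cnj (1 - ?q)) = 1 - (cmod ?q)\<^sup>2"
      unfolding cmod_power2 by (simp add: power2_eq_square algebra_simps)
    also have "cmod ?q = a * cmod z" using a v by (simp add: norm_mult)
    finally show ?thesis by (simp add: power_mult_distrib mult.assoc)
  qed
  have [measurable]: "F \<in> borel_measurable borel"
    unfolding F_def [abs_def] by measurable
  have hol: "F holomorphic_on ball 0 R"
    unfolding F_def [abs_def] using nz by (intro holomorphic_intros) auto
  note I = poisson_formula[OF hol R b]
  have re: "integrable circle_measure (\<lambda>w. Re (poisson b w * F w))"
     "(LINT w|circle_measure. Re (poisson b w * F w)) = Re (F b)"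
    using I by (auto simp del: times_complex.sel)
  have "(\<integral>\<^sup>+w. ennreal (poisson b w * poisson a (cnj v * w)) \<partial>circle_measure)
     = (\<integral>\<^sup>+w. ennreal (Re (poisson b w * F w)) \<partial>circle_measure)"
  proof (rule nn_integral_cong_AE, rule AE_mp[OF AE_circle_measure], rule AE_I2, intro impI)
    fix w assume "cmod w = 1"
    then have "Re (F w) = poisson a (cnj v * w)"
      using R by (subst Re_F) (auto simp: poisson_def)
    then show "ennreal (poisson b w * poisson a (cnj v * w)) = ennreal (Re (poisson b w * F w))"
      by simp
  qed
  also have "\<dots> = ennreal (LINT w|circle_measure. Re (poisson b w * F w))"
  proof (rule nn_integral_eq_integral[OF re(1)], rule AE_mp[OF AE_circle_measure], rule AE_I2, intro impI)
    fix w assume "cmod w = 1"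
    then have "Re (F w) = poisson a (cnj v * w)"
      using R by (subst Re_F) (auto simp: poisson_def)
    then show "0 \<le> Re (poisson b w * F w)" using a b by (simp add: poisson_nonneg)
  qed
  also have "\<dots> = Re (F b)" by (simp only: re)
  also have "\<dots> = poisson (b * a) (cnj v)"
    using R b by (subst Re_F) (auto simp: poisson_def power_mult_distrib mult_ac)
  finally show ?thesis by (simp add: poisson_cnj)
qed

text \<open>Squaring a holomorphic function turns the bound on \<open>|F|\<close> into one on \<open>|F|\<^sup>2\<close> without Jensen's inequality.\<close>

lemma poisson_subharmonic:
  fixes F :: "complex \<Rightarrow> complex"
  assumes hol: "F holomorphic_on ball 0 R" and R: "1 < R" and a: "0 \<le> a" "a < 1"
    and F[measurable]: "F \<in> borel_measurable borel"
  shows "ennreal (cmod (F a)) \<le> (\<integral>\<^sup>+w. ennreal (poisson a w) * ennreal (cmod (F w)) \<partial>circle_measure)"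
    "ennreal ((cmod (F a))\<^sup>2) \<le> (\<integral>\<^sup>+w. ennreal (poisson a w) * ennreal ((cmod (F w))\<^sup>2) \<partial>circle_measure)"
proof -
  have main: "ennreal (cmod (F a)) \<le> (\<integral>\<^sup>+w. ennreal (poisson a w) * ennreal (cmod (F w)) \<partial>circle_measure)"
    if "F holomorphic_on ball 0 R" and [measurable]: "F \<in> borel_measurable borel" for F
  proof -
    note I = poisson_formula[OF that(1) R a that(2)]
    have "ennreal (cmod (F a)) \<le> (\<integral>\<^sup>+w. ennreal (cmod (poisson a w * F w)) \<partial>circle_measure)"
      unfolding I(2)[symmetric] by (rule integral_norm_bound_ennreal[OF I(1)])
    also have "\<dots> = (\<integral>\<^sup>+w. ennreal (poisson a w) * ennreal (cmod (F w)) \<partial>circle_measure)"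
      using a by (simp add: norm_mult poisson_nonneg ennreal_mult)
    finally show ?thesis .
  qed
  show "ennreal (cmod (F a)) \<le> (\<integral>\<^sup>+w. ennreal (poisson a w) * ennreal (cmod (F w)) \<partial>circle_measure)"
    by (rule main) (use hol F in auto)
  have "(\<lambda>z. (F z)\<^sup>2) holomorphic_on ball 0 R" by (intro holomorphic_intros hol)
  from main[OF this] show "ennreal ((cmod (F a))\<^sup>2) \<le> (\<integral>\<^sup>+w. ennreal (poisson a w) * ennreal ((cmod (F w))\<^sup>2) \<partial>circle_measure)"
    by (simp add: norm_power)
qed

text \<open>With \<open>a = 0\<close> this is the plain circular mean. Values in
  \<open>ennreal\<close> let Fubini apply without integrability conditions.\<close>

definition slice_mean :: "real \<Rightarrow> (complex^'n \<Rightarrow> ennreal) \<Rightarrow> complex^'n \<Rightarrow> ennreal" where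
  "slice_mean a g z = (\<integral>\<^sup>+w. ennreal (poisson a w) * g (w *s z) \<partial>circle_measure)"

lemma sigma_finite_circle: "sigma_finite_measure circle_measure"
  and sigma_finite_sphere: "sigma_finite_measure (sphere_measure :: (complex^'n) measure)"
  using finite_measure_circle_measure finite_measure_sphere_measure
  by (auto simp: finite_measure_def)

lemma borel_measurable_slice_mean [measurable]:
  assumes [measurable]: "g \<in> borel_measurable borel"
  shows "slice_mean a g \<in> borel_measurable borel"
proof -
  interpret sigma_finite_measure circle_measure by (rule sigma_finite_circle)
  show ?thesis unfolding slice_mean_def [abs_def] by measurable
qed

lemma nn_integral_circle_sphere_swap:
  fixes f :: "complex \<Rightarrow> complex^'n \<Rightarrow> ennreal"
  assumes [measurable]: "case_prod f \<in> borel_measurable (borel \<Otimes>\<^sub>M borel)"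
  shows "(\<integral>\<^sup>+z. \<integral>\<^sup>+w. f w z \<partial>circle_measure \<partial>sphere_measure) = (\<integral>\<^sup>+w. \<integral>\<^sup>+z. f w z \<partial>sphere_measure \<partial>circle_measure)"
proof -
  interpret pair_sigma_finite circle_measure "sphere_measure :: (complex^'n) measure"
    by (intro pair_sigma_finite.intro sigma_finite_circle sigma_finite_sphere)
  have "(\<lambda>(w, z). f w z) \<in> borel_measurable (circle_measure \<Otimes>\<^sub>M (sphere_measure :: (complex^'n) measure))"
  proof -
    have "(\<lambda>x. (fst x, snd x)) \<in> circle_measure \<Otimes>\<^sub>M (sphere_measure :: (complex^'n) measure) \<rightarrow>\<^sub>M borel \<Otimes>\<^sub>M borel"
      by (intro measurable_Pair measurable_compose[OF measurable_snd measurable_id_sphere_measure]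
          measurable_compose[OF measurable_fst]) (simp add: measurable_cong_sets[OF sets_circle_measure refl])
    from measurable_compose[OF this assms] show ?thesis by (simp add: case_prod_beta')
  qed
  then show ?thesis by (rule Fubini')
qed

lemma nn_integral_sphere_rotate:
  fixes f :: "complex^'n \<Rightarrow> ennreal"
  assumes "cmod u = 1" "f \<in> borel_measurable borel"
  shows "(\<integral>\<^sup>+z. f (u *s z) \<partial>sphere_measure) = (\<integral>\<^sup>+z. f z \<partial>sphere_measure)"
  by (rule nn_integral_sphere_measure_isometry) (use assms in \<open>auto simp: linear_cscale norm_cscale\<close>)

lemma nn_integral_circle_cong:
  assumes "\<And>w. cmod w = 1 \<Longrightarrow> f w = g w"
  shows "(\<integral>\<^sup>+w. f w \<partial>circle_measure) = (\<integral>\<^sup>+w. g w \<partial>circle_measure)"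
  by (rule nn_integral_cong_AE, rule AE_mp[OF AE_circle_measure]) (auto simp: assms)

text \<open>Each rotation preserves the sphere measure and the kernel has total mass one.\<close>

lemma nn_integral_slice_mean:
  fixes g :: "complex^'n \<Rightarrow> ennreal"
  assumes a: "0 \<le> a" "a < 1" and [measurable]: "g \<in> borel_measurable borel"
  shows "(\<integral>\<^sup>+z. slice_mean a g z \<partial>sphere_measure) = (\<integral>\<^sup>+z. g z \<partial>sphere_measure)"
proof -
  have "(\<integral>\<^sup>+z. slice_mean a g z \<partial>sphere_measure)
      = (\<integral>\<^sup>+w. \<integral>\<^sup>+z. ennreal (poisson a w) * g (w *s z) \<partial>sphere_measure \<partial>circle_measure)"
    unfolding slice_mean_def by (rule nn_integral_circle_sphere_swap) measurable
  also have "\<dots> = (\<integral>\<^sup>+w. ennreal (poisson a w) * (\<integral>\<^sup>+z. g z \<partial>sphere_measure) \<partial>circle_measure)"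
    by (intro nn_integral_circle_cong, subst nn_integral_cmult)
       (simp_all add: nn_integral_sphere_rotate measurable_sphere_measure)
  also have "\<dots> = (\<integral>\<^sup>+z. g z \<partial>sphere_measure)"
    by (subst nn_integral_multc) (auto simp: nn_integral_poisson a)
  finally show ?thesis .
qed

text \<open>Moving the rotation by \<open>w\<close> from \<open>g\<close> to \<open>f\<close>
  replaces it by \<open>cnj w\<close>, and both the kernel and the arc length are invariant under
  conjugation.\<close>

lemma slice_mean_symmetric:
  fixes f g :: "complex^'n \<Rightarrow> ennreal"
  assumes [measurable]: "f \<in> borel_measurable borel" "g \<in> borel_measurable borel"
  shows "(\<integral>\<^sup>+z. slice_mean a g z * f z \<partial>sphere_measure) = (\<integral>\<^sup>+z. g z * slice_mean a f z \<partial>sphere_measure)"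
proof -
  have "(\<integral>\<^sup>+z. slice_mean a g z * f z \<partial>sphere_measure)
      = (\<integral>\<^sup>+z. \<integral>\<^sup>+w. ennreal (poisson a w) * g (w *s z) * f z \<partial>circle_measure \<partial>sphere_measure)"
    unfolding slice_mean_def by (simp add: nn_integral_multc)
  also have "\<dots> = (\<integral>\<^sup>+w. \<integral>\<^sup>+z. ennreal (poisson a w) * g (w *s z) * f z \<partial>sphere_measure \<partial>circle_measure)"
    by (rule nn_integral_circle_sphere_swap) measurable
  also have "\<dots> = (\<integral>\<^sup>+w. \<integral>\<^sup>+z. ennreal (poisson a (cnj w)) * g z * f (cnj w *s z) \<partial>sphere_measure \<partial>circle_measure)"
  proof (rule nn_integral_circle_cong)
    fix w :: complex assume w: "cmod w = 1"
    then have "w * cnj w = 1" by (simp add: complex_norm_square[symmetric])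
    then have "(\<integral>\<^sup>+z. ennreal (poisson a w) * g (w *s z) * f z \<partial>sphere_measure)
       = (\<integral>\<^sup>+z. (\<lambda>z. ennreal (poisson a w) * g z * f (cnj w *s z)) (w *s z) \<partial>(sphere_measure :: (complex^'n) measure))"
      by (simp add: mult.commute[of "cnj w"])
    also have "\<dots> = (\<integral>\<^sup>+z. ennreal (poisson a w) * g z * f (cnj w *s z) \<partial>sphere_measure)"
      by (rule nn_integral_sphere_rotate[OF w]) measurable
    finally show "(\<integral>\<^sup>+z. ennreal (poisson a w) * g (w *s z) * f z \<partial>sphere_measure)
      = (\<integral>\<^sup>+z. ennreal (poisson a (cnj w)) * g z * f (cnj w *s z) \<partial>sphere_measure)"
      by (simp add: poisson_cnj)
  qed
  also have "\<dots> = (\<integral>\<^sup>+z. \<integral>\<^sup>+w. ennreal (poisson a (cnj w)) * g z * f (cnj w *s z) \<partial>circle_measure \<partial>sphere_measure)"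
    by (rule nn_integral_circle_sphere_swap[symmetric]) measurable
  also have "\<dots> = (\<integral>\<^sup>+z. \<integral>\<^sup>+w. ennreal (poisson a w) * g z * f (w *s z) \<partial>circle_measure \<partial>sphere_measure)"
    by (intro nn_integral_cong nn_integral_circle_cnj) measurable
  also have "\<dots> = (\<integral>\<^sup>+z. g z * slice_mean a f z \<partial>sphere_measure)"
    unfolding slice_mean_def
    by (intro nn_integral_cong, subst nn_integral_cmult[symmetric]) (simp_all add: mult_ac)
  finally show ?thesis .
qed

text \<open>The two rotations are merged by taking \<open>v * w\<close> as the new variable; after
  exchanging the integrals, the inner one is \<open>poisson_convolution\<close>.\<close>

lemma slice_mean_slice_mean:
  fixes g :: "complex^'n \<Rightarrow> ennreal"
  assumes a: "0 \<le> a" "a < 1" and b: "0 \<le> b" "b < 1" and [measurable]: "g \<in> borel_measurable borel"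
  shows "slice_mean b (slice_mean a g) z = slice_mean (b * a) g z"
proof -
  interpret pair_sigma_finite circle_measure circle_measure
    by (intro pair_sigma_finite.intro sigma_finite_circle)
  have "slice_mean b (slice_mean a g) z
     = (\<integral>\<^sup>+v. ennreal (poisson b v) * (\<integral>\<^sup>+w. ennreal (poisson a w) * g (w *s (v *s z)) \<partial>circle_measure) \<partial>circle_measure)"
    by (simp add: slice_mean_def)
  also have "\<dots> = (\<integral>\<^sup>+v. ennreal (poisson b v) * (\<integral>\<^sup>+w. ennreal (poisson a (cnj v * w)) * g (w *s z) \<partial>circle_measure) \<partial>circle_measure)"
  proof (rule nn_integral_circle_cong)
    fix v :: complex assume v: "cmod v = 1"
    then have vv: "v * cnj v = 1" by (simp add: complex_norm_square[symmetric])
    have "(\<integral>\<^sup>+w. ennreal (poisson a w) * g (w *s (v *s z)) \<partial>circle_measure)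
      = (\<integral>\<^sup>+w. ennreal (poisson a (cnj v * (v * w))) * g ((v * w) *s z) \<partial>circle_measure)"
    proof -
      have "cnj v * v = 1" using vv by (simp add: mult.commute)
      then have e1: "cnj v * (v * w) = w" for w by (simp add: mult.assoc[symmetric])
      have e2: "(v * w) *s z = w *s (v *s z)" for w by (simp add: vec_eq_iff)
      show ?thesis by (simp only: e1 e2)
    qed
    also have "\<dots> = (\<integral>\<^sup>+w. ennreal (poisson a (cnj v * w)) * g (w *s z) \<partial>circle_measure)"
      by (rule nn_integral_circle_rotate[where f="\<lambda>w. ennreal (poisson a (cnj v * w)) * g (w *s z)", OF _ v]) measurable
    finally show "ennreal (poisson b v) * (\<integral>\<^sup>+w. ennreal (poisson a w) * g (w *s (v *s z)) \<partial>circle_measure)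
      = ennreal (poisson b v) * (\<integral>\<^sup>+w. ennreal (poisson a (cnj v * w)) * g (w *s z) \<partial>circle_measure)"
      by (rule arg_cong)
  qed
  also have "\<dots> = (\<integral>\<^sup>+v. \<integral>\<^sup>+w. ennreal (poisson b v) * ennreal (poisson a (cnj v * w)) * g (w *s z) \<partial>circle_measure \<partial>circle_measure)"
    by (intro nn_integral_cong, subst nn_integral_cmult[symmetric]) (simp_all add: mult.assoc)
  also have "\<dots> = (\<integral>\<^sup>+w. \<integral>\<^sup>+v. ennreal (poisson b v) * ennreal (poisson a (cnj v * w)) * g (w *s z) \<partial>circle_measure \<partial>circle_measure)"
    by (rule Fubini') measurable
  also have "\<dots> = (\<integral>\<^sup>+w. ennreal (poisson (b * a) w) * g (w *s z) \<partial>circle_measure)"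
  proof (rule nn_integral_circle_cong)
    fix w :: complex assume w: "cmod w = 1"
    have "(\<integral>\<^sup>+v. ennreal (poisson b v) * ennreal (poisson a (cnj v * w)) \<partial>circle_measure)
        = (\<integral>\<^sup>+v. ennreal (poisson b v * poisson a (cnj w * v)) \<partial>circle_measure)"
    proof -
      have "poisson a (cnj v * w) = poisson a (cnj w * v)" for v
        using poisson_cnj[of a "cnj v * w"] by (simp add: mult.commute)
      then show ?thesis using a b by (simp add: ennreal_mult poisson_nonneg)
    qed
    then show "(\<integral>\<^sup>+v. ennreal (poisson b v) * ennreal (poisson a (cnj v * w)) * g (w *s z) \<partial>circle_measure)
        = ennreal (poisson (b * a) w) * g (w *s z)"
      by (subst nn_integral_multc) (simp_all add: poisson_convolution a b w)
  qed
  finally show ?thesis by (simp add: slice_mean_def)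
qed

subsection \<open>The maximal inequality\<close>

text \<open>The sum on the right frees the bound from the order of \<open>r\<close> and
  \<open>s\<close>, as needed for a double sum over radii.\<close>

lemma poisson_mult_le':
  assumes "0 \<le> r" "r < 1" "0 \<le> s" "s < 1" "cmod w = 1"
  shows "poisson (r * s) w \<le> 8 * (poisson r w + poisson s w)"
proof (cases "r \<le> s")
  case True
  then show ?thesis using poisson_mult_le[of r s w] poisson_nonneg[of s w] assms by auto
next
  case False
  then show ?thesis using poisson_mult_le[of s r w] poisson_nonneg[of r w] assms by (auto simp: mult.commute)
qed

lemma slice_mean_mono:
  assumes "norm z = 1" "\<And>y. norm y = 1 \<Longrightarrow> f y \<le> g y"
  shows "slice_mean a f z \<le> slice_mean a g z"
  unfolding slice_mean_def
  by (rule nn_integral_mono_AE, rule AE_mp[OF AE_circle_measure])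
     (auto simp: norm_cscale assms intro!: mult_left_mono)

lemma slice_mean_const:
  assumes "0 \<le> a" "a < 1"
  shows "slice_mean a (\<lambda>_. c) z = c"
  unfolding slice_mean_def using assms by (simp add: nn_integral_multc nn_integral_poisson)

lemma slice_mean_mult_le:
  assumes "0 \<le> r" "r < 1" "0 \<le> s" "s < 1" and [measurable]: "g \<in> borel_measurable borel"
  shows "slice_mean (r * s) g z \<le> 8 * (slice_mean r g z + slice_mean s g z)"
proof -
  have "slice_mean (r * s) g z \<le> (\<integral>\<^sup>+w. 8 * (ennreal (poisson r w) * g (w *s z) + ennreal (poisson s w) * g (w *s z)) \<partial>circle_measure)"
    unfolding slice_mean_def
  proof (rule nn_integral_mono_AE, rule AE_mp[OF AE_circle_measure], rule AE_I2, intro impI)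
    fix w assume "cmod w = 1"
    then have "ennreal (poisson (r * s) w) \<le> ennreal (8 * (poisson r w + poisson s w))"
      by (intro ennreal_leI poisson_mult_le') (use assms in auto)
    also have "\<dots> = 8 * (ennreal (poisson r w) + ennreal (poisson s w))"
      using poisson_nonneg[of r w] poisson_nonneg[of s w] assms
      by (simp add: ennreal_mult ennreal_plus distrib_left flip: ennreal_numeral)
    finally show "ennreal (poisson (r * s) w) * g (w *s z) \<le> 8 * (ennreal (poisson r w) * g (w *s z) + ennreal (poisson s w) * g (w *s z))"
      by (metis mult_right_mono zero_le distrib_right mult.assoc)
  qed
  also have "\<dots> = 8 * (slice_mean r g z + slice_mean s g z)"
    unfolding slice_mean_def by (simp add: nn_integral_cmult nn_integral_add)
  finally show ?thesis .
qed

text \<open>Squaring gives \<open>X * X \<le> 256 * (X * Z)\<close> with 256 = 16 * 16; finiteness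
  of \<open>X\<close> is what permits its cancellation.\<close>

lemma ennreal_self_bound:
  fixes X Y Z :: ennreal
  assumes "X \<le> 16 * Y" "Y\<^sup>2 \<le> X * Z" "X < top"
  shows "X \<le> 256 * Z"
proof (cases "X = 0")
  case False
  have "X * X \<le> (16 * Y)\<^sup>2" unfolding power2_eq_square by (intro mult_mono assms) auto
  also have "\<dots> = 256 * Y\<^sup>2" by (simp add: power_mult_distrib)
  also have "\<dots> \<le> 256 * (X * Z)" by (intro mult_left_mono assms) auto
  also have "\<dots> = X * (256 * Z)" by (simp add: mult_ac)
  finally show ?thesis using False assms(3) by (simp add: ennreal_mult_le_mult_iff)
qed auto

text \<open>
  The dual form of the maximal inequality. Expanding the square and moving one mean to the other side
  leaves means with parameters \<open>r\<^sub>i r\<^sub>j\<close>, which are dominated by those with parameters \<open>r\<^sub>i\<close> and \<open>r\<^sub>j\<close>;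
  the square is thus bounded by a mixed integral, and the Cauchy-Schwarz inequality gives the claim.
\<close>

lemma slice_mean_dual_maximal:
  fixes g :: "'i \<Rightarrow> complex^'n \<Rightarrow> ennreal"
  assumes fin: "finite I" and r: "\<And>i. i \<in> I \<Longrightarrow> 0 \<le> r i" "\<And>i. i \<in> I \<Longrightarrow> r i < 1"
    and g[measurable]: "\<And>i. i \<in> I \<Longrightarrow> g i \<in> borel_measurable borel"
    and finite: "(\<integral>\<^sup>+z. (\<Sum>i\<in>I. slice_mean (r i) (g i) z)\<^sup>2 \<partial>sphere_measure) < top"
  shows "(\<integral>\<^sup>+z. (\<Sum>i\<in>I. slice_mean (r i) (g i) z)\<^sup>2 \<partial>sphere_measure)
    \<le> 256 * (\<integral>\<^sup>+z. (\<Sum>i\<in>I. g i z)\<^sup>2 \<partial>sphere_measure)"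
proof -
  let ?P = "\<lambda>i. slice_mean (r i) (g i)"
  let ?Y = "\<integral>\<^sup>+z. (\<Sum>i\<in>I. ?P i z) * (\<Sum>i\<in>I. g i z) \<partial>sphere_measure"
  have m: "f \<in> borel_measurable sphere_measure" if "f \<in> borel_measurable borel" for f :: "complex^'n \<Rightarrow> ennreal"
    by (rule measurable_sphere_measure[OF that])
  have "(\<integral>\<^sup>+z. (\<Sum>i\<in>I. ?P i z)\<^sup>2 \<partial>sphere_measure) = (\<Sum>i\<in>I. \<Sum>j\<in>I. \<integral>\<^sup>+z. ?P i z * ?P j z \<partial>sphere_measure)"
    by (simp add: power2_eq_square sum_product nn_integral_sum m)
  also have "\<dots> = (\<Sum>i\<in>I. \<Sum>j\<in>I. \<integral>\<^sup>+z. slice_mean (r j * r i) (g i) z * g j z \<partial>sphere_measure)"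
    by (intro sum.cong refl, subst slice_mean_symmetric[symmetric]) (simp_all add: slice_mean_slice_mean r)
  also have "\<dots> \<le> (\<Sum>i\<in>I. \<Sum>j\<in>I. \<integral>\<^sup>+z. 8 * (slice_mean (r j) (g i) z + ?P i z) * g j z \<partial>sphere_measure)"
    by (intro sum_mono nn_integral_mono mult_right_mono slice_mean_mult_le) (auto simp: r)
  also have "\<dots> = 8 * ((\<Sum>i\<in>I. \<Sum>j\<in>I. \<integral>\<^sup>+z. slice_mean (r j) (g i) z * g j z \<partial>sphere_measure)
      + (\<Sum>i\<in>I. \<Sum>j\<in>I. \<integral>\<^sup>+z. ?P i z * g j z \<partial>sphere_measure))"
    by (simp add: distrib_right nn_integral_add nn_integral_cmult m sum.distrib sum_distrib_left mult.assoc distrib_left)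
  also have "(\<Sum>i\<in>I. \<Sum>j\<in>I. \<integral>\<^sup>+z. slice_mean (r j) (g i) z * g j z \<partial>sphere_measure)
     = (\<Sum>i\<in>I. \<Sum>j\<in>I. \<integral>\<^sup>+z. g i z * ?P j z \<partial>sphere_measure)"
    by (intro sum.cong refl slice_mean_symmetric) auto
  also have "\<dots> = ?Y"
    by (subst sum.swap) (simp add: mult.commute[of "g _ _"] sum_product nn_integral_sum m)
  also have "(\<Sum>i\<in>I. \<Sum>j\<in>I. \<integral>\<^sup>+z. ?P i z * g j z \<partial>sphere_measure) = ?Y"
    by (simp add: sum_product nn_integral_sum m)
  \<comment> \<open>Both double sums are \<open>?Y\<close>, so the factor 8 of the kernel estimate
    becomes 16.\<close>
  finally have 1: "(\<integral>\<^sup>+z. (\<Sum>i\<in>I. ?P i z)\<^sup>2 \<partial>sphere_measure) \<le> 16 * ?Y"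
    by (simp add: mult_2[symmetric] mult.assoc[symmetric])
  have 2: "?Y\<^sup>2 \<le> (\<integral>\<^sup>+z. (\<Sum>i\<in>I. ?P i z)\<^sup>2 \<partial>sphere_measure) * (\<integral>\<^sup>+z. (\<Sum>i\<in>I. g i z)\<^sup>2 \<partial>sphere_measure)"
    by (rule Cauchy_Schwarz_nn_integral) (auto intro!: m)
  from ennreal_self_bound[OF 1 2 finite] show ?thesis .
qed

lemma nn_integral_sphere_bounded:
  fixes f :: "complex^'n \<Rightarrow> ennreal"
  assumes "\<And>z. norm z = 1 \<Longrightarrow> f z \<le> K" "K < top"
  shows "(\<integral>\<^sup>+z. f z \<partial>sphere_measure) < top"
proof -
  have "(\<integral>\<^sup>+z. f z \<partial>sphere_measure) \<le> (\<integral>\<^sup>+z. K \<partial>(sphere_measure :: (complex^'n) measure))"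
    by (rule nn_integral_mono) (auto intro: assms)
  also have "\<dots> = K" by (simp add: emeasure_sphere_measure_sphere)
  finally show ?thesis using assms(2) by simp
qed

text \<open>The maximum is linearized: \<open>M\<close> is split into pieces \<open>g i\<close>,
  each supported where \<open>i\<close> is the first index attaining it, so that
  \<open>M z * M z\<close> is the sum of the \<open>g i z * U i z\<close>. The means then pass from
  \<open>u\<close> to the pieces, and Cauchy-Schwarz together with
  \<open>slice_mean_dual_maximal\<close> bounds the result by \<open>M\<close> again. The bound
  \<open>K\<close> makes the integrals finite and hence cancellable; the constant 256 is independent
  of \<open>N\<close>.\<close>

lemma slice_maximal:
  fixes u :: "complex^'n \<Rightarrow> ennreal" and U :: "nat \<Rightarrow> complex^'n \<Rightarrow> ennreal"
  assumes r: "\<And>i. i < N \<Longrightarrow> 0 \<le> r i" "\<And>i. i < N \<Longrightarrow> r i < 1"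
    and u[measurable]: "u \<in> borel_measurable borel"
    and U[measurable]: "\<And>i. U i \<in> borel_measurable borel"
    and le: "\<And>i z. i < N \<Longrightarrow> norm z = 1 \<Longrightarrow> U i z \<le> slice_mean (r i) u z"
    and bd: "\<And>z. norm z = 1 \<Longrightarrow> u z \<le> K" "K < top"
  shows "(\<integral>\<^sup>+z. (SUP i\<in>{..<N}. U i z)\<^sup>2 \<partial>sphere_measure) \<le> 256 * (\<integral>\<^sup>+z. (u z)\<^sup>2 \<partial>sphere_measure)"
proof (cases "N = 0")
  case True then show ?thesis by (simp add: bot_ennreal)
next
  case False
  define M where "M z = (SUP i\<in>{..<N}. U i z)" for z
  define g where "g i z = (if U i z = M z \<and> (\<forall>j\<in>{..<i}. U j z \<noteq> M z) then M z else 0)" for i z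
  have M[measurable]: "M \<in> borel_measurable borel" unfolding M_def [abs_def] by measurable
  have g[measurable]: "g i \<in> borel_measurable borel" for i unfolding g_def [abs_def] by measurable
  have m: "f \<in> borel_measurable sphere_measure" if "f \<in> borel_measurable borel" for f :: "complex^'n \<Rightarrow> ennreal"
    by (rule measurable_sphere_measure[OF that])
  have idx: "\<exists>i<N. U i z = M z \<and> (\<forall>j\<in>{..<i}. U j z \<noteq> M z)" for z
  proof -
    have "M z = Max ((\<lambda>i. U i z) ` {..<N})"
      unfolding M_def using False by (intro cSup_eq_Max) auto
    also have "\<dots> \<in> (\<lambda>i. U i z) ` {..<N}" using False by (intro Max_in) auto
    finally obtain i where i: "i < N" "U i z = M z" by auto
    define k where "k = (LEAST i. U i z = M z)"
    have "U k z = M z" unfolding k_def by (rule LeastI[of _ i]) (rule i)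
    moreover have "k \<le> i" unfolding k_def by (rule Least_le) (rule i)
    moreover have "U j z \<noteq> M z" if "j < k" for j using not_less_Least[of j "\<lambda>i. U i z = M z"] that by (simp add: k_def)
    ultimately show ?thesis using i by (intro exI[of _ k]) auto
  qed
  have sum_g: "(\<Sum>i<N. g i z) = M z" "(\<Sum>i<N. g i z * U i z) = M z * M z" for z
  proof -
    obtain k where k: "k < N" "U k z = M z" "\<And>j. j < k \<Longrightarrow> U j z \<noteq> M z" using idx[of z] by auto
    have gz: "g i z = (if i = k then M z else 0)" for i
      unfolding g_def using k by (cases i k rule: linorder_cases) auto
    show "(\<Sum>i<N. g i z) = M z" using k by (simp add: gz)
    have "g i z * U i z = (if i = k then M z * M z else 0)" for i using k by (simp add: gz)
    then show "(\<Sum>i<N. g i z * U i z) = M z * M z" using k by simp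
  qed
  have UK: "U i z \<le> K" if "i < N" "norm z = 1" for i z
  proof -
    have "U i z \<le> slice_mean (r i) u z" by (rule le[OF that])
    also have "\<dots> \<le> slice_mean (r i) (\<lambda>_. K) z" by (rule slice_mean_mono[OF that(2) bd(1)])
    also have "\<dots> = K" using r[OF that(1)] by (simp add: slice_mean_const)
    finally show ?thesis .
  qed
  have MK: "M z \<le> K" if "norm z = 1" for z
    unfolding M_def by (rule SUP_least) (use UK that in auto)
  have gK: "g i z \<le> K" if "norm z = 1" for z i using MK[OF that] by (auto simp: g_def)
  let ?X = "\<integral>\<^sup>+z. (\<Sum>i<N. slice_mean (r i) (g i) z)\<^sup>2 \<partial>sphere_measure"
  have Xfin: "?X < top"
  proof (rule nn_integral_sphere_bounded)
    fix z :: "complex^'n" assume z: "norm z = 1"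
    have "slice_mean (r i) (g i) z \<le> K" if "i < N" for i
      using slice_mean_mono[OF z gK, where a = "r i"] r[OF that] by (simp add: slice_mean_const)
    then have "(\<Sum>i<N. slice_mean (r i) (g i) z) \<le> (\<Sum>i<N. K)" by (intro sum_mono) auto
    then show "(\<Sum>i<N. slice_mean (r i) (g i) z)\<^sup>2 \<le> (of_nat N * K)\<^sup>2" by (simp add: power_mono)
  qed (use bd(2) in \<open>simp add: power_mult_distrib ennreal_mult_less_top power_less_top_ennreal of_nat_less_top\<close>)
  have X: "?X \<le> 256 * (\<integral>\<^sup>+z. (M z)\<^sup>2 \<partial>sphere_measure)"
    using slice_mean_dual_maximal[of "{..<N}" r g] Xfin r by (simp add: sum_g)
  have Mfin: "(\<integral>\<^sup>+z. (M z)\<^sup>2 \<partial>sphere_measure) < top"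
    by (rule nn_integral_sphere_bounded[of _ "K\<^sup>2"]) (use bd(2) MK in \<open>auto simp: power_mono power_less_top_ennreal\<close>)
  have "(\<integral>\<^sup>+z. (M z)\<^sup>2 \<partial>sphere_measure) = (\<integral>\<^sup>+z. (\<Sum>i<N. g i z * U i z) \<partial>sphere_measure)"
    by (simp add: sum_g power2_eq_square)
  also have "\<dots> \<le> (\<integral>\<^sup>+z. (\<Sum>i<N. g i z * slice_mean (r i) u z) \<partial>sphere_measure)"
    by (intro nn_integral_mono sum_mono mult_left_mono le) auto
  also have "\<dots> = (\<Sum>i<N. \<integral>\<^sup>+z. g i z * slice_mean (r i) u z \<partial>sphere_measure)"
    by (rule nn_integral_sum) (auto intro: m)
  also have "\<dots> = (\<Sum>i<N. \<integral>\<^sup>+z. slice_mean (r i) (g i) z * u z \<partial>sphere_measure)"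
    by (intro sum.cong refl slice_mean_symmetric[symmetric]) auto
  also have "\<dots> = (\<integral>\<^sup>+z. (\<Sum>i<N. slice_mean (r i) (g i) z) * u z \<partial>sphere_measure)"
    unfolding sum_distrib_right by (rule nn_integral_sum[symmetric]) (auto intro: m)
  finally have "(\<integral>\<^sup>+z. (M z)\<^sup>2 \<partial>sphere_measure) \<le> (\<integral>\<^sup>+z. (\<Sum>i<N. slice_mean (r i) (g i) z) * u z \<partial>sphere_measure)" .
  then have "(\<integral>\<^sup>+z. (M z)\<^sup>2 \<partial>sphere_measure)\<^sup>2 \<le> (\<integral>\<^sup>+z. (\<Sum>i<N. slice_mean (r i) (g i) z) * u z \<partial>sphere_measure)\<^sup>2"
    by (rule power_mono) simp
  also have "\<dots> \<le> ?X * (\<integral>\<^sup>+z. (u z)\<^sup>2 \<partial>sphere_measure)"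
    by (rule Cauchy_Schwarz_nn_integral) (auto intro!: m)
  also have "\<dots> \<le> 256 * (\<integral>\<^sup>+z. (M z)\<^sup>2 \<partial>sphere_measure) * (\<integral>\<^sup>+z. (u z)\<^sup>2 \<partial>sphere_measure)"
    by (rule mult_right_mono[OF X]) simp
  finally have "(\<integral>\<^sup>+z. (M z)\<^sup>2 \<partial>sphere_measure) * (\<integral>\<^sup>+z. (M z)\<^sup>2 \<partial>sphere_measure)
     \<le> (\<integral>\<^sup>+z. (M z)\<^sup>2 \<partial>sphere_measure) * (256 * (\<integral>\<^sup>+z. (u z)\<^sup>2 \<partial>sphere_measure))"
    by (simp add: power2_eq_square mult_ac)
  then have "(\<integral>\<^sup>+z. (M z)\<^sup>2 \<partial>sphere_measure) \<le> 256 * (\<integral>\<^sup>+z. (u z)\<^sup>2 \<partial>sphere_measure)"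
    using Mfin by (cases "(\<integral>\<^sup>+z. (M z)\<^sup>2 \<partial>sphere_measure) = 0") (simp_all add: ennreal_mult_le_mult_iff)
  then show ?thesis by (simp add: M_def)
qed

subsection \<open>Dilations of analytic functions of the ball\<close>

lemma integral_sphere_rotate:
  fixes f :: "complex^'n \<Rightarrow> complex"
  assumes u: "cmod u = 1" and [measurable]: "f \<in> borel_measurable borel"
  shows "(LINT z|sphere_measure. f (u *s z)) = (LINT z|sphere_measure. f z)"
proof -
  let ?S = "sphere_measure :: (complex^'n) measure"
  have m: "(\<lambda>z. u *s z) \<in> ?S \<rightarrow>\<^sub>M borel"
    by measurable
  have "distr ?S borel (\<lambda>z. u *s z) = distr ?S borel (\<lambda>z. z)"
  proof (rule measure_eqI)
    fix E assume "E \<in> sets (distr ?S borel (\<lambda>z. u *s z))"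
    then have E[measurable]: "E \<in> sets borel" by simp
    have "(\<integral>\<^sup>+z. indicator E z \<partial>distr ?S borel (\<lambda>z. u *s z)) = (\<integral>\<^sup>+z. indicator E z \<partial>distr ?S borel (\<lambda>z. z))"
      using nn_integral_sphere_rotate[OF u, of "indicator E"]
      by (subst (1 2) nn_integral_distr) (auto simp: m)
    then show "emeasure (distr ?S borel (\<lambda>z. u *s z)) E = emeasure (distr ?S borel (\<lambda>z. z)) E"
      by simp
  qed simp
  then have "(LINT z|distr ?S borel (\<lambda>z. u *s z). f z) = (LINT z|distr ?S borel (\<lambda>z. z). f z)" by simp
  then show ?thesis by (subst (asm) (1 2) integral_distr) (auto simp: m)
qed

lemma integral_circle_cnj:
  fixes f :: "complex \<Rightarrow> complex"
  assumes [measurable]: "f \<in> borel_measurable borel"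
  shows "(LINT z|circle_measure. f (cnj z)) = (LINT z|circle_measure. f z)"
proof -
  have m: "cnj \<in> circle_measure \<rightarrow>\<^sub>M borel" by measurable
  have "distr circle_measure borel cnj = circle_measure"
  proof (rule measure_eqI)
    fix E assume "E \<in> sets (distr circle_measure borel cnj)"
    then have E[measurable]: "E \<in> sets borel" by simp
    have "(\<integral>\<^sup>+z. indicator E z \<partial>distr circle_measure borel cnj) = (\<integral>\<^sup>+z. indicator E z \<partial>circle_measure)"
      using nn_integral_circle_cnj[of "indicator E"]
      by (subst nn_integral_distr) (auto simp: m)
    then show "emeasure (distr circle_measure borel cnj) E = emeasure circle_measure E"
      by simp
  qed simp
  then have "(LINT z|distr circle_measure borel cnj. f z) = (LINT z|circle_measure. f z)" by simp
  then show ?thesis by (subst (asm) integral_distr) (auto simp: m)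
qed

text \<open>The maps \<open>u\<close> and \<open>v\<close> let one statement serve both integrands
  of the next symmetry: the rotation sits in the first factor before the substitution and in the
  second one after it.\<close>

lemma integrable_circle_sphere:
  fixes F G :: "complex^'n \<Rightarrow> complex"
  assumes a: "0 \<le> a" "a < 1" and [measurable]: "F \<in> borel_measurable borel" "G \<in> borel_measurable borel"
    and u: "\<And>w. cmod w = 1 \<Longrightarrow> cmod (u w) = 1" "\<And>w. cmod w = 1 \<Longrightarrow> cmod (v w) = 1"
    and [measurable]: "u \<in> borel_measurable borel" "v \<in> borel_measurable borel"
    and K: "\<And>z. norm z = 1 \<Longrightarrow> cmod (F z) \<le> K" "\<And>z. norm z = 1 \<Longrightarrow> cmod (G z) \<le> K"
  shows "integrable (circle_measure \<Otimes>\<^sub>M sphere_measure) (\<lambda>(w, z). poisson a w * F (u w *s z) * cnj (G (v w *s z)))"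
proof (rule integrableI_bounded)
  interpret sigma_finite_measure "sphere_measure :: (complex^'n) measure" by (rule sigma_finite_sphere)
  have [measurable]: "(\<lambda>x. x) \<in> circle_measure \<rightarrow>\<^sub>M borel"
    by (simp add: measurable_cong_sets[OF sets_circle_measure refl])
  show m[measurable]: "(\<lambda>(w, z). poisson a w * F (u w *s z) * cnj (G (v w *s z)))
      \<in> borel_measurable (circle_measure \<Otimes>\<^sub>M (sphere_measure :: (complex^'n) measure))"
  proof -
    have "(\<lambda>x. (fst x, snd x)) \<in> circle_measure \<Otimes>\<^sub>M (sphere_measure :: (complex^'n) measure) \<rightarrow>\<^sub>M borel \<Otimes>\<^sub>M borel"
      by (intro measurable_Pair measurable_compose[OF measurable_snd measurable_id_sphere_measure]
          measurable_compose[OF measurable_fst]) (simp add: measurable_cong_sets[OF sets_circle_measure refl])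
    moreover have "(\<lambda>(w, z). poisson a w * F (u w *s z) * cnj (G (v w *s z))) \<in> borel_measurable (borel \<Otimes>\<^sub>M borel)"
      by measurable
    ultimately have "(\<lambda>x. (\<lambda>(w, z). poisson a w * F (u w *s z) * cnj (G (v w *s z))) (fst x, snd x))
      \<in> borel_measurable (circle_measure \<Otimes>\<^sub>M (sphere_measure :: (complex^'n) measure))"
      by (rule measurable_compose)
    then show ?thesis by (simp only: case_prod_beta' fst_conv snd_conv)
  qed
  \<comment> \<open>Any unit vector will do; it shows \<open>0 \<le> K\<close>.\<close>
  have "cmod (F (axis undefined 1)) \<le> K" by (rule K(1)) (simp add: norm_axis_1)
  then have K0: "0 \<le> K" by (rule order_trans[OF norm_ge_zero])
  have "(\<integral>\<^sup>+x. ennreal (norm ((case x of (w, z) \<Rightarrow> poisson a w * F (u w *s z) * cnj (G (v w *s z))))) \<partial>(circle_measure \<Otimes>\<^sub>M (sphere_measure :: (complex^'n) measure)))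
    = (\<integral>\<^sup>+w. \<integral>\<^sup>+z. ennreal (norm (poisson a w * F (u w *s z) * cnj (G (v w *s z)))) \<partial>sphere_measure \<partial>circle_measure)"
    by (subst nn_integral_fst[symmetric]) (use m in \<open>simp_all\<close>)
  also have "\<dots> \<le> (\<integral>\<^sup>+w. \<integral>\<^sup>+z. ennreal (poisson a w) * ennreal (K * K) \<partial>(sphere_measure :: (complex^'n) measure) \<partial>circle_measure)"
  proof (rule nn_integral_mono_AE, rule AE_mp[OF AE_circle_measure], rule AE_I2, intro impI nn_integral_mono)
    fix w z assume w: "cmod w = 1" and "z \<in> space (sphere_measure :: (complex^'n) measure)"
    then have z: "norm z = 1" by simp
    have "norm (poisson a w * F (u w *s z) * cnj (G (v w *s z))) = poisson a w * (cmod (F (u w *s z)) * cmod (G (v w *s z)))"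
      using a by (simp add: norm_mult poisson_nonneg)
    also have "\<dots> \<le> poisson a w * (K * K)"
      using w z u a K0 by (intro mult_left_mono mult_mono K) (auto simp: norm_cscale poisson_nonneg)
    finally show "ennreal (norm (poisson a w * F (u w *s z) * cnj (G (v w *s z)))) \<le> ennreal (poisson a w) * ennreal (K * K)"
      using a K0 by (subst ennreal_mult[symmetric]) (auto simp: poisson_nonneg intro!: ennreal_leI)
  qed
  also have "\<dots> = ennreal (K * K)"
    by (simp add: emeasure_sphere_measure_sphere nn_integral_multc nn_integral_poisson a)
  finally show "(\<integral>\<^sup>+x. ennreal (norm ((case x of (w, z) \<Rightarrow> poisson a w * F (u w *s z) * cnj (G (v w *s z))))) \<partial>(circle_measure \<Otimes>\<^sub>M (sphere_measure :: (complex^'n) measure))) < \<infinity>"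
    using le_less_trans by fastforce
qed

text \<open>Complex counterpart of \<open>slice_mean_symmetric\<close>, in which boundedness of
  \<open>F\<close> and \<open>G\<close> takes over the role of positivity in Fubini's
  theorem.\<close>

lemma slice_mean_symmetric_complex:
  fixes F G :: "complex^'n \<Rightarrow> complex"
  assumes a: "0 \<le> a" "a < 1" and [measurable]: "F \<in> borel_measurable borel" "G \<in> borel_measurable borel"
    and K: "\<And>z. norm z = 1 \<Longrightarrow> cmod (F z) \<le> K" "\<And>z. norm z = 1 \<Longrightarrow> cmod (G z) \<le> K"
  shows "(LINT z|sphere_measure. (LINT w|circle_measure. poisson a w * F (w *s z)) * cnj (G z))
    = (LINT z|sphere_measure. F z * cnj (LINT w|circle_measure. poisson a w * G (w *s z)))"
proof -
  interpret P: pair_sigma_finite circle_measure "sphere_measure :: (complex^'n) measure"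
    by (intro pair_sigma_finite.intro sigma_finite_circle sigma_finite_sphere)
  note m = measurable_sphere_measure
  have i1: "integrable (circle_measure \<Otimes>\<^sub>M sphere_measure) (\<lambda>(w, z). poisson a w * F (w *s z) * cnj (G (1 *s z)))"
    by (rule integrable_circle_sphere) (use a K in auto)
  have i2: "integrable (circle_measure \<Otimes>\<^sub>M sphere_measure) (\<lambda>(w, z). poisson a w * F (1 *s z) * cnj (G (cnj w *s z)))"
    by (rule integrable_circle_sphere) (use a K in auto)
  have "(LINT z|sphere_measure. (LINT w|circle_measure. poisson a w * F (w *s z)) * cnj (G z))
      = (LINT z|sphere_measure. LINT w|circle_measure. poisson a w * F (w *s z) * cnj (G z))"
    by simp
  also have "\<dots> = (LINT w|circle_measure. LINT z|sphere_measure. poisson a w * F (w *s z) * cnj (G z))"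
    using P.Fubini_integral[OF i1] by simp
  also have "\<dots> = (LINT w|circle_measure. LINT z|sphere_measure. poisson a w * F z * cnj (G (cnj w *s z)))"
  proof (rule integral_cong_AE)
    interpret sigma_finite_measure "sphere_measure :: (complex^'n) measure" by (rule sigma_finite_sphere)
    show "(\<lambda>w. LINT z|sphere_measure. poisson a w * F (w *s z) * cnj (G z)) \<in> borel_measurable circle_measure"
      using P.M2.borel_measurable_lebesgue_integral[of "\<lambda>w z. poisson a w * F (w *s z) * cnj (G z)"] borel_measurable_integrable[OF i1] by (simp add: case_prod_beta')
    show "(\<lambda>w. LINT z|sphere_measure. poisson a w * F z * cnj (G (cnj w *s z))) \<in> borel_measurable circle_measure"
      using P.M2.borel_measurable_lebesgue_integral[of "\<lambda>w z. poisson a w * F z * cnj (G (cnj w *s z))"] borel_measurable_integrable[OF i2] by (simp add: case_prod_beta')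
    have "(LINT z|sphere_measure. poisson a w * F (w *s z) * cnj (G z)) = (LINT z|sphere_measure. poisson a w * F z * cnj (G (cnj w *s z)))"
      if w: "cmod w = 1" for w
    proof -
      have "cnj w * w = 1" using w complex_norm_square[of w] by (simp add: mult.commute)
      then have e: "cnj w *s (w *s z) = z" for z :: "complex^'n" by simp
      have "(LINT z|sphere_measure. poisson a w * F (w *s z) * cnj (G z))
        = (LINT z|(sphere_measure :: (complex^'n) measure). (\<lambda>z. poisson a w * F z * cnj (G (cnj w *s z))) (w *s z))"
        by (simp only: e)
      also have "\<dots> = (LINT z|sphere_measure. poisson a w * F z * cnj (G (cnj w *s z)))"
        by (rule integral_sphere_rotate[OF w]) measurable
      finally show ?thesis .
    qed
    then show "AE w in circle_measure. (LINT z|sphere_measure. poisson a w * F (w *s z) * cnj (G z)) = (LINT z|sphere_measure. poisson a w * F z * cnj (G (cnj w *s z)))"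
      by - (rule AE_mp[OF AE_circle_measure], rule AE_I2, rule impI)
  qed
  also have "\<dots> = (LINT z|sphere_measure. LINT w|circle_measure. poisson a w * F z * cnj (G (cnj w *s z)))"
    using P.Fubini_integral[OF i2] by simp
  also have "\<dots> = (LINT z|sphere_measure. F z * cnj (LINT w|circle_measure. poisson a w * G (w *s z)))"
  proof (rule Bochner_Integration.integral_cong[OF refl])
    fix z :: "complex^'n"
    have "(LINT w|circle_measure. poisson a w * F z * cnj (G (cnj w *s z)))
       = (LINT w|circle_measure. (\<lambda>w. poisson a w * F z * cnj (G (w *s z))) (cnj w))"
      by (simp add: poisson_cnj)
    also have "\<dots> = (LINT w|circle_measure. F z * cnj (poisson a w * G (w *s z)))"
      by (subst integral_circle_cnj) (simp_all add: mult_ac)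
    finally show "(LINT w|circle_measure. poisson a w * F z * cnj (G (cnj w *s z)))
      = F z * cnj (LINT w|circle_measure. poisson a w * G (w *s z))"
      by (simp del: complex_cnj_mult)
  qed
  finally show ?thesis .
qed

text \<open>Complex linearity of \<open>D\<close> turns the real derivative along a complex line
  into a complex derivative.\<close>

lemma analytic_slice_derivative:
  fixes h :: "complex^'n \<Rightarrow> complex"
  assumes D: "(h has_derivative D) (at (z + t *s w))" and lin: "Vector_Spaces.linear (*s) (*) D"
  shows "((\<lambda>t. h (z + t *s w)) has_field_derivative D w) (at t)"
proof -
  have bl: "bounded_linear (\<lambda>t::complex. t *s w)"
    by (intro linear_conv_bounded_linear[THEN iffD1] linearI) (auto simp: vec_eq_iff algebra_simps)
  have "((\<lambda>t. z + t *s w) has_derivative (\<lambda>s. s *s w)) (at t)"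
    using bounded_linear_imp_has_derivative[OF bl] by (auto intro!: derivative_eq_intros)
  from has_derivative_compose[OF this D] have "((\<lambda>t. h (z + t *s w)) has_derivative (\<lambda>s. D (s *s w))) (at t)" .
  moreover have "D (s *s w) = s * D w" for s
  proof -
    interpret Vector_Spaces.linear "(*s)" "(*)" D by (rule lin)
    show ?thesis by (rule scale)
  qed
  ultimately show ?thesis by (simp add: has_field_derivative_def mult_commute_abs)
qed

lemma holomorphic_slice:
  assumes "analytic_on_ball h"
  shows "(\<lambda>t. h (z + t *s w)) holomorphic_on {t. z + t *s w \<in> ball 0 1}"
  unfolding holomorphic_on_def field_differentiable_def
proof
  fix t assume "t \<in> {t. z + t *s w \<in> ball 0 1}"
  then obtain D where "Vector_Spaces.linear (*s) (*) D" "(h has_derivative D) (at (z + t *s w))"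
    using assms unfolding analytic_on_ball_def by blast
  from analytic_slice_derivative[OF this(2,1)]
  show "\<exists>f'. ((\<lambda>t. h (z + t *s w)) has_field_derivative f') (at t within {t. z + t *s w \<in> ball 0 1})"
    by (blast intro: has_field_derivative_at_within)
qed

text \<open>\<open>hardy_space\<close> without its growth condition. Vanishing off the ball makes
  these functions Borel measurable on the whole space.\<close>

definition ball_analytic :: "(complex^'n \<Rightarrow> complex) \<Rightarrow> bool" where
  "ball_analytic h \<longleftrightarrow> analytic_on_ball h \<and> (\<forall>z. z \<notin> ball 0 1 \<longrightarrow> h z = 0)"

lemma ball_analytic_continuous: "ball_analytic h \<Longrightarrow> continuous_on (ball 0 1) h"
  unfolding ball_analytic_def analytic_on_ball_def
  by (meson continuous_at_imp_continuous_on has_derivative_continuous)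

lemma ball_analytic_measurable:
  assumes "ball_analytic h" shows "h \<in> borel_measurable borel"
proof -
  have "(\<lambda>z. indicator (ball 0 1) z *\<^sub>R h z) \<in> borel_measurable borel"
    by (rule borel_measurable_continuous_on_indicator) (use ball_analytic_continuous[OF assms] in auto)
  moreover have "(\<lambda>z. indicator (ball 0 1) z *\<^sub>R h z) = h"
    using assms by (auto simp: ball_analytic_def indicator_def)
  ultimately show ?thesis by simp
qed

lemma of_real_cscale: "complex_of_real r *s z = r *\<^sub>R z"
  by (simp add: vec_eq_iff) (simp add: scaleR_conv_of_real)

lemma cscale_scaleR: "w *s (r *\<^sub>R z) = r *\<^sub>R (w *s (z :: complex^'n))"
  by (simp add: vec_eq_iff)

definition dilate :: "(complex^'n \<Rightarrow> complex) \<Rightarrow> real \<Rightarrow> complex^'n \<Rightarrow> complex" where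
  "dilate h r z = h (r *\<^sub>R z)"

lemma borel_measurable_dilate [measurable]: "h \<in> borel_measurable borel \<Longrightarrow> dilate h r \<in> borel_measurable borel"
proof -
  assume [measurable]: "h \<in> borel_measurable borel"
  show ?thesis unfolding dilate_def [abs_def] by measurable
qed

lemma dilate_bounded:
  fixes h :: "complex^'n \<Rightarrow> complex"
  assumes "ball_analytic h" "0 \<le> s" "s < 1"
  obtains K where "\<And>z. norm z \<le> 1 \<Longrightarrow> cmod (dilate h s z) \<le> K"
proof -
  have "compact (h ` cball 0 s)"
    by (intro compact_continuous_image continuous_on_subset[OF ball_analytic_continuous[OF assms(1)]])
       (use assms in auto)
  then have "bounded (h ` cball 0 s)" by (rule compact_imp_bounded)
  then obtain K where K: "\<And>z. z \<in> cball 0 s \<Longrightarrow> cmod (h z) \<le> K" unfolding bounded_iff by blast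
  show ?thesis
  proof (rule that[of K])
    fix z :: "complex^'n" assume "norm z \<le> 1"
    then show "cmod (dilate h s z) \<le> K"
      unfolding dilate_def using assms mult_left_mono[of "norm z" 1 s] by (intro K) auto
  qed
qed

lemma dilate_slice:
  assumes h: "ball_analytic h" and s: "0 \<le> s" "s < 1" and z: "norm z = 1"
  obtains R where "1 < R" "(\<lambda>t. dilate h s (t *s z)) holomorphic_on ball 0 R"
    "(\<lambda>t. dilate h s (t *s z)) \<in> borel_measurable borel"
proof -
  \<comment> \<open>The point \<open>t *s (s *\<^sub>R z)\<close> stays in the ball for
    \<open>cmod t < 1 / s\<close>; for \<open>s = 0\<close> any radius above 1 would do.\<close>
  define R where "R = (if s = 0 then 2 else 1 / s)"
  have "ball 0 R \<subseteq> {t. 0 + t *s (s *\<^sub>R z) \<in> ball 0 1}"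
    using s z by (auto simp: norm_cscale R_def pos_less_divide_eq)
  from holomorphic_on_subset[OF holomorphic_slice this] h
  have "(\<lambda>t. h (0 + t *s (s *\<^sub>R z))) holomorphic_on ball 0 R" by (simp add: ball_analytic_def)
  moreover note [measurable] = ball_analytic_measurable[OF h]
  have "(\<lambda>t. dilate h s (t *s z)) \<in> borel_measurable borel" by measurable
  moreover have "1 < R" using s by (auto simp: R_def)
  ultimately show ?thesis by (intro that[of R]) (simp_all add: dilate_def cscale_scaleR)
qed

text \<open>The Poisson formula and its subharmonic versions on the slice through \<open>z\<close>:
  shrinking the radius by the factor \<open>a\<close> amounts to taking the mean with parameter
  \<open>a\<close>.\<close>

lemma dilate_slice_mean:
  assumes h: "ball_analytic h" and s: "0 \<le> s" "s < 1" and z: "norm z = 1" and a: "0 \<le> a" "a < 1"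
  shows "ennreal (cmod (dilate h (a * s) z)) \<le> slice_mean a (\<lambda>z. ennreal (cmod (dilate h s z))) z"
    and "ennreal ((cmod (dilate h (a * s) z))\<^sup>2) \<le> slice_mean a (\<lambda>z. ennreal ((cmod (dilate h s z))\<^sup>2)) z"
    and "(LINT w|circle_measure. poisson a w * dilate h s (w *s z)) = dilate h (a * s) z"
proof -
  obtain R where R: "1 < R" "(\<lambda>t. dilate h s (t *s z)) holomorphic_on ball 0 R"
    "(\<lambda>t. dilate h s (t *s z)) \<in> borel_measurable borel"
    using dilate_slice[OF h s z] by blast
  have e: "dilate h s (complex_of_real a *s z) = dilate h (a * s) z"
    by (simp add: dilate_def of_real_cscale mult.commute)
  show "ennreal (cmod (dilate h (a * s) z)) \<le> slice_mean a (\<lambda>z. ennreal (cmod (dilate h s z))) z"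
    using poisson_subharmonic(1)[OF R(2,1) a R(3)] by (simp add: e slice_mean_def)
  show "ennreal ((cmod (dilate h (a * s) z))\<^sup>2) \<le> slice_mean a (\<lambda>z. ennreal ((cmod (dilate h s z))\<^sup>2)) z"
    using poisson_subharmonic(2)[OF R(2,1) a R(3)] by (simp add: e slice_mean_def)
  show "(LINT w|circle_measure. poisson a w * dilate h s (w *s z)) = dilate h (a * s) z"
    using poisson_formula(2)[OF R(2,1) a R(3)] by (simp add: e)
qed

section \<open>Closure properties of analytic functions on the ball\<close>

lemma clinear_iff:
  fixes D :: "complex^'n \<Rightarrow> complex"
  shows "Vector_Spaces.linear (*s) (*) D \<longleftrightarrow> (\<forall>x y. D (x + y) = D x + D y) \<and> (\<forall>c x. D (c *s x) = c * D x)"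
  by (auto simp: Vector_Spaces.linear_iff vec.vector_space_axioms vector_space_over_itself.vector_space_axioms)

lemma analytic_on_ball_add:
  assumes "analytic_on_ball f" "analytic_on_ball g"
  shows "analytic_on_ball (\<lambda>z. f z + g z)"
  unfolding analytic_on_ball_def
proof
  fix z :: "complex^'a" assume "z \<in> ball 0 1"
  then obtain D E where "Vector_Spaces.linear (*s) (*) D" "(f has_derivative D) (at z)"
    "Vector_Spaces.linear (*s) (*) E" "(g has_derivative E) (at z)"
    using assms unfolding analytic_on_ball_def by blast
  then show "\<exists>D. Vector_Spaces.linear (*s) (*) D \<and> ((\<lambda>z. f z + g z) has_derivative D) (at z)"
    by (intro exI[of _ "\<lambda>x. D x + E x"]) (auto simp: clinear_iff algebra_simps intro!: has_derivative_add)
qed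

lemma analytic_on_ball_mult:
  assumes "analytic_on_ball f" "analytic_on_ball g"
  shows "analytic_on_ball (\<lambda>z. f z * g z)"
  unfolding analytic_on_ball_def
proof
  fix z :: "complex^'a" assume "z \<in> ball 0 1"
  then obtain D E where "Vector_Spaces.linear (*s) (*) D" "(f has_derivative D) (at z)"
    "Vector_Spaces.linear (*s) (*) E" "(g has_derivative E) (at z)"
    using assms unfolding analytic_on_ball_def by blast
  moreover from this have "((\<lambda>z. f z * g z) has_derivative (\<lambda>x. f z * E x + D x * g z)) (at z)"
    by (intro has_derivative_mult)
  ultimately show "\<exists>D. Vector_Spaces.linear (*s) (*) D \<and> ((\<lambda>z. f z * g z) has_derivative D) (at z)"
    by (intro exI[of _ "\<lambda>x. f z * E x + D x * g z"]) (auto simp: clinear_iff algebra_simps)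
qed

lemma analytic_on_ball_const: "analytic_on_ball (\<lambda>_. c)"
  unfolding analytic_on_ball_def by (auto intro!: exI[of _ "\<lambda>_. 0"] simp: clinear_iff)

lemma analytic_on_ball_clinear:
  fixes D :: "complex^'n \<Rightarrow> complex"
  assumes "Vector_Spaces.linear (*s) (*) D"
  shows "analytic_on_ball D"
proof -
  have "D (r *\<^sub>R x) = r *\<^sub>R D x" for r x
  proof -
    have "D (r *\<^sub>R x) = D (complex_of_real r *s x)" by (simp only: of_real_cscale)
    then show ?thesis using assms by (simp add: clinear_iff scaleR_conv_of_real)
  qed
  then have "bounded_linear D"
    using assms by (intro linear_conv_bounded_linear[THEN iffD1] linearI) (auto simp: clinear_iff)
  then show ?thesis
    unfolding analytic_on_ball_def using assms bounded_linear_imp_has_derivative by blast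
qed

lemma analytic_on_ball_nth: "analytic_on_ball (\<lambda>z. z $ j)"
  by (rule analytic_on_ball_clinear) (simp add: clinear_iff)

lemma analytic_on_ball_cong:
  assumes "\<And>z. z \<in> ball 0 1 \<Longrightarrow> f z = g z" "analytic_on_ball f"
  shows "analytic_on_ball g"
  unfolding analytic_on_ball_def
proof
  fix z :: "complex^'a" assume z: "z \<in> ball 0 1"
  then obtain D where "Vector_Spaces.linear (*s) (*) D" "(f has_derivative D) (at z)"
    using assms unfolding analytic_on_ball_def by blast
  then show "\<exists>D. Vector_Spaces.linear (*s) (*) D \<and> (g has_derivative D) (at z)"
    using has_derivative_transform_within_open[of f D z UNIV "ball 0 1" g] z assms(1) by auto
qed

lemma ball_analytic_add: "ball_analytic f \<Longrightarrow> ball_analytic g \<Longrightarrow> ball_analytic (\<lambda>z. f z + g z)"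
  by (simp add: ball_analytic_def analytic_on_ball_add)

lemma ball_analytic_mult: "analytic_on_ball f \<Longrightarrow> ball_analytic g \<Longrightarrow> ball_analytic (\<lambda>z. f z * g z)"
  by (simp add: ball_analytic_def analytic_on_ball_mult)

lemma ball_analytic_cmult: "ball_analytic g \<Longrightarrow> ball_analytic (\<lambda>z. c * g z)"
  by (rule ball_analytic_mult[OF analytic_on_ball_const])

lemma ball_analytic_diff: "ball_analytic f \<Longrightarrow> ball_analytic g \<Longrightarrow> ball_analytic (\<lambda>z. f z - g z)"
  using ball_analytic_add[of f "\<lambda>z. -1 * g z"] ball_analytic_cmult[of g "-1"] by simp

lemma clinear_bounded:
  fixes A :: "complex^'n \<Rightarrow> complex^'n"
  assumes "Vector_Spaces.linear (*s) (*s) A"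
  shows "bounded_linear A"
proof -
  interpret Vector_Spaces.linear "(*s)" "(*s)" A by (rule assms)
  show ?thesis
    using scale[of "complex_of_real _"]
    by (intro linear_conv_bounded_linear[THEN iffD1] linearI) (simp_all add: add of_real_cscale)
qed

lemma ball_analytic_composition:
  fixes A :: "complex^'n \<Rightarrow> complex^'n"
  assumes A: "Vector_Spaces.linear (*s) (*s) A" "\<And>z. norm (A z) \<le> norm z" and h: "ball_analytic h"
  shows "ball_analytic (composition_op A h)"
proof -
  interpret Vector_Spaces.linear "(*s)" "(*s)" A by (rule A(1))
  have "analytic_on_ball (\<lambda>z. h (A z))"
    unfolding analytic_on_ball_def
  proof
    fix z :: "complex^'n" assume "z \<in> ball 0 1"
    then have "A z \<in> ball 0 1" using A(2)[of z] by simp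
    then obtain D where D: "Vector_Spaces.linear (*s) (*) D" "(h has_derivative D) (at (A z))"
      using h unfolding analytic_on_ball_def ball_analytic_def by blast
    have "((\<lambda>z. h (A z)) has_derivative (\<lambda>x. D (A x))) (at z)"
      by (rule has_derivative_compose[OF bounded_linear_imp_has_derivative[OF clinear_bounded[OF A(1)]] D(2)])
    moreover have "Vector_Spaces.linear (*s) (*) (\<lambda>x. D (A x))"
      using D(1) by (simp add: clinear_iff add scale)
    ultimately show "\<exists>D. Vector_Spaces.linear (*s) (*) D \<and> ((\<lambda>z. h (A z)) has_derivative D) (at z)" by blast
  qed
  then have "analytic_on_ball (composition_op A h)"
    by (rule analytic_on_ball_cong[rotated]) (simp add: composition_op_def)
  then show ?thesis by (simp add: ball_analytic_def composition_op_def)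
qed

section \<open>Quadratic means of dilates\<close>

lemma integrable_sphere_bounded:
  fixes f :: "complex^'n \<Rightarrow> 'b::{banach, second_countable_topology}"
  assumes "f \<in> borel_measurable sphere_measure" "\<And>z. norm z = 1 \<Longrightarrow> norm (f z) \<le> K"
  shows "integrable sphere_measure f"
proof (rule finite_measure.integrable_const_bound[OF finite_measure_sphere_measure])
  show "AE z in sphere_measure. norm (f z) \<le> K"
    by (rule AE_I2) (use assms(2) in simp)
qed (fact assms(1))

definition dilate_mean :: "(complex^'n \<Rightarrow> complex) \<Rightarrow> real \<Rightarrow> real" where
  "dilate_mean h r = (LINT z|sphere_measure. (cmod (dilate h r z))\<^sup>2)"

lemma dilate_measurable_sphere:
  "ball_analytic h \<Longrightarrow> dilate h r \<in> borel_measurable sphere_measure"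
  by (intro measurable_sphere_measure borel_measurable_dilate ball_analytic_measurable)

lemma dilate_integrable:
  assumes h: "ball_analytic h" "0 \<le> r" "r < 1" "0 \<le> s" "s < 1"
  shows "integrable sphere_measure (\<lambda>z. dilate h r z * cnj (dilate h s z))" (is ?A)
    and "integrable sphere_measure (\<lambda>z. (cmod (dilate h r z))\<^sup>2)" (is ?B)
proof -
  note [measurable] = dilate_measurable_sphere[OF h(1)]
  obtain K where K: "\<And>z. norm z \<le> 1 \<Longrightarrow> cmod (dilate h r z) \<le> K" using dilate_bounded h by metis
  obtain K' where K': "\<And>z. norm z \<le> 1 \<Longrightarrow> cmod (dilate h s z) \<le> K'" using dilate_bounded h by metis
  have K0: "0 \<le> K" using order_trans[OF norm_ge_zero K[of 0]] by simp
  show ?A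
    by (rule integrable_sphere_bounded[where K="K * K'"]) (use K K' K0 in \<open>auto simp: norm_mult intro!: mult_mono\<close>)
  show ?B
    by (rule integrable_sphere_bounded[where K="K\<^sup>2"]) (use K K0 in \<open>auto intro!: power_mono\<close>)
qed

lemma nn_integral_dilate:
  assumes "ball_analytic h" "0 \<le> r" "r < 1"
  shows "(\<integral>\<^sup>+z. ennreal ((cmod (dilate h r z))\<^sup>2) \<partial>sphere_measure) = ennreal (dilate_mean h r)"
  unfolding dilate_mean_def
  by (rule nn_integral_eq_integral[OF dilate_integrable(2)]) (use assms in auto)

lemma dilate_mean_nonneg: "0 \<le> dilate_mean h r"
  unfolding dilate_mean_def by (rule integral_nonneg_AE) auto

text \<open>Subharmonicity on slices with \<open>a = r / s\<close>, integrated over the sphere;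
  slice means do not change the integral.\<close>

lemma dilate_mean_mono:
  fixes h :: "complex^'n \<Rightarrow> complex"
  assumes h: "ball_analytic h" and rs: "0 \<le> r" "r \<le> s" "s < 1"
  shows "dilate_mean h r \<le> dilate_mean h s"
proof (cases "r = s")
  case False
  note [measurable] = borel_measurable_dilate[OF ball_analytic_measurable[OF h]]
  define a where "a = r / s"
  have a: "0 \<le> a" "a < 1" "a * s = r" "0 \<le> s" using rs False by (auto simp: a_def)
  have "ennreal (dilate_mean h r) = (\<integral>\<^sup>+z. ennreal ((cmod (dilate h (a * s) z))\<^sup>2) \<partial>sphere_measure)"
    using nn_integral_dilate[OF h rs(1)] rs a by simp
  also have "\<dots> \<le> (\<integral>\<^sup>+z. slice_mean a (\<lambda>z. ennreal ((cmod (dilate h s z))\<^sup>2)) z \<partial>(sphere_measure :: (complex^'n) measure))"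
    by (rule nn_integral_mono, rule dilate_slice_mean(2)[OF h]) (use a rs in auto)
  also have "\<dots> = (\<integral>\<^sup>+z. ennreal ((cmod (dilate h s z))\<^sup>2) \<partial>sphere_measure)"
    by (rule nn_integral_slice_mean) (use a in auto)
  also have "\<dots> = ennreal (dilate_mean h s)"
    by (rule nn_integral_dilate) (use h rs a in auto)
  finally show ?thesis using dilate_mean_nonneg[of h s] by simp
qed simp

lemma hardy_norm_sq_eq:
  assumes "ball_analytic h"
  shows "hardy_norm_sq h = (SUP r\<in>{0<..<1}. ennreal (dilate_mean h r))"
  unfolding hardy_norm_sq_def
  by (intro SUP_cong refl) (use nn_integral_dilate[OF assms] in \<open>simp add: dilate_def\<close>)

text \<open>By the symmetry of slice means a factor of the radius moves from one argument to the
  other. In effect the inner product of two dilates sees only the product of the radii, which stands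
  in for the orthogonality of homogeneous components.\<close>

lemma dilate_inner_shift:
  fixes h :: "complex^'n \<Rightarrow> complex"
  assumes h: "ball_analytic h" and a: "0 \<le> a" "a < 1" and s: "0 \<le> s" "s < 1" and t: "0 \<le> t" "t < 1"
  shows "(LINT z|sphere_measure. dilate h (a * s) z * cnj (dilate h t z))
       = (LINT z|sphere_measure. dilate h s z * cnj (dilate h (a * t) z))"
proof -
  obtain K where K: "\<And>z. norm z \<le> 1 \<Longrightarrow> cmod (dilate h s z) \<le> K" using dilate_bounded[OF h s] by metis
  obtain K' where K': "\<And>z. norm z \<le> 1 \<Longrightarrow> cmod (dilate h t z) \<le> K'" using dilate_bounded[OF h t] by metis
  note m = borel_measurable_dilate[OF ball_analytic_measurable[OF h]]
  have "(LINT z|sphere_measure. (LINT w|circle_measure. poisson a w * dilate h s (w *s z)) * cnj (dilate h t z))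
    = (LINT z|sphere_measure. dilate h s z * cnj (LINT w|circle_measure. poisson a w * dilate h t (w *s z)))"
    by (rule slice_mean_symmetric_complex[OF a m m, where K = "max K K'"]) (use K K' in \<open>auto simp: max.coboundedI1 max.coboundedI2\<close>)
  moreover have "(LINT z|sphere_measure. (LINT w|circle_measure. poisson a w * dilate h s (w *s z)) * cnj (dilate h t z))
    = (LINT z|sphere_measure. dilate h (a * s) z * cnj (dilate h t z))"
    by (rule Bochner_Integration.integral_cong[OF refl]) (use dilate_slice_mean(3)[OF h s _ a] in simp)
  moreover have "(LINT z|sphere_measure. dilate h s z * cnj (LINT w|circle_measure. poisson a w * dilate h t (w *s z)))
    = (LINT z|sphere_measure. dilate h s z * cnj (dilate h (a * t) z))"
    by (rule Bochner_Integration.integral_cong[OF refl]) (use dilate_slice_mean(3)[OF h t _ a] in simp)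
  ultimately show ?thesis by simp
qed

text \<open>
  In terms of Taylor coefficients both sides are \<open>\<Sum> (r\<^sup>k - s\<^sup>k)\<^sup>2 \<parallel>h\<^sub>k\<parallel>\<^sup>2\<close>.
\<close>

lemma dilate_mean_diff:
  fixes h :: "complex^'n \<Rightarrow> complex"
  assumes h: "ball_analytic h" and r: "0 < r" "r \<le> s" "s < 1"
  shows "(LINT z|sphere_measure. (cmod (dilate h r z - dilate h s z))\<^sup>2)
       = dilate_mean h r + dilate_mean h s - 2 * dilate_mean h (sqrt (r * s))"
proof -
  \<comment> \<open>The geometric mean has the same square as the product of \<open>r\<close> and
    \<open>s\<close>, so the mixed term becomes the squared norm of a single dilate.\<close>
  define m where "m = sqrt (r * s)"
  have m: "0 < m" "m < 1" "m * m = r * s"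
    using r mult_strict_mono[of r 1 s 1] by (auto simp: m_def)
  have ms: "m \<le> s" unfolding m_def using r by (intro real_le_lsqrt) (auto simp: power2_eq_square)
  have inner: "(LINT z|sphere_measure. dilate h r z * cnj (dilate h s z)) = (LINT z|sphere_measure. dilate h m z * cnj (dilate h m z))"
  proof (cases "m = s")
    case True
    then have "r = s" using m r by simp
    with True show ?thesis by simp
  next
    case False
    define a where "a = m / s"
    have a: "0 \<le> a" "a < 1" using m r ms False by (auto simp: a_def)
    have "a * m = r" "a * s = m" using m r by (auto simp: a_def)
    then show ?thesis using dilate_inner_shift[OF h a, of m s] m r by simp
  qed
  have re: "(LINT z|sphere_measure. dilate h m z * cnj (dilate h m z)) = complex_of_real (dilate_mean h m)"
    unfolding dilate_mean_def by (subst integral_complex_of_real[symmetric]) (simp add: complex_norm_square del: of_real_power)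
  have rs: "(cmod (x - y))\<^sup>2 = (cmod x)\<^sup>2 + (cmod y)\<^sup>2 - 2 * Re (x * cnj y)" for x y
    unfolding cmod_power2 by (simp add: power2_eq_square algebra_simps)
  have I: "integrable sphere_measure (\<lambda>z. dilate h r z * cnj (dilate h s z))" "integrable sphere_measure (\<lambda>z. (cmod (dilate h r z))\<^sup>2)"
    "integrable sphere_measure (\<lambda>z. (cmod (dilate h s z))\<^sup>2)"
    using dilate_integrable(1)[OF h, of r s] dilate_integrable(2)[OF h, of r r] dilate_integrable(2)[OF h, of s s] r by auto
  have "(LINT z|sphere_measure. (cmod (dilate h r z - dilate h s z))\<^sup>2)
     = dilate_mean h r + dilate_mean h s - 2 * (LINT z|sphere_measure. Re (dilate h r z * cnj (dilate h s z)))"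
    unfolding rs dilate_mean_def using I by (simp del: times_complex.sel)
  also have "(LINT z|sphere_measure. Re (dilate h r z * cnj (dilate h s z))) = dilate_mean h m"
    using I(1) inner re by (simp del: times_complex.sel)
  finally show ?thesis by (simp add: m_def)
qed

lemma dilate_mean_le_norm:
  assumes "ball_analytic h" "0 < r" "r < 1"
  shows "ennreal (dilate_mean h r) \<le> hardy_norm_sq h"
  unfolding hardy_norm_sq_eq[OF assms(1)] by (rule SUP_upper) (use assms in auto)

text \<open>The means are bounded by \<open>L\<close> and exceed \<open>L - e / 2\<close> from some
  radius \<open>\<rho>\<close> on. The geometric mean of two radii beyond \<open>\<rho>\<close> is
  again beyond \<open>\<rho>\<close>, so \<open>dilate_mean_diff\<close> yields at most
  \<open>L + L - 2 * (L - e / 2) = e\<close>.\<close>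

lemma dilate_Cauchy:
  assumes h: "ball_analytic h" and fin: "hardy_norm_sq h < \<infinity>" and e: "0 < e"
  obtains \<rho> where "0 < \<rho>" "\<rho> < 1" "\<And>r s. \<rho> \<le> r \<Longrightarrow> r \<le> s \<Longrightarrow> s < 1 \<Longrightarrow>
    (LINT z|sphere_measure. (cmod (dilate h r z - dilate h s z))\<^sup>2) \<le> e"
proof -
  define L where "L = enn2real (hardy_norm_sq h)"
  have L: "ennreal L = hardy_norm_sq h" "0 \<le> L" using fin by (auto simp: L_def)
  have le: "dilate_mean h r \<le> L" if "0 < r" "r < 1" for r
    using dilate_mean_le_norm[OF h that] L by (metis ennreal_le_iff)
  obtain \<rho> where rho: "0 < \<rho>" "\<rho> < 1" "L - e / 2 < dilate_mean h \<rho>"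
  proof (cases "L - e / 2 < 0")
    case True
    show ?thesis by (rule that[of "1/2"]) (use True dilate_mean_nonneg[of h "1/2"] in auto)
  next
    case False
    then have "ennreal (L - e / 2) < (SUP r\<in>{0<..<1}. ennreal (dilate_mean h r))"
      unfolding hardy_norm_sq_eq[OF h, symmetric] L(1)[symmetric] using e by (simp add: ennreal_less_iff)
    then obtain r where "r \<in> {0<..<1}" "ennreal (L - e / 2) < ennreal (dilate_mean h r)"
      by (auto simp: less_SUP_iff)
    then show ?thesis using False by (intro that[of r]) (auto simp: ennreal_less_iff)
  qed
  show ?thesis
  proof (rule that[OF rho(1,2)])
    fix r s assume rs: "\<rho> \<le> r" "r \<le> s" "s < 1"
    have "\<rho> \<le> sqrt (r * s)" using rs rho mult_mono[of \<rho> r \<rho> s] by (intro real_le_rsqrt) (auto simp: power2_eq_square)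
    moreover have "sqrt (r * s) < 1" using rs rho mult_strict_mono[of r 1 s 1] by auto
    ultimately have "dilate_mean h \<rho> \<le> dilate_mean h (sqrt (r * s))"
      using rho by (intro dilate_mean_mono[OF h]) auto
    then show "(LINT z|sphere_measure. (cmod (dilate h r z - dilate h s z))\<^sup>2) \<le> e"
      using dilate_mean_diff[OF h, of r s] le[of r] le[of s] rho rs by auto
  qed
qed

subsection \<open>Radial limits\<close>

text \<open>The restriction to rational radii makes this square of the radial maximal function measurable.\<close>

definition radial_max_sq :: "(complex^'n \<Rightarrow> complex) \<Rightarrow> complex^'n \<Rightarrow> ennreal" where
  "radial_max_sq h z = (SUP r\<in>\<rat> \<inter> {0<..<1}. ennreal ((cmod (dilate h r z))\<^sup>2))"

lemma countable_rat_Ioo: "countable (\<rat> \<inter> {0<..<1::real})"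
  by (rule countable_subset[OF _ countable_rat]) auto

lemma rat_Ioo_nonempty: "\<rat> \<inter> {0<..<1::real} \<noteq> {}"
proof -
  have "1/2 \<in> \<rat> \<inter> {0<..<1::real}" by auto
  then show ?thesis by blast
qed

lemma pred_countable_Ball:
  assumes "countable X" "X \<noteq> {}" "\<And>i. Measurable.pred M (P i)"
  shows "Measurable.pred M (\<lambda>x. \<forall>i\<in>X. P i x)"
proof -
  have "(\<forall>i\<in>X. P i x) \<longleftrightarrow> (\<forall>n. P (from_nat_into X n) x)" for x
    using range_from_nat_into[OF assms(2,1)] by (metis imageE rangeI)
  then show ?thesis using assms(3) by simp
qed

lemma borel_measurable_radial_max_sq:
  assumes "ball_analytic h" shows "radial_max_sq h \<in> borel_measurable borel"
proof -
  note [measurable] = borel_measurable_dilate[OF ball_analytic_measurable[OF assms]]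
  show ?thesis
    unfolding radial_max_sq_def [abs_def] by (rule borel_measurable_SUP[OF countable_rat_Ioo]) measurable
qed

text \<open>The rational radii are enumerated and cut off after \<open>N\<close> of them;
  \<open>slice_maximal\<close> applies with a constant independent of \<open>N\<close>, and monotone
  convergence removes the cut-off.\<close>

lemma nn_integral_radial_max_sq:
  fixes h :: "complex^'n \<Rightarrow> complex"
  assumes h: "ball_analytic h"
  shows "(\<integral>\<^sup>+z. radial_max_sq h z \<partial>sphere_measure) \<le> 256 * hardy_norm_sq h"
proof -
  note [measurable] = borel_measurable_dilate[OF ball_analytic_measurable[OF h]]
  note m = measurable_sphere_measure
  define Q where "Q = \<rat> \<inter> {0<..<1::real}"
  have Q: "countable Q" "Q \<noteq> {}" using countable_rat_Ioo rat_Ioo_nonempty unfolding Q_def by blast+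
  define \<rho> where "\<rho> = from_nat_into Q"
  have range: "range \<rho> = Q" unfolding \<rho>_def using Q by (simp add: range_from_nat_into)
  then have rho: "0 < \<rho> i" "\<rho> i < 1" for i by (auto simp: Q_def set_eq_iff)
  define V where "V i z = ennreal ((cmod (dilate h (\<rho> i) z))\<^sup>2)" for i and z :: "complex^'n"
  have V[measurable]: "V i \<in> borel_measurable borel" for i unfolding V_def [abs_def] by measurable
  define W where "W N z = (SUP i\<in>{..<N}. V i z)" for N :: nat and z :: "complex^'n"
  have W[measurable]: "W N \<in> borel_measurable borel" for N unfolding W_def [abs_def] by measurable
  have "radial_max_sq h z = (SUP N. W N z)" for z
  proof -
    have "radial_max_sq h z = (SUP i. V i z)"
      unfolding radial_max_sq_def Q_def[symmetric] range[symmetric] V_def by (simp add: image_comp)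
    also have "\<dots> = (SUP N. W N z)"
    proof (rule antisym)
      show "(SUP i. V i z) \<le> (SUP N. W N z)"
      proof (rule SUP_least)
        fix i
        have "V i z \<le> W (Suc i) z" unfolding W_def by (rule SUP_upper) simp
        also have "\<dots> \<le> (SUP N. W N z)" by (rule SUP_upper) simp
        finally show "V i z \<le> (SUP N. W N z)" .
      qed
      show "(SUP N. W N z) \<le> (SUP i. V i z)"
        unfolding W_def by (intro SUP_least SUP_upper) simp
    qed
    finally show ?thesis .
  qed
  then have "(\<integral>\<^sup>+z. radial_max_sq h z \<partial>sphere_measure) = (\<integral>\<^sup>+z. (SUP N. W N z) \<partial>sphere_measure)" by simp
  also have "\<dots> = (SUP N. \<integral>\<^sup>+z. W N z \<partial>sphere_measure)"
    by (rule nn_integral_monotone_convergence_SUP)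
       (auto simp: W_def incseq_def le_fun_def intro!: m SUP_subset_mono)
  also have "\<dots> \<le> 256 * hardy_norm_sq h"
  proof (rule SUP_least)
    fix N
    define M where "M = Max (insert 0 (\<rho> ` {..<N}))"
    have M: "0 \<le> M" "M < 1" "\<And>i. i < N \<Longrightarrow> \<rho> i \<le> M"
      using rho by (auto simp: M_def)
    \<comment> \<open>A radius strictly between the first \<open>N\<close> radii and 1: each
      \<open>dilate h (\<rho> i)\<close> is dominated by a slice mean of the bounded function
      \<open>dilate h s\<close>.\<close>
    define s where "s = (1 + M) / 2"
    have s: "0 < s" "s < 1" "\<And>i. i < N \<Longrightarrow> \<rho> i < s"
      using M by (fastforce simp: s_def)+
    obtain K where K: "\<And>z. norm z \<le> 1 \<Longrightarrow> cmod (dilate h s z) \<le> K" using dilate_bounded[OF h, of s] s by force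
    have "(\<integral>\<^sup>+z. W N z \<partial>sphere_measure)
       \<le> (\<integral>\<^sup>+z. (SUP i\<in>{..<N}. ennreal (cmod (dilate h (\<rho> i) z)))\<^sup>2 \<partial>(sphere_measure :: (complex^'n) measure))"
    proof (rule nn_integral_mono)
      fix z :: "complex^'n"
      show "W N z \<le> (SUP i\<in>{..<N}. ennreal (cmod (dilate h (\<rho> i) z)))\<^sup>2"
        unfolding W_def
      proof (rule SUP_least)
        fix i assume "i \<in> {..<N}"
        then have "ennreal (cmod (dilate h (\<rho> i) z)) \<le> (SUP i\<in>{..<N}. ennreal (cmod (dilate h (\<rho> i) z)))"
          by (rule SUP_upper)
        then have "(ennreal (cmod (dilate h (\<rho> i) z)))\<^sup>2 \<le> (SUP i\<in>{..<N}. ennreal (cmod (dilate h (\<rho> i) z)))\<^sup>2"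
          by (rule power_mono) simp
        then show "V i z \<le> (SUP i\<in>{..<N}. ennreal (cmod (dilate h (\<rho> i) z)))\<^sup>2"
          by (simp add: V_def ennreal_power)
      qed
    qed
    also have "\<dots> \<le> 256 * (\<integral>\<^sup>+z. (ennreal (cmod (dilate h s z)))\<^sup>2 \<partial>(sphere_measure :: (complex^'n) measure))"
    proof (rule slice_maximal[where r = "\<lambda>i. \<rho> i / s" and K = "ennreal K"])
      fix i and z :: "complex^'n" assume i: "i < N" and z: "norm z = 1"
      have "\<rho> i = \<rho> i / s * s" using s by simp
      then show "ennreal (cmod (dilate h (\<rho> i) z)) \<le> slice_mean (\<rho> i / s) (\<lambda>z. ennreal (cmod (dilate h s z))) z"
        using dilate_slice_mean(1)[OF h _ s(2) z, of "\<rho> i / s"] s i rho(1)[of i] by simp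
    qed (use s rho K in \<open>auto simp: less_imp_le intro!: ennreal_leI\<close>)
    also have "(\<integral>\<^sup>+z. (ennreal (cmod (dilate h s z)))\<^sup>2 \<partial>(sphere_measure :: (complex^'n) measure)) = ennreal (dilate_mean h s)"
      using nn_integral_dilate[OF h, of s] s by (simp add: ennreal_power)
    also have "\<dots> \<le> hardy_norm_sq h" by (rule dilate_mean_le_norm[OF h s(1,2)])
    finally show "(\<integral>\<^sup>+z. W N z \<partial>sphere_measure) \<le> 256 * hardy_norm_sq h" by (simp add: mult_left_mono)
  qed
  finally show ?thesis .
qed

lemma dilate_continuous:
  assumes "ball_analytic h" "norm z = 1"
  shows "continuous_on {0<..<1} (\<lambda>r. dilate h r z)"
  unfolding dilate_def
  by (rule continuous_on_compose2[OF ball_analytic_continuous[OF assms(1)]])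
     (use assms(2) in \<open>auto intro!: continuous_intros\<close>)

lemma dilate_rational_approx:
  assumes h: "ball_analytic h" "norm z = 1" and r: "0 < r" "r < 1" and d: "0 < \<delta>"
  obtains q where "q \<in> \<rat>" "r < q" "q < 1" "cmod (dilate h q z - dilate h r z) < \<delta>"
proof -
  obtain e where e: "0 < e" "\<And>q. q \<in> {0<..<1} \<Longrightarrow> dist q r < e \<Longrightarrow> dist (dilate h q z) (dilate h r z) < \<delta>"
    using dilate_continuous[OF h] r d unfolding continuous_on_iff by (metis greaterThanLessThan_iff)
  obtain q where q: "q \<in> \<rat>" "r < q" "q < min (r + e) 1"
    using Rats_dense_in_real[of r "min (r + e) 1"] e r by auto
  then have "dist q r < e" by (auto simp: dist_real_def)
  then show ?thesis using e(2)[of q] q r by (intro that[of q]) (auto simp: dist_norm)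
qed

text \<open>Continuity along the radius extends the bound from the rational radii of the
  definition.\<close>

lemma dilate_le_radial_max:
  assumes h: "ball_analytic h" "norm z = 1" and r: "0 < r" "r < 1"
  shows "ennreal ((cmod (dilate h r z))\<^sup>2) \<le> radial_max_sq h z"
proof (cases "radial_max_sq h z = top")
  case False
  define m where "m = sqrt (enn2real (radial_max_sq h z))"
  have m: "radial_max_sq h z = ennreal (m\<^sup>2)" "0 \<le> m" using False by (auto simp: m_def less_top)
  have q: "cmod (dilate h q z) \<le> m" if "q \<in> \<rat>" "0 < q" "q < 1" for q
  proof -
    have "ennreal ((cmod (dilate h q z))\<^sup>2) \<le> radial_max_sq h z"
      unfolding radial_max_sq_def by (rule SUP_upper) (use that in auto)
    then show ?thesis using m by (auto intro: power2_le_imp_le)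
  qed
  have "cmod (dilate h r z) \<le> m"
  proof (rule field_le_epsilon)
    fix e :: real assume "0 < e"
    then obtain p where p: "p \<in> \<rat>" "r < p" "p < 1" "cmod (dilate h p z - dilate h r z) < e"
      using dilate_rational_approx[OF h r] by blast
    then show "cmod (dilate h r z) \<le> m + e"
      using q[of p] r norm_triangle_ineq2[of "dilate h r z" "dilate h p z"] by (simp add: norm_minus_commute)
  qed
  then show ?thesis by (simp add: m(1) power_mono)
qed simp

lemma Cauchy_at_left_limit:
  fixes f :: "real \<Rightarrow> complex"
  assumes "\<And>e. 0 < e \<Longrightarrow> \<exists>r0<1. \<forall>r\<in>{r0<..<1}. \<forall>r'\<in>{r0<..<1}. cmod (f r - f r') \<le> e"
  obtains l where "(f \<longlongrightarrow> l) (at_left 1)"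
proof -
  define x where "x n = 1 - 1 / real (n + 2)" for n
  have x: "x \<longlonglongrightarrow> 1" unfolding x_def by real_asymp
  have x1: "x n < 1" for n by (simp add: x_def)
  have ev: "eventually (\<lambda>n. x n \<in> {r0<..<1}) sequentially" if "r0 < 1" for r0
    using order_tendstoD(1)[OF x that] x1 by (auto elim: eventually_mono)
  have "Cauchy (\<lambda>n. f (x n))"
  proof (rule metric_CauchyI)
    fix e :: real assume "0 < e"
    then obtain r0 where r0: "r0 < 1" "\<forall>r\<in>{r0<..<1}. \<forall>r'\<in>{r0<..<1}. cmod (f r - f r') \<le> e / 2"
      using assms[of "e / 2"] by auto
    from ev[OF r0(1)] obtain N where N: "\<And>n. n \<ge> N \<Longrightarrow> x n \<in> {r0<..<1}" by (auto simp: eventually_sequentially)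
    show "\<exists>M. \<forall>m\<ge>M. \<forall>n\<ge>M. dist (f (x m)) (f (x n)) < e"
    proof (intro exI[of _ N] allI impI)
      fix m n assume "N \<le> m" "N \<le> n"
      then have "cmod (f (x m) - f (x n)) \<le> e / 2" using r0(2) N by blast
      then show "dist (f (x m)) (f (x n)) < e" using \<open>0 < e\<close> by (simp add: dist_norm)
    qed
  qed
  then obtain l where l: "(\<lambda>n. f (x n)) \<longlonglongrightarrow> l" using Cauchy_convergent convergent_def by blast
  have "(f \<longlongrightarrow> l) (at_left 1)"
  proof (rule tendstoI)
    fix e :: real assume "0 < e"
    then obtain r0 where r0: "r0 < 1" "\<forall>r\<in>{r0<..<1}. \<forall>r'\<in>{r0<..<1}. cmod (f r - f r') \<le> e / 3"
      using assms[of "e / 3"] by auto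
    have evn: "eventually (\<lambda>n. x n \<in> {r0<..<1} \<and> dist (f (x n)) l < e / 3) sequentially"
      using ev[OF r0(1)] tendstoD[OF l, of "e / 3"] \<open>0 < e\<close> by (auto elim: eventually_elim2)
    then obtain n where n: "x n \<in> {r0<..<1}" "dist (f (x n)) l < e / 3"
      using eventually_happens'[OF sequentially_bot evn] by blast
    have "dist (f r) l < e" if "r \<in> {r0<..<1}" for r
    proof -
      have "cmod (f r - f (x n)) \<le> e / 3" using r0(2) that n(1) by blast
      then have "dist (f r) (f (x n)) \<le> e / 3" by (simp add: dist_norm)
      then show ?thesis using n(2) dist_triangle[of "f r" l "f (x n)"] \<open>0 < e\<close> by linarith
    qed
    then show "\<forall>\<^sub>F r in at_left 1. dist (f r) l < e"
      unfolding eventually_at_left_field using r0(1) by (intro exI[of _ r0]) auto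
  qed
  then show ?thesis by (rule that)
qed

text \<open>The Cauchy criterion at 1, written with rational radii and countable quantifiers so that
  it visibly defines a Borel set.\<close>

definition radially_convergent :: "(complex^'n \<Rightarrow> complex) \<Rightarrow> (complex^'n) set" where
  "radially_convergent h = {z. \<forall>n::nat. \<exists>m::nat. \<forall>p\<in>\<rat> \<inter> {0<..<1}. \<forall>q\<in>\<rat> \<inter> {0<..<1}.
     1 - 1 / real (Suc m) < p \<longrightarrow> 1 - 1 / real (Suc m) < q \<longrightarrow> cmod (dilate h p z - dilate h q z) \<le> 1 / real (Suc n)}"

lemma radially_convergent_measurable:
  assumes "ball_analytic h" shows "radially_convergent h \<in> sets borel"
proof -
  note [measurable] = borel_measurable_dilate[OF ball_analytic_measurable[OF assms]]
  have "Measurable.pred borel (\<lambda>z. \<forall>n::nat. \<exists>m::nat. \<forall>p\<in>\<rat> \<inter> {0<..<1}. \<forall>q\<in>\<rat> \<inter> {0<..<1}.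
     1 - 1 / real (Suc m) < p \<longrightarrow> 1 - 1 / real (Suc m) < q \<longrightarrow> cmod (dilate h p z - dilate h q z) \<le> 1 / real (Suc n))"
    by (intro pred_intros_countable pred_countable_Ball countable_rat_Ioo rat_Ioo_nonempty) measurable
  then show ?thesis by (simp add: radially_convergent_def pred_def)
qed

text \<open>Continuity along the radius passes the Cauchy condition from rational to arbitrary
  radii; each of the two approximations and the condition itself costs a third of
  \<open>e\<close>.\<close>

lemma radially_convergent_iff:
  assumes h: "ball_analytic h" and z: "norm z = 1"
  shows "z \<in> radially_convergent h \<longleftrightarrow> (\<exists>l. ((\<lambda>r. h (r *\<^sub>R z)) \<longlongrightarrow> l) (at_left 1))"
proof
  assume G: "z \<in> radially_convergent h"
  have "\<exists>r0<1. \<forall>r\<in>{r0<..<1}. \<forall>r'\<in>{r0<..<1}. cmod (dilate h r z - dilate h r' z) \<le> e" if "0 < e" for e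
  proof -
    have "0 < e / 3" using that by simp
    from reals_Archimedean[OF this] obtain n where "inverse (real (Suc n)) < e / 3" by blast
    then have n: "1 / real (Suc n) < e / 3" by (simp only: inverse_eq_divide)
    obtain m where m: "\<And>p q. p \<in> \<rat> \<inter> {0<..<1} \<Longrightarrow> q \<in> \<rat> \<inter> {0<..<1} \<Longrightarrow> 1 - 1 / real (Suc m) < p \<Longrightarrow> 1 - 1 / real (Suc m) < q
       \<Longrightarrow> cmod (dilate h p z - dilate h q z) \<le> 1 / real (Suc n)"
      using G unfolding radially_convergent_def by blast
    define r0 where "r0 = max 0 (1 - 1 / real (Suc m))"
    show ?thesis
    proof (intro exI[of _ r0] conjI ballI)
      show "r0 < 1" by (auto simp: r0_def)
      fix r r' assume r: "r \<in> {r0<..<1}" "r' \<in> {r0<..<1}"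
      then have rr: "0 < r" "r < 1" "0 < r'" "r' < 1" "1 - 1 / real (Suc m) < r" "1 - 1 / real (Suc m) < r'"
        unfolding r0_def greaterThanLessThan_iff max_less_iff_conj by blast+
      obtain p where p: "p \<in> \<rat>" "r < p" "p < 1" "cmod (dilate h p z - dilate h r z) < e / 3"
        using dilate_rational_approx[OF h z rr(1,2) \<open>0 < e / 3\<close>] by blast
      obtain q where q: "q \<in> \<rat>" "r' < q" "q < 1" "cmod (dilate h q z - dilate h r' z) < e / 3"
        using dilate_rational_approx[OF h z rr(3,4) \<open>0 < e / 3\<close>] by blast
      have "cmod (dilate h p z - dilate h q z) \<le> 1 / real (Suc n)"
        by (rule m) (use p q rr in auto)
      then have "dist (dilate h p z) (dilate h q z) \<le> 1 / real (Suc n)" by (simp only: dist_norm)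
      moreover have "dist (dilate h p z) (dilate h r z) < e / 3" "dist (dilate h q z) (dilate h r' z) < e / 3"
        using p(4) q(4) by (simp_all only: dist_norm)
      ultimately have "dist (dilate h r z) (dilate h r' z) \<le> e"
        using n dist_triangle3[of "dilate h r z" "dilate h r' z" "dilate h p z"]
          dist_triangle[of "dilate h p z" "dilate h r' z" "dilate h q z"] by linarith
      then show "cmod (dilate h r z - dilate h r' z) \<le> e" by (simp only: dist_norm)
    qed
  qed
  from Cauchy_at_left_limit[OF this] show "\<exists>l. ((\<lambda>r. h (r *\<^sub>R z)) \<longlongrightarrow> l) (at_left 1)"
    unfolding dilate_def by blast
next
  assume "\<exists>l. ((\<lambda>r. h (r *\<^sub>R z)) \<longlongrightarrow> l) (at_left 1)"
  then obtain l where l: "((\<lambda>r. dilate h r z) \<longlongrightarrow> l) (at_left 1)" unfolding dilate_def by blast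
  show "z \<in> radially_convergent h"
    unfolding radially_convergent_def
  proof (intro CollectI allI)
    fix n :: nat
    have "\<forall>\<^sub>F r in at_left 1. dist (dilate h r z) l < 1 / (2 * real (Suc n))"
      by (rule tendstoD[OF l]) simp
    then obtain b where b: "b < 1" "\<And>r. b < r \<Longrightarrow> r < 1 \<Longrightarrow> dist (dilate h r z) l < 1 / (2 * real (Suc n))"
      unfolding eventually_at_left_field by auto
    have "0 < 1 - b" using b(1) by simp
    from reals_Archimedean[OF this] obtain m where "inverse (real (Suc m)) < 1 - b" by blast
    then have m: "1 / real (Suc m) < 1 - b" by (simp only: inverse_eq_divide)
    show "\<exists>m. \<forall>p\<in>\<rat> \<inter> {0<..<1}. \<forall>q\<in>\<rat> \<inter> {0<..<1}.
     1 - 1 / real (Suc m) < p \<longrightarrow> 1 - 1 / real (Suc m) < q \<longrightarrow> cmod (dilate h p z - dilate h q z) \<le> 1 / real (Suc n)"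
    proof (intro exI[of _ m] ballI impI)
      fix p q assume pq: "p \<in> \<rat> \<inter> {0<..<1}" "q \<in> \<rat> \<inter> {0<..<1}" "1 - 1 / real (Suc m) < p" "1 - 1 / real (Suc m) < q"
      have "dist (dilate h p z) l < 1 / (2 * real (Suc n))" by (rule b(2)) (use pq m in auto)
      moreover have "dist (dilate h q z) l < 1 / (2 * real (Suc n))" by (rule b(2)) (use pq m in auto)
      ultimately have "dist (dilate h p z) (dilate h q z) < 1 / (2 * real (Suc n)) + 1 / (2 * real (Suc n))"
        using dist_triangle2[of "dilate h p z" "dilate h q z" l] by linarith
      moreover have "1 / (2 * real (Suc n)) + 1 / (2 * real (Suc n)) = 1 / real (Suc n)" by (simp add: field_simps)
      ultimately show "cmod (dilate h p z - dilate h q z) \<le> 1 / real (Suc n)"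
        unfolding dist_norm by (metis less_imp_le)
    qed
  qed
qed

lemma radial_limit_tendsto:
  assumes "ball_analytic h" "norm z = 1" "z \<in> radially_convergent h"
  shows "((\<lambda>r. h (r *\<^sub>R z)) \<longlongrightarrow> radial_limit h z) (at_left 1)"
proof -
  obtain l where l: "((\<lambda>r. h (r *\<^sub>R z)) \<longlongrightarrow> l) (at_left 1)"
    using assms radially_convergent_iff by blast
  then have "radial_limit h z = l" unfolding radial_limit_def by (intro tendsto_Lim) auto
  with l show ?thesis by simp
qed

text \<open>The offset 2 makes the first radius 1/2, so that the whole sequence lies strictly
  between 0 and 1.\<close>

lemma radius_seq: "(\<lambda>n. 1 - 1 / real (n + 2)) \<longlonglongrightarrow> 1" "0 < 1 - 1 / real (n + 2)" "1 - 1 / real (n + 2) < 1"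
  by real_asymp (simp_all add: field_simps)

lemma radius_seq_at_left: "filterlim (\<lambda>n. 1 - 1 / real (n + 2)) (at_left 1) sequentially"
  unfolding filterlim_at using radius_seq by (auto intro!: always_eventually)

lemma borel_measurable_radial_limit:
  fixes h :: "complex^'n \<Rightarrow> complex"
  assumes h: "ball_analytic h"
  shows "radial_limit h \<in> borel_measurable sphere_measure"
proof -
  note [measurable] = borel_measurable_dilate[OF ball_analytic_measurable[OF h]] radially_convergent_measurable[OF h]
  \<comment> \<open>Without a limit, \<open>Lim\<close> is a \<open>THE\<close> over an
    unsatisfiable predicate, and \<open>c\<close> is that default value. Thus
    \<open>radial_limit\<close> is measurable as it stands, with no change on a null set.\<close>
  define c where "c = (THE l :: complex. False)"
  define f where "f z = (if z \<in> radially_convergent h then lim (\<lambda>n. dilate h (1 - 1 / real (n + 2)) z) else c)" for z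
  have "f \<in> borel_measurable borel"
    unfolding f_def [abs_def] by measurable
  then have "f \<in> borel_measurable sphere_measure" by (rule measurable_sphere_measure)
  moreover have "radial_limit h z = f z" if "z \<in> space (sphere_measure :: (complex^'n) measure)" for z
  proof (cases "z \<in> radially_convergent h")
    case True
    then have "((\<lambda>r. dilate h r z) \<longlongrightarrow> radial_limit h z) (at_left 1)"
      using radial_limit_tendsto[OF h] that unfolding dilate_def by simp
    from filterlim_compose[OF this radius_seq_at_left] show ?thesis
      using True by (simp add: f_def limI)
  next
    case False
    then have "\<not> ((\<lambda>r. h (r *\<^sub>R z)) \<longlongrightarrow> l) (at_left 1)" for l
      using radially_convergent_iff[OF h, of z] that by auto
    then show ?thesis using False by (simp add: f_def radial_limit_def t2_space_class.Lim_def c_def)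
  qed
  ultimately show ?thesis using measurable_cong[of sphere_measure "radial_limit h" f borel] by blast
qed

lemma hardy_space_iff: "h \<in> hardy_space \<longleftrightarrow> ball_analytic h \<and> hardy_norm_sq h < \<infinity>"
  by (auto simp: hardy_space_def ball_analytic_def)

lemma hardy_space_ball_analytic: "h \<in> hardy_space \<Longrightarrow> ball_analytic h"
  by (simp add: hardy_space_iff)

lemma hardy_norm_sq_le:
  assumes "ball_analytic h" "\<And>r. 0 < r \<Longrightarrow> r < 1 \<Longrightarrow> dilate_mean h r \<le> K"
  shows "hardy_norm_sq h \<le> ennreal K"
  unfolding hardy_norm_sq_eq[OF assms(1)] by (rule SUP_least) (use assms in \<open>auto intro: ennreal_leI\<close>)

lemma dilate_mean_le_hardy:
  assumes "h \<in> hardy_space" "0 \<le> r" "r < 1"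
  shows "dilate_mean h r \<le> enn2real (hardy_norm_sq h)"
proof -
  have h: "ball_analytic h" "hardy_norm_sq h < \<infinity>" using assms by (auto simp: hardy_space_iff)
  have "dilate_mean h r \<le> dilate_mean h (max r (1/2))" by (rule dilate_mean_mono[OF h(1)]) (use assms in auto)
  also have "\<dots> \<le> enn2real (hardy_norm_sq h)"
  proof -
    have "ennreal (dilate_mean h (max r (1/2))) \<le> ennreal (enn2real (hardy_norm_sq h))"
      using dilate_mean_le_norm[OF h(1), of "max r (1/2)"] h(2) assms(3) by simp
    then show ?thesis by simp
  qed
  finally show ?thesis .
qed

lemma clinear_scaleR: "Vector_Spaces.linear (*s) (*s) (\<lambda>z :: complex^'n. r *\<^sub>R z)"
  by (simp add: Vector_Spaces.linear_iff vec.vector_space_axioms cscale_scaleR scaleR_right_distrib)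

text \<open>Dilates are continuous up to the sphere and so have radial limits everywhere; this
  density statement is the second ingredient, besides the maximal inequality, of convergence almost
  everywhere.\<close>

lemma radial_approximation:
  fixes h :: "complex^'n \<Rightarrow> complex"
  assumes h: "h \<in> hardy_space" and e: "0 < e"
  obtains \<rho> where "0 < \<rho>" "\<rho> < 1" "ball_analytic (\<lambda>z. h z - composition_op (\<lambda>z. \<rho> *\<^sub>R z) h z)"
    "hardy_norm_sq (\<lambda>z. h z - composition_op (\<lambda>z. \<rho> *\<^sub>R z) h z) \<le> ennreal e"
proof -
  have h': "ball_analytic h" "hardy_norm_sq h < \<infinity>" using h by (auto simp: hardy_space_iff)
  obtain \<rho>0 where rho0: "0 < \<rho>0" "\<rho>0 < 1" "\<And>r s. \<rho>0 \<le> r \<Longrightarrow> r \<le> s \<Longrightarrow> s < 1 \<Longrightarrow>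
    (LINT z|sphere_measure. (cmod (dilate h r z - dilate h s z))\<^sup>2) \<le> e"
    using dilate_Cauchy[OF h' e] by blast
  \<comment> \<open>The radii compared below are \<open>\<rho> * s\<close> and \<open>s\<close> with
    \<open>s \<ge> \<rho>\<close>; the square root ensures
    \<open>\<rho> * s \<ge> \<rho>0\<close>.\<close>
  define \<rho> where "\<rho> = sqrt \<rho>0"
  have rho: "0 < \<rho>" "\<rho> < 1" "\<rho> * \<rho> = \<rho>0" using rho0 by (auto simp: \<rho>_def)
  define k where "k = (\<lambda>z. h z - composition_op (\<lambda>z. \<rho> *\<^sub>R z) h z)"
  have k: "ball_analytic k"
    unfolding k_def
    by (intro ball_analytic_diff ball_analytic_composition h' clinear_scaleR) (use rho in \<open>auto intro: mult_left_le_one_le\<close>)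
  have "hardy_norm_sq k \<le> ennreal e"
  proof (rule hardy_norm_sq_le[OF k])
    fix r :: real assume r: "0 < r" "r < 1"
    \<comment> \<open>Since the means of \<open>k\<close> increase, small radii may be replaced by
      \<open>\<rho>\<close>.\<close>
    define s where "s = max r \<rho>"
    have s: "r \<le> s" "\<rho> \<le> s" "s < 1" "0 < s" using r rho by (auto simp: s_def)
    have "dilate_mean k r \<le> dilate_mean k s" by (rule dilate_mean_mono[OF k]) (use r s in auto)
    also have "\<dots> = (LINT z|sphere_measure. (cmod (dilate h (\<rho> * s) z - dilate h s z))\<^sup>2)"
      unfolding dilate_mean_def
      by (rule Bochner_Integration.integral_cong[OF refl]) (use s in \<open>simp add: dilate_def k_def composition_op_def norm_minus_commute\<close>)
    also have "\<dots> \<le> e"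
      by (rule rho0(3)) (use s rho mult_left_mono[of \<rho> s \<rho>] mult_right_mono[of \<rho> 1 s] in auto)
    finally show "dilate_mean k r \<le> e" .
  qed
  then show ?thesis using that[of \<rho>] rho k unfolding k_def by auto
qed

lemma AE_sphere_norm: "AE z in sphere_measure. norm z = 1"
  by (rule AE_I2) simp

text \<open>The maximal functions of the differences between \<open>h\<close> and its dilates have
  arbitrarily small integrals, so their infimum \<open>g\<close> vanishes almost everywhere. Where
  \<open>g z = 0\<close>, the function \<open>h\<close> is uniformly close along the radius to a
  dilate, which is continuous there up to radius 1.\<close>

lemma AE_radially_convergent:
  fixes h :: "complex^'n \<Rightarrow> complex"
  assumes h: "h \<in> hardy_space"
  shows "AE z in sphere_measure. z \<in> radially_convergent h"
proof -
  have h': "ball_analytic h" using h by (rule hardy_space_ball_analytic)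
  define k where "k \<rho> = (\<lambda>z. h z - composition_op (\<lambda>z. \<rho> *\<^sub>R z) h z)" for \<rho>
  have "\<forall>n::nat. \<exists>\<rho>. 0 < \<rho> \<and> \<rho> < 1 \<and> ball_analytic (k \<rho>) \<and> hardy_norm_sq (k \<rho>) \<le> ennreal (1 / real (Suc n))"
  proof
    fix n :: nat
    have "0 < 1 / real (Suc n)" by simp
    from radial_approximation[OF h this]
    show "\<exists>\<rho>. 0 < \<rho> \<and> \<rho> < 1 \<and> ball_analytic (k \<rho>) \<and> hardy_norm_sq (k \<rho>) \<le> ennreal (1 / real (Suc n))"
      unfolding k_def by blast
  qed
  then obtain \<rho> where rho: "\<And>n. 0 < \<rho> n" "\<And>n. \<rho> n < 1" "\<And>n. ball_analytic (k (\<rho> n))"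
    "\<And>n. hardy_norm_sq (k (\<rho> n)) \<le> ennreal (1 / real (Suc n))"
    by metis
  define g where "g z = (INF n. radial_max_sq (k (\<rho> n)) z)" for z
  note [measurable] = borel_measurable_radial_max_sq[OF rho(3)]
  have "g \<in> borel_measurable borel" unfolding g_def [abs_def] by measurable
  then have [measurable]: "g \<in> borel_measurable sphere_measure" by (rule measurable_sphere_measure)
  have le: "(\<integral>\<^sup>+z. g z \<partial>sphere_measure) \<le> ennreal e" if e: "0 < e" for e
  proof -
    have "0 < e / 256" using e by simp
    from reals_Archimedean[OF this] obtain n where n: "inverse (real (Suc n)) < e / 256" by blast
    have "(\<integral>\<^sup>+z. g z \<partial>sphere_measure) \<le> (\<integral>\<^sup>+z. radial_max_sq (k (\<rho> n)) z \<partial>sphere_measure)"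
      unfolding g_def by (intro nn_integral_mono INF_lower) simp
    also have "\<dots> \<le> 256 * hardy_norm_sq (k (\<rho> n))" by (rule nn_integral_radial_max_sq[OF rho(3)])
    also have "\<dots> \<le> 256 * ennreal (1 / real (Suc n))" by (intro mult_left_mono rho(4)) simp
    also have "\<dots> = ennreal (256 * (1 / real (Suc n)))" by (subst ennreal_mult) auto
    also have "\<dots> \<le> ennreal e" using n by (intro ennreal_leI) (simp add: inverse_eq_divide field_simps)
    finally show ?thesis .
  qed
  have "(\<integral>\<^sup>+z. g z \<partial>sphere_measure) \<le> 0"
    by (rule ennreal_le_epsilon) (simp only: add_0_left le)
  then have "(\<integral>\<^sup>+z. g z \<partial>sphere_measure) = 0" by simp
  then have "AE z in sphere_measure. g z = 0" by (subst (asm) nn_integral_0_iff_AE) auto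
  then show ?thesis
  proof (rule AE_mp, intro AE_I2 impI)
    fix z :: "complex^'n" assume "z \<in> space sphere_measure" and g0: "g z = 0"
    then have z: "norm z = 1" by simp
    have "\<exists>r0<1. \<forall>r\<in>{r0<..<1}. \<forall>r'\<in>{r0<..<1}. cmod (dilate h r z - dilate h r' z) \<le> e" if e: "0 < e" for e
    proof -
      have "g z < ennreal ((e / 4)\<^sup>2)" using e by (simp add: g0)
      then obtain n where n: "radial_max_sq (k (\<rho> n)) z < ennreal ((e / 4)\<^sup>2)"
        unfolding g_def by (auto simp: INF_less_iff)
      let ?\<rho> = "\<rho> n"
      have k: "cmod (dilate h r z - dilate h (?\<rho> * r) z) \<le> e / 4" if r: "0 < r" "r < 1" for r
      proof -
        have "ennreal ((cmod (dilate (k ?\<rho>) r z))\<^sup>2) \<le> ennreal ((e / 4)\<^sup>2)"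
          using dilate_le_radial_max[OF rho(3) z r] n by (meson less_imp_le order_trans)
        then have "cmod (dilate (k ?\<rho>) r z) \<le> e / 4" using e by (auto intro: power2_le_imp_le)
        then show ?thesis using r z by (simp add: dilate_def k_def composition_op_def)
      qed
      \<comment> \<open>The dilate is continuous at radius 1. Of the four shares
        \<open>e / 4\<close>, two are spent on this continuity and two on replacing \<open>h\<close>
        by its dilate.\<close>
      have "continuous_on {0..1} (\<lambda>r. dilate h (?\<rho> * r) z)"
        unfolding dilate_def
      proof (rule continuous_on_compose2[OF ball_analytic_continuous[OF h']])
        show "(\<lambda>r. (?\<rho> * r) *\<^sub>R z) ` {0..1} \<subseteq> ball 0 1"
        proof
          fix y assume "y \<in> (\<lambda>r. (?\<rho> * r) *\<^sub>R z) ` {0..1}"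
          then obtain r where r: "0 \<le> r" "r \<le> 1" "y = (?\<rho> * r) *\<^sub>R z" by auto
          have "?\<rho> * r \<le> ?\<rho>" using rho(1)[of n] r by (intro mult_left_le) auto
          then have "?\<rho> * r < 1" using rho(2)[of n] by linarith
          then show "y \<in> ball 0 1" using r rho(1)[of n] z by (simp add: abs_mult)
        qed
      qed (intro continuous_intros)
      then obtain d where d: "0 < d" "\<And>r. r \<in> {0..1} \<Longrightarrow> dist r 1 < d \<Longrightarrow> dist (dilate h (?\<rho> * r) z) (dilate h (?\<rho> * 1) z) < e / 4"
        unfolding continuous_on_iff using e by (elim ballE[of _ _ 1] allE[of _ "e / 4"]) auto
      define r0 where "r0 = max 0 (1 - d)"
      show ?thesis
      proof (intro exI[of _ r0] conjI ballI)
        show "r0 < 1" using d by (auto simp: r0_def)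
        fix r r' assume "r \<in> {r0<..<1}" "r' \<in> {r0<..<1}"
        then have r: "0 < r" "r < 1" "0 < r'" "r' < 1" "dist r 1 < d" "dist r' 1 < d" by (auto simp: r0_def dist_real_def)
        have "dist (dilate h r z) (dilate h (?\<rho> * r) z) \<le> e / 4" "dist (dilate h r' z) (dilate h (?\<rho> * r') z) \<le> e / 4"
          using k r by (simp_all add: dist_norm)
        moreover have "dist (dilate h (?\<rho> * r) z) (dilate h (?\<rho> * 1) z) < e / 4" "dist (dilate h (?\<rho> * r') z) (dilate h (?\<rho> * 1) z) < e / 4"
          using d(2) r by auto
        ultimately have "dist (dilate h r z) (dilate h r' z) \<le> e"
          using dist_triangle[of "dilate h r z" "dilate h r' z" "dilate h (?\<rho> * r) z"]
            dist_triangle2[of "dilate h (?\<rho> * r) z" "dilate h r' z" "dilate h (?\<rho> * r') z"]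
            dist_triangle2[of "dilate h (?\<rho> * r) z" "dilate h (?\<rho> * r') z" "dilate h (?\<rho> * 1) z"] by linarith
        then show "cmod (dilate h r z - dilate h r' z) \<le> e" by (simp add: dist_norm)
      qed
    qed
    from Cauchy_at_left_limit[OF this] have "\<exists>l. ((\<lambda>r. h (r *\<^sub>R z)) \<longlongrightarrow> l) (at_left 1)"
      unfolding dilate_def by blast
    then show "z \<in> radially_convergent h" using radially_convergent_iff[OF h' z] by simp
  qed
qed

lemma AE_radial_limit:
  assumes h: "h \<in> hardy_space"
  shows "AE z in sphere_measure. ((\<lambda>r. h (r *\<^sub>R z)) \<longlongrightarrow> radial_limit h z) (at_left 1)"
  using AE_radially_convergent[OF h]
  by (rule AE_mp, intro AE_I2 impI) (use radial_limit_tendsto[OF hardy_space_ball_analytic[OF h]] in simp)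

lemma radial_limit_eq: "((\<lambda>r. h (r *\<^sub>R z)) \<longlongrightarrow> l) (at_left 1) \<Longrightarrow> radial_limit h z = l"
  unfolding radial_limit_def by (intro tendsto_Lim) auto

text \<open>Dominated convergence along \<open>radius_seq\<close> with the radial maximal function
  as majorant; by monotonicity the means tend to their supremum. Boundary values thus embed the
  Hardy space isometrically.\<close>

lemma nn_integral_radial_limit:
  fixes h :: "complex^'n \<Rightarrow> complex"
  assumes h: "h \<in> hardy_space"
  shows "(\<integral>\<^sup>+z. ennreal ((cmod (radial_limit h z))\<^sup>2) \<partial>sphere_measure) = hardy_norm_sq h"
proof -
  have h': "ball_analytic h" "hardy_norm_sq h < \<infinity>" using h by (auto simp: hardy_space_iff)
  let ?x = "\<lambda>n. 1 - 1 / real (n + 2)"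
  let ?u = "\<lambda>n z. ennreal ((cmod (dilate h (?x n) z))\<^sup>2)"
  note [measurable] = borel_measurable_radial_limit[OF h'(1)] dilate_measurable_sphere[OF h'(1)]
    measurable_sphere_measure[OF borel_measurable_radial_max_sq[OF h'(1)]]
  have "(\<lambda>n. \<integral>\<^sup>+z. ?u n z \<partial>sphere_measure) \<longlonglongrightarrow> (\<integral>\<^sup>+z. ennreal ((cmod (radial_limit h z))\<^sup>2) \<partial>(sphere_measure :: (complex^'n) measure))"
  proof (rule nn_integral_dominated_convergence[where w = "radial_max_sq h"])
    show "AE z in sphere_measure. ?u n z \<le> radial_max_sq h z" for n
      by (rule AE_I2) (use dilate_le_radial_max[OF h'(1) _ radius_seq(2,3)] in simp)
    show "(\<integral>\<^sup>+z. radial_max_sq h z \<partial>sphere_measure) < \<infinity>"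
      using nn_integral_radial_max_sq[OF h'(1)] h'(2)
      by (auto simp: ennreal_mult_less_top less_top intro: le_less_trans)
    show "AE z in sphere_measure. (\<lambda>n. ?u n z) \<longlonglongrightarrow> ennreal ((cmod (radial_limit h z))\<^sup>2)"
      using AE_radial_limit[OF h]
    proof (rule AE_mp, intro AE_I2 impI)
      fix z :: "complex^'n" assume "((\<lambda>r. h (r *\<^sub>R z)) \<longlongrightarrow> radial_limit h z) (at_left 1)"
      from filterlim_compose[OF this radius_seq_at_left]
      show "(\<lambda>n. ?u n z) \<longlonglongrightarrow> ennreal ((cmod (radial_limit h z))\<^sup>2)"
        unfolding dilate_def by (intro tendsto_ennrealI tendsto_power tendsto_norm)
    qed
  qed measurable
  moreover have "(\<lambda>n. \<integral>\<^sup>+z. ?u n z \<partial>(sphere_measure :: (complex^'n) measure)) \<longlonglongrightarrow> hardy_norm_sq h"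
  proof -
    have e: "(\<integral>\<^sup>+z. ?u n z \<partial>sphere_measure) = ennreal (dilate_mean h (?x n))" for n
      by (rule nn_integral_dilate[OF h'(1)]) (use radius_seq(2,3)[of n] in auto)
    have mono: "incseq (\<lambda>n. ennreal (dilate_mean h (?x n)))"
      unfolding incseq_def
    proof (intro allI impI ennreal_leI dilate_mean_mono[OF h'(1)])
      fix m n :: nat assume "m \<le> n"
      then show "?x m \<le> ?x n" by (simp add: frac_le)
    qed (use radius_seq(2,3) in \<open>auto intro: less_imp_le\<close>)
    have "(SUP n. ennreal (dilate_mean h (?x n))) = hardy_norm_sq h"
    proof (rule antisym)
      show "(SUP n. ennreal (dilate_mean h (?x n))) \<le> hardy_norm_sq h"
        by (rule SUP_least, rule dilate_mean_le_norm[OF h'(1) radius_seq(2,3)])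
      show "hardy_norm_sq h \<le> (SUP n. ennreal (dilate_mean h (?x n)))"
        unfolding hardy_norm_sq_eq[OF h'(1)]
      proof (rule SUP_least)
        fix r :: real assume r: "r \<in> {0<..<1}"
        then have "\<forall>\<^sub>F n in sequentially. r < ?x n" by (intro order_tendstoD(1)[OF radius_seq(1)]) auto
        then obtain n where "r < ?x n" using eventually_happens'[OF sequentially_bot] by blast
        then have "ennreal (dilate_mean h r) \<le> ennreal (dilate_mean h (?x n))"
          using r radius_seq(3)[of n] by (intro ennreal_leI dilate_mean_mono[OF h'(1)]) auto
        also have "\<dots> \<le> (SUP n. ennreal (dilate_mean h (?x n)))" by (rule SUP_upper) simp
        finally show "ennreal (dilate_mean h r) \<le> (SUP n. ennreal (dilate_mean h (?x n)))" .
      qed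
    qed
    with LIMSEQ_SUP[OF mono] show ?thesis unfolding e by simp
  qed
  ultimately show ?thesis by (rule LIMSEQ_unique)
qed

subsection \<open>The Hardy space inside \<open>L\<^sup>2\<close>\<close>

text \<open>Functions are used rather than classes modulo null sets; identities between boundary
  functions appear as \<open>AE\<close> statements.\<close>

definition sq_integrable :: "(complex^'n \<Rightarrow> complex) \<Rightarrow> bool" where
  "sq_integrable f \<longleftrightarrow> f \<in> borel_measurable sphere_measure \<and> integrable sphere_measure (\<lambda>z. (cmod (f z))\<^sup>2)"

definition l2_norm_sq :: "(complex^'n \<Rightarrow> complex) \<Rightarrow> real" where
  "l2_norm_sq f = (LINT z|sphere_measure. (cmod (f z))\<^sup>2)"

lemma l2_norm_sq_nonneg: "0 \<le> l2_norm_sq f"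
  unfolding l2_norm_sq_def by (rule integral_nonneg_AE) auto

lemma nn_integral_l2_norm_sq:
  "sq_integrable f \<Longrightarrow> (\<integral>\<^sup>+z. ennreal ((cmod (f z))\<^sup>2) \<partial>sphere_measure) = ennreal (l2_norm_sq f)"
  unfolding l2_norm_sq_def by (rule nn_integral_eq_integral) (auto simp: sq_integrable_def)

lemma sq_integrable_product:
  assumes "sq_integrable f" "sq_integrable g"
  shows "integrable sphere_measure (\<lambda>z. f z * cnj (g z))"
proof (rule Bochner_Integration.integrable_bound)
  show "integrable sphere_measure (\<lambda>z. (cmod (f z))\<^sup>2 + (cmod (g z))\<^sup>2)"
    using assms by (auto simp: sq_integrable_def)
  have "f \<in> borel_measurable sphere_measure" "g \<in> borel_measurable sphere_measure"
    using assms by (auto simp: sq_integrable_def)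
  then show "(\<lambda>z. f z * cnj (g z)) \<in> borel_measurable sphere_measure" by measurable
  show "AE z in sphere_measure. norm (f z * cnj (g z)) \<le> norm ((cmod (f z))\<^sup>2 + (cmod (g z))\<^sup>2)"
  proof (rule AE_I2)
    fix z
    have "0 \<le> (cmod (f z) - cmod (g z))\<^sup>2" "0 \<le> (cmod (f z))\<^sup>2" "0 \<le> (cmod (g z))\<^sup>2" by auto
    then have "cmod (f z) * cmod (g z) \<le> (cmod (f z))\<^sup>2 + (cmod (g z))\<^sup>2"
      unfolding power2_diff by linarith
    then show "norm (f z * cnj (g z)) \<le> norm ((cmod (f z))\<^sup>2 + (cmod (g z))\<^sup>2)" by (simp add: norm_mult)
  qed
qed

lemma sq_integrable_add:
  assumes "sq_integrable f" "sq_integrable g"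
  shows "sq_integrable (\<lambda>z. f z + g z)"
proof -
  have [measurable]: "f \<in> borel_measurable sphere_measure" "g \<in> borel_measurable sphere_measure"
    using assms by (auto simp: sq_integrable_def)
  have "(cmod (f z + g z))\<^sup>2 = (cmod (f z))\<^sup>2 + (cmod (g z))\<^sup>2 + 2 * Re (f z * cnj (g z))" for z
    unfolding cmod_power2 by (simp add: power2_eq_square algebra_simps)
  moreover have "integrable sphere_measure (\<lambda>z. (cmod (f z))\<^sup>2 + (cmod (g z))\<^sup>2 + 2 * Re (f z * cnj (g z)))"
    using assms sq_integrable_product[OF assms] by (auto simp: sq_integrable_def simp del: times_complex.sel)
  ultimately have "integrable sphere_measure (\<lambda>z. (cmod (f z + g z))\<^sup>2)" by presburger
  then show ?thesis unfolding sq_integrable_def by (auto intro: borel_measurable_add)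
qed

lemma sq_integrable_mult:
  fixes f p :: "complex^'n \<Rightarrow> complex"
  assumes "sq_integrable f" and [measurable]: "p \<in> borel_measurable sphere_measure" and K: "\<And>z. norm z = 1 \<Longrightarrow> cmod (p z) \<le> K"
  shows "sq_integrable (\<lambda>z. p z * f z)"
  unfolding sq_integrable_def
proof
  have [measurable]: "f \<in> borel_measurable sphere_measure"
    using assms by (auto simp: sq_integrable_def)
  show "(\<lambda>z. p z * f z) \<in> borel_measurable sphere_measure" by measurable
  show "integrable sphere_measure (\<lambda>z. (cmod (p z * f z))\<^sup>2)"
  proof (rule Bochner_Integration.integrable_bound)
    show "integrable sphere_measure (\<lambda>z. K\<^sup>2 * (cmod (f z))\<^sup>2)"
      using assms by (auto simp: sq_integrable_def)
    show "AE z in sphere_measure. norm ((cmod (p z * f z))\<^sup>2) \<le> norm (K\<^sup>2 * (cmod (f z))\<^sup>2)"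
    proof (rule AE_I2)
      fix z :: "complex^'n" assume "z \<in> space sphere_measure"
      then have "(cmod (p z))\<^sup>2 \<le> K\<^sup>2" using K[of z] by (intro power_mono) auto
      then show "norm ((cmod (p z * f z))\<^sup>2) \<le> norm (K\<^sup>2 * (cmod (f z))\<^sup>2)"
        by (simp add: norm_mult power_mult_distrib mult_right_mono)
    qed
  qed measurable
qed

lemma sq_integrable_cmult: "sq_integrable f \<Longrightarrow> sq_integrable (\<lambda>z. c * f z)"
  by (rule sq_integrable_mult[where K="cmod c"]) auto

lemma sq_integrable_diff: "sq_integrable f \<Longrightarrow> sq_integrable g \<Longrightarrow> sq_integrable (\<lambda>z. f z - g z)"
  using sq_integrable_add[of f "\<lambda>z. -1 * g z"] sq_integrable_cmult[of g "-1"] by simp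

lemma sq_integrable_sum: "(\<And>i. i \<in> I \<Longrightarrow> sq_integrable (f i)) \<Longrightarrow> sq_integrable (\<lambda>z. \<Sum>i\<in>I. f i z)"
  by (induction I rule: infinite_finite_induct) (auto simp: sq_integrable_add, auto simp: sq_integrable_def)

lemma l2_inner_diff_left:
  assumes "sq_integrable f" "sq_integrable g" "sq_integrable k"
  shows "l2_inner (\<lambda>z. f z - g z) k = l2_inner f k - l2_inner g k"
  using sq_integrable_product[OF assms(1,3)] sq_integrable_product[OF assms(2,3)]
  by (simp add: l2_inner_def left_diff_distrib)

lemma l2_inner_self: "sq_integrable f \<Longrightarrow> l2_inner f f = complex_of_real (l2_norm_sq f)"
  unfolding l2_inner_def l2_norm_sq_def
  by (subst integral_complex_of_real[symmetric]) (simp add: complex_norm_square del: of_real_power)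

lemma l2_Cauchy_Schwarz:
  assumes f: "sq_integrable f" and g: "sq_integrable g"
  shows "(cmod (l2_inner f g))\<^sup>2 \<le> l2_norm_sq f * l2_norm_sq g"
proof -
  have [measurable]: "f \<in> borel_measurable sphere_measure" "g \<in> borel_measurable sphere_measure"
    using assms by (auto simp: sq_integrable_def)
  have "ennreal (cmod (l2_inner f g)) \<le> (\<integral>\<^sup>+z. ennreal (cmod (f z * cnj (g z))) \<partial>sphere_measure)"
    unfolding l2_inner_def by (rule integral_norm_bound_ennreal[OF sq_integrable_product[OF f g]])
  also have "\<dots> = (\<integral>\<^sup>+z. ennreal (cmod (f z)) * ennreal (cmod (g z)) \<partial>sphere_measure)"
    by (simp add: norm_mult ennreal_mult)
  finally have "(ennreal (cmod (l2_inner f g)))\<^sup>2 \<le> (\<integral>\<^sup>+z. ennreal (cmod (f z)) * ennreal (cmod (g z)) \<partial>sphere_measure)\<^sup>2"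
    by (rule power_mono) simp
  also have "\<dots> \<le> (\<integral>\<^sup>+z. (ennreal (cmod (f z)))\<^sup>2 \<partial>sphere_measure) * (\<integral>\<^sup>+z. (ennreal (cmod (g z)))\<^sup>2 \<partial>sphere_measure)"
    by (rule Cauchy_Schwarz_nn_integral) measurable
  also have "\<dots> = ennreal (l2_norm_sq f * l2_norm_sq g)"
    using f g by (simp add: ennreal_power nn_integral_l2_norm_sq ennreal_mult l2_norm_sq_nonneg)
  finally show ?thesis by (simp add: ennreal_power l2_norm_sq_nonneg)
qed

lemma l2_norm_sq_diff_cmult:
  assumes u: "sq_integrable u" and v: "sq_integrable v"
  shows "l2_norm_sq (\<lambda>z. u z - t * v z) = l2_norm_sq u - 2 * Re (cnj t * l2_inner u v) + (cmod t)\<^sup>2 * l2_norm_sq v"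
proof -
  have e: "(cmod (x - t * y))\<^sup>2 = (cmod x)\<^sup>2 - 2 * Re (cnj t * (x * cnj y)) + (cmod t)\<^sup>2 * (cmod y)\<^sup>2" for x y
    unfolding cmod_power2 by (simp add: power2_eq_square algebra_simps)
  have i: "integrable sphere_measure (\<lambda>z. cnj t * (u z * cnj (v z)))"
    using sq_integrable_product[OF u v] by (rule integrable_mult_right)
  then have i': "integrable sphere_measure (\<lambda>z. Re (cnj t * (u z * cnj (v z))))"
     "(LINT z|sphere_measure. Re (cnj t * (u z * cnj (v z)))) = Re (cnj t * l2_inner u v)"
    unfolding l2_inner_def by (simp_all del: times_complex.sel)
  show ?thesis
    unfolding l2_norm_sq_def e using u v i' by (simp add: sq_integrable_def del: times_complex.sel)
qed

lemma l2_inner_cong_AE: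
  assumes "AE z in sphere_measure. f z = f' z" "AE z in sphere_measure. g z = g' z"
    and [measurable]: "f \<in> borel_measurable sphere_measure" "f' \<in> borel_measurable sphere_measure"
      "g \<in> borel_measurable sphere_measure" "g' \<in> borel_measurable sphere_measure"
  shows "l2_inner f g = l2_inner f' g'"
  unfolding l2_inner_def by (rule integral_cong_AE) (use assms(1,2) in \<open>auto elim: AE_mp\<close>)

lemma l2_norm_sq_cong_AE:
  assumes "AE z in sphere_measure. f z = f' z"
    and [measurable]: "f \<in> borel_measurable sphere_measure" "f' \<in> borel_measurable sphere_measure"
  shows "l2_norm_sq f = l2_norm_sq f'"
  unfolding l2_norm_sq_def by (rule integral_cong_AE) (use assms(1) in \<open>auto elim: AE_mp\<close>)

lemma sq_integrable_radial_limit: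
  assumes "h \<in> hardy_space"
  shows "sq_integrable (radial_limit h)"
  unfolding sq_integrable_def
proof
  show [measurable]: "radial_limit h \<in> borel_measurable sphere_measure"
    by (rule borel_measurable_radial_limit[OF hardy_space_ball_analytic[OF assms]])
  show "integrable sphere_measure (\<lambda>z. (cmod (radial_limit h z))\<^sup>2)"
    by (rule integrableI_nonneg) (use nn_integral_radial_limit[OF assms] assms in \<open>auto simp: hardy_space_iff\<close>)
qed

lemma measurable_radial_limit: "h \<in> hardy_space \<Longrightarrow> radial_limit h \<in> borel_measurable sphere_measure"
  using sq_integrable_radial_limit sq_integrable_def by blast

lemma hardy_norm_sq_radial: "h \<in> hardy_space \<Longrightarrow> hardy_norm_sq h = ennreal (l2_norm_sq (radial_limit h))"
  using nn_integral_l2_norm_sq[OF sq_integrable_radial_limit] nn_integral_radial_limit by metis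

lemma hardy_norm_power2: "h \<in> hardy_space \<Longrightarrow> (hardy_norm h)\<^sup>2 = l2_norm_sq (radial_limit h)"
  by (simp add: hardy_norm_def hardy_norm_sq_radial l2_norm_sq_nonneg)

lemma hardy_norm_nonneg: "0 \<le> hardy_norm h"
  by (simp add: hardy_norm_def)

lemma hardy_norm_sq_power2: "h \<in> hardy_space \<Longrightarrow> hardy_norm_sq h = ennreal ((hardy_norm h)\<^sup>2)"
  by (simp add: hardy_norm_power2 hardy_norm_sq_radial)

lemma dilate_mean_le_hardy_norm:
  "h \<in> hardy_space \<Longrightarrow> 0 \<le> r \<Longrightarrow> r < 1 \<Longrightarrow> dilate_mean h r \<le> (hardy_norm h)\<^sup>2"
  using dilate_mean_le_hardy[of h r] by (simp add: hardy_norm_sq_power2)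

lemma hardy_spaceI:
  assumes "ball_analytic h" "\<And>r. 0 < r \<Longrightarrow> r < 1 \<Longrightarrow> dilate_mean h r \<le> K"
  shows "h \<in> hardy_space"
  using hardy_norm_sq_le[OF assms] assms(1) by (auto simp: hardy_space_iff intro: le_less_trans)

lemma hardy_norm_leI:
  assumes "ball_analytic h" "\<And>r. 0 < r \<Longrightarrow> r < 1 \<Longrightarrow> dilate_mean h r \<le> K\<^sup>2" "0 \<le> K"
  shows "hardy_norm h \<le> K"
proof -
  have "h \<in> hardy_space" by (rule hardy_spaceI[OF assms(1,2)])
  then have "ennreal ((hardy_norm h)\<^sup>2) \<le> ennreal (K\<^sup>2)"
    using hardy_norm_sq_le[OF assms(1,2)] by (simp add: hardy_norm_sq_power2)
  then show ?thesis using assms(3) by (auto intro: power2_le_imp_le)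
qed

text \<open>A factor continuous on the closed ball is bounded there and is its own boundary
  function. Constants, coordinates, the components of \<open>A\<close> and powers of
  \<open>cinner z w\<close> all enter through this lemma.\<close>

lemma hardy_space_mult:
  fixes h p :: "complex^'n \<Rightarrow> complex"
  assumes h: "h \<in> hardy_space" and p: "analytic_on_ball p" "continuous_on (cball 0 1) p"
  shows "(\<lambda>z. p z * h z) \<in> hardy_space"
    and "AE z in sphere_measure. radial_limit (\<lambda>z. p z * h z) z = p z * radial_limit h z"
proof -
  have "bounded (p ` cball 0 1)"
    by (intro compact_imp_bounded compact_continuous_image p) auto
  then obtain K where K: "\<And>z. z \<in> cball 0 1 \<Longrightarrow> cmod (p z) \<le> K" unfolding bounded_iff by blast
  have h': "ball_analytic h" using h by (rule hardy_space_ball_analytic)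
  have ph: "ball_analytic (\<lambda>z. p z * h z)" by (rule ball_analytic_mult[OF p(1) h'])
  show "(\<lambda>z. p z * h z) \<in> hardy_space"
  proof (rule hardy_spaceI[OF ph])
    fix r :: real assume r: "0 < r" "r < 1"
    have "dilate_mean (\<lambda>z. p z * h z) r \<le> (LINT z|sphere_measure. K\<^sup>2 * (cmod (dilate h r z))\<^sup>2)"
      unfolding dilate_mean_def
    proof (rule integral_mono)
      show "integrable sphere_measure (\<lambda>z. (cmod (dilate (\<lambda>z. p z * h z) r z))\<^sup>2)"
        by (rule dilate_integrable(2)[OF ph, of r r]) (use r in auto)
      show "integrable sphere_measure (\<lambda>z. K\<^sup>2 * (cmod (dilate h r z))\<^sup>2)"
        by (rule integrable_mult_right, rule dilate_integrable(2)[OF h', of r r]) (use r in auto)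
      fix z :: "complex^'n" assume "z \<in> space sphere_measure"
      then have "(cmod (p (r *\<^sub>R z)))\<^sup>2 \<le> K\<^sup>2" using r by (intro power_mono K) auto
      then show "(cmod (dilate (\<lambda>z. p z * h z) r z))\<^sup>2 \<le> K\<^sup>2 * (cmod (dilate h r z))\<^sup>2"
        by (simp add: dilate_def norm_mult power_mult_distrib mult_right_mono)
    qed
    also have "\<dots> = K\<^sup>2 * dilate_mean h r" by (simp add: dilate_mean_def)
    also have "\<dots> \<le> K\<^sup>2 * (hardy_norm h)\<^sup>2"
      using dilate_mean_le_hardy_norm[OF h, of r] r by (intro mult_left_mono) auto
    finally show "dilate_mean (\<lambda>z. p z * h z) r \<le> K\<^sup>2 * (hardy_norm h)\<^sup>2" .
  qed
  show "AE z in sphere_measure. radial_limit (\<lambda>z. p z * h z) z = p z * radial_limit h z"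
    using AE_radial_limit[OF h]
  proof (rule AE_mp, intro AE_I2 impI)
    fix z :: "complex^'n" assume "z \<in> space sphere_measure" and l: "((\<lambda>r. h (r *\<^sub>R z)) \<longlongrightarrow> radial_limit h z) (at_left 1)"
    then have z: "norm z = 1" by simp
    have "continuous_on {0..1} (\<lambda>r. p (r *\<^sub>R z))"
      by (rule continuous_on_compose2[OF p(2)]) (use z in \<open>auto intro!: continuous_intros\<close>)
    then have "((\<lambda>r. p (r *\<^sub>R z)) \<longlongrightarrow> p (1 *\<^sub>R z)) (at 1 within {0..1})"
      unfolding continuous_on by (elim ballE[of _ _ "1::real"]) simp_all
    then have "((\<lambda>r. p (r *\<^sub>R z)) \<longlongrightarrow> p z) (at_left 1)"
      by (simp add: at_within_Icc_at_left)
    from tendsto_mult[OF this l] show "radial_limit (\<lambda>z. p z * h z) z = p z * radial_limit h z"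
      by (rule radial_limit_eq)
  qed
qed

lemma hardy_space_cmult:
  assumes "h \<in> hardy_space"
  shows "(\<lambda>z. c * h z) \<in> hardy_space" "AE z in sphere_measure. radial_limit (\<lambda>z. c * h z) z = c * radial_limit h z"
  using hardy_space_mult[OF assms analytic_on_ball_const, of c] by auto

lemma hardy_space_add:
  fixes f g :: "complex^'n \<Rightarrow> complex"
  assumes f: "f \<in> hardy_space" and g: "g \<in> hardy_space"
  shows "(\<lambda>z. f z + g z) \<in> hardy_space"
    "AE z in sphere_measure. radial_limit (\<lambda>z. f z + g z) z = radial_limit f z + radial_limit g z"
proof -
  have f': "ball_analytic f" and g': "ball_analytic g" using f g hardy_space_ball_analytic by auto
  have fg: "ball_analytic (\<lambda>z. f z + g z)" by (rule ball_analytic_add[OF f' g'])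
  show "(\<lambda>z. f z + g z) \<in> hardy_space"
  proof (rule hardy_spaceI[OF fg])
    fix r :: real assume r: "0 < r" "r < 1"
    have I: "integrable sphere_measure (\<lambda>z. (cmod (dilate f r z))\<^sup>2)" "integrable sphere_measure (\<lambda>z. (cmod (dilate g r z))\<^sup>2)"
      "integrable sphere_measure (\<lambda>z. (cmod (dilate (\<lambda>z. f z + g z) r z))\<^sup>2)"
      using dilate_integrable(2)[OF f', of r r] dilate_integrable(2)[OF g', of r r] dilate_integrable(2)[OF fg, of r r] r by auto
    have "dilate_mean (\<lambda>z. f z + g z) r \<le> (LINT z|sphere_measure. 2 * (cmod (dilate f r z))\<^sup>2 + 2 * (cmod (dilate g r z))\<^sup>2)"
      unfolding dilate_mean_def
    proof (rule integral_mono)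
      fix z
      have "(cmod (dilate (\<lambda>z. f z + g z) r z))\<^sup>2 \<le> (cmod (dilate f r z) + cmod (dilate g r z))\<^sup>2"
        by (intro power_mono) (auto simp: dilate_def norm_triangle_ineq)
      moreover have "0 \<le> (cmod (dilate f r z) - cmod (dilate g r z))\<^sup>2" by simp
      ultimately show "(cmod (dilate (\<lambda>z. f z + g z) r z))\<^sup>2 \<le> 2 * (cmod (dilate f r z))\<^sup>2 + 2 * (cmod (dilate g r z))\<^sup>2"
        unfolding power2_sum power2_diff by linarith
    qed (use I in auto)
    also have "\<dots> = 2 * dilate_mean f r + 2 * dilate_mean g r" using I by (simp add: dilate_mean_def)
    also have "\<dots> \<le> 2 * (hardy_norm f)\<^sup>2 + 2 * (hardy_norm g)\<^sup>2"
      using dilate_mean_le_hardy_norm[OF f, of r] dilate_mean_le_hardy_norm[OF g, of r] r by auto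
    finally show "dilate_mean (\<lambda>z. f z + g z) r \<le> 2 * (hardy_norm f)\<^sup>2 + 2 * (hardy_norm g)\<^sup>2" .
  qed
  show "AE z in sphere_measure. radial_limit (\<lambda>z. f z + g z) z = radial_limit f z + radial_limit g z"
    using AE_radial_limit[OF f] AE_radial_limit[OF g]
    by eventually_elim (rule radial_limit_eq, rule tendsto_add)
qed

lemma hardy_space_diff:
  fixes f g :: "complex^'n \<Rightarrow> complex"
  assumes f: "f \<in> hardy_space" and g: "g \<in> hardy_space"
  shows "(\<lambda>z. f z - g z) \<in> hardy_space"
    "AE z in sphere_measure. radial_limit (\<lambda>z. f z - g z) z = radial_limit f z - radial_limit g z"
proof -
  note m = hardy_space_cmult[OF g, of "-1"]
  show "(\<lambda>z. f z - g z) \<in> hardy_space"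
    using hardy_space_add(1)[OF f m(1)] by simp
  show "AE z in sphere_measure. radial_limit (\<lambda>z. f z - g z) z = radial_limit f z - radial_limit g z"
    using hardy_space_add(2)[OF f m(1)] m(2) by eventually_elim simp
qed

lemma hardy_space_sum:
  fixes f :: "'i \<Rightarrow> complex^'n \<Rightarrow> complex"
  assumes "finite I" "\<And>i. i \<in> I \<Longrightarrow> f i \<in> hardy_space"
  shows "(\<lambda>z. \<Sum>i\<in>I. f i z) \<in> hardy_space \<and>
    (AE z in sphere_measure. radial_limit (\<lambda>z. \<Sum>i\<in>I. f i z) z = (\<Sum>i\<in>I. radial_limit (f i) z))"
  using assms
proof (induction I rule: finite_induct)
  case empty
  have "(\<lambda>z::complex^'n. 0::complex) \<in> hardy_space"
    by (rule hardy_spaceI[where K=0]) (auto simp: ball_analytic_def analytic_on_ball_const dilate_mean_def dilate_def)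
  moreover have "radial_limit (\<lambda>z::complex^'n. 0::complex) z = 0" for z by (rule radial_limit_eq) simp
  ultimately show ?case by simp
next
  case (insert i I)
  then have I: "(\<lambda>z. \<Sum>i\<in>I. f i z) \<in> hardy_space"
    "AE z in sphere_measure. radial_limit (\<lambda>z. \<Sum>i\<in>I. f i z) z = (\<Sum>i\<in>I. radial_limit (f i) z)" by auto
  have i: "f i \<in> hardy_space" using insert by auto
  have "AE z in sphere_measure. radial_limit (\<lambda>z. f i z + (\<Sum>i\<in>I. f i z)) z = radial_limit (f i) z + (\<Sum>i\<in>I. radial_limit (f i) z)"
    using hardy_space_add(2)[OF i I(1)] I(2) by eventually_elim simp
  then show ?case using hardy_space_add(1)[OF i I(1)] insert.hyps by simp
qed

lemma l2_norm_sq_radial_diff: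
  assumes "f \<in> hardy_space" "g \<in> hardy_space"
  shows "(hardy_norm (\<lambda>z. f z - g z))\<^sup>2 = l2_norm_sq (\<lambda>z. radial_limit f z - radial_limit g z)"
  unfolding hardy_norm_power2[OF hardy_space_diff(1)[OF assms]]
  by (rule l2_norm_sq_cong_AE[OF hardy_space_diff(2)[OF assms]])
     (use assms hardy_space_diff(1)[OF assms] in \<open>auto intro!: borel_measurable_diff measurable_radial_limit\<close>)

subsection \<open>Point evaluations and completeness\<close>

lemma poisson_0 [simp]: "poisson 0 w = 1"
  by (simp add: poisson_def)

text \<open>Unimodular scalars act as isometries, so they preserve Lebesgue measure and every ball
  about 0.\<close>

lemma nn_integral_lborel_slice_mean:
  fixes g :: "complex^'n \<Rightarrow> ennreal"
  assumes [measurable]: "g \<in> borel_measurable borel"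
  shows "(\<integral>\<^sup>+w. slice_mean 0 g w * indicator (ball 0 d) w \<partial>lborel) = (\<integral>\<^sup>+w. g w * indicator (ball 0 d) w \<partial>lborel)"
proof -
  interpret P: pair_sigma_finite circle_measure "lborel :: (complex^'n) measure"
    by (intro pair_sigma_finite.intro sigma_finite_circle sigma_finite_lborel)
  have "(\<integral>\<^sup>+w. slice_mean 0 g w * indicator (ball 0 d) w \<partial>lborel)
     = (\<integral>\<^sup>+w. \<integral>\<^sup>+u. g (u *s w) * indicator (ball 0 d) w \<partial>circle_measure \<partial>lborel)"
    unfolding slice_mean_def by (simp add: nn_integral_multc)
  also have "\<dots> = (\<integral>\<^sup>+u. \<integral>\<^sup>+w. g (u *s w) * indicator (ball 0 d) w \<partial>lborel \<partial>circle_measure)"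
    by (rule P.Fubini') measurable
  also have "\<dots> = (\<integral>\<^sup>+u. \<integral>\<^sup>+w. g w * indicator (ball 0 d) w \<partial>lborel \<partial>circle_measure)"
  proof (rule nn_integral_circle_cong)
    fix u :: complex assume u: "cmod u = 1"
    have "(\<integral>\<^sup>+w. g (u *s w) * indicator (ball 0 d) w \<partial>lborel)
        = (\<integral>\<^sup>+w. g (u *s w) * indicator (ball 0 d) (u *s w) \<partial>lborel)"
      by (intro nn_integral_cong) (simp add: indicator_def norm_cscale u)
    also have "\<dots> = (\<integral>\<^sup>+w. g w * indicator (ball 0 d) w \<partial>lborel)"
      by (rule nn_integral_lborel_isometry[where f = "\<lambda>w. g w * indicator (ball 0 d) w"])
         (simp_all add: linear_cscale norm_cscale u)
    finally show "(\<integral>\<^sup>+w. g (u *s w) * indicator (ball 0 d) w \<partial>lborel) = (\<integral>\<^sup>+w. g w * indicator (ball 0 d) w \<partial>lborel)" .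
  qed
  also have "\<dots> = (\<integral>\<^sup>+w. g w * indicator (ball 0 d) w \<partial>lborel)"
    by (simp add: emeasure_circle_measure)
  finally show ?thesis .
qed

text \<open>On each complex line through \<open>z\<close> the circular mean dominates the value at
  the centre; averaging over all directions \<open>w\<close> in a ball gives the solid mean.\<close>

lemma analytic_mean_value_le:
  fixes h :: "complex^'n \<Rightarrow> complex"
  assumes h: "ball_analytic h" and d: "norm z + 2 * d \<le> 1" "0 < d"
  shows "ennreal ((cmod (h z))\<^sup>2) * emeasure lborel (ball (0 :: complex^'n) d)
    \<le> (\<integral>\<^sup>+w. ennreal ((cmod (h w))\<^sup>2) * indicator (ball z d) w \<partial>lborel)"
proof -
  note [measurable] = ball_analytic_measurable[OF h]
  define g where "g w = ennreal ((cmod (h (z + w)))\<^sup>2)" for w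
  have [measurable]: "g \<in> borel_measurable borel" unfolding g_def [abs_def] by measurable
  have "ennreal ((cmod (h z))\<^sup>2) * emeasure lborel (ball (0 :: complex^'n) d)
     = (\<integral>\<^sup>+w. ennreal ((cmod (h z))\<^sup>2) * indicator (ball (0 :: complex^'n) d) w \<partial>lborel)"
    by (simp add: nn_integral_cmult)
  also have "\<dots> \<le> (\<integral>\<^sup>+w. slice_mean 0 g w * indicator (ball 0 d) w \<partial>lborel)"
  proof (rule nn_integral_mono)
    fix w :: "complex^'n"
    have "ennreal ((cmod (h z))\<^sup>2) \<le> slice_mean 0 g w" if w: "norm w < d"
    proof -
      \<comment> \<open>\<open>poisson_subharmonic\<close> asks for a disc of radius above 1; the
        choice 2 is the origin of \<open>2 * d\<close> in the hypothesis.\<close>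
      have "ball 0 2 \<subseteq> {t. z + t *s w \<in> ball 0 1}"
      proof
        fix t :: complex assume "t \<in> ball 0 2"
        then have "cmod t * norm w \<le> 2 * norm w" by (intro mult_right_mono) auto
        then have "norm (z + t *s w) < 1" using norm_triangle_ineq[of z "t *s w"] w d by (simp add: norm_cscale)
        then show "t \<in> {t. z + t *s w \<in> ball 0 1}" by simp
      qed
      moreover have "analytic_on_ball h" using h by (simp add: ball_analytic_def)
      ultimately have "(\<lambda>t. h (z + t *s w)) holomorphic_on ball 0 2"
        by (intro holomorphic_on_subset[OF holomorphic_slice])
      from poisson_subharmonic(2)[OF this, of 0] show ?thesis by (simp add: slice_mean_def g_def)
    qed
    then show "ennreal ((cmod (h z))\<^sup>2) * indicator (ball 0 d) w \<le> slice_mean 0 g w * indicator (ball 0 d) w"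
      by (auto simp: indicator_def)
  qed
  also have "\<dots> = (\<integral>\<^sup>+w. g w * indicator (ball 0 d) w \<partial>lborel)"
    by (rule nn_integral_lborel_slice_mean) measurable
  also have "\<dots> = (\<integral>\<^sup>+w. ennreal ((cmod (h (z + w)))\<^sup>2) * indicator (ball z d) (z + w) \<partial>lborel)"
    by (intro nn_integral_cong) (simp add: g_def indicator_def dist_norm)
  also have "\<dots> = (\<integral>\<^sup>+w. ennreal ((cmod (h w))\<^sup>2) * indicator (ball z d) w \<partial>lborel)"
    by (rule nn_integral_lborel_shift) measurable
  finally show ?thesis .
qed

text \<open>
  The circular means of \<open>|h|\<^sup>2\<close> increase along rays, so that pushing the points of the ball of radius
  \<open>\<rho>\<close> radially to its boundary avoids an integration in polar coordinates.
\<close>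

lemma nn_integral_ball_le_dilate_mean:
  fixes h :: "complex^'n \<Rightarrow> complex"
  assumes h: "ball_analytic h" and \<rho>: "0 < \<rho>" "\<rho> < 1"
  shows "(\<integral>\<^sup>+w. ennreal ((cmod (h w))\<^sup>2) * indicator (ball 0 \<rho>) w \<partial>lborel)
     \<le> ball_vol TYPE(complex^'n) * ennreal (dilate_mean h \<rho>)"
proof -
  note [measurable] = ball_analytic_measurable[OF h] borel_measurable_sgn_vec
  define g where "g s z = ennreal ((cmod (dilate h s z))\<^sup>2)" for s z
  have g[measurable]: "g s \<in> borel_measurable borel" for s unfolding g_def [abs_def] by measurable
  have "(\<integral>\<^sup>+w. ennreal ((cmod (h w))\<^sup>2) * indicator (ball 0 \<rho>) w \<partial>lborel)
      = (\<integral>\<^sup>+w. g 1 w * indicator (ball 0 \<rho>) w \<partial>lborel)"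
    by (simp add: g_def dilate_def)
  also have "\<dots> = (\<integral>\<^sup>+w. slice_mean 0 (g 1) w * indicator (ball 0 \<rho>) w \<partial>lborel)"
    by (rule nn_integral_lborel_slice_mean[symmetric]) measurable
  also have "\<dots> \<le> (\<integral>\<^sup>+w. slice_mean 0 (g \<rho>) (sgn w) * indicator (ball 0 1) w \<partial>lborel)"
  proof (rule nn_integral_mono_AE, rule AE_mp[OF AE_lborel_singleton[of "0 :: complex^'n"]], intro AE_I2 impI)
    fix w :: "complex^'n" assume w: "w \<noteq> 0"
    have "slice_mean 0 (g 1) w \<le> slice_mean 0 (g \<rho>) (sgn w)" if "norm w < \<rho>"
    proof -
      define a where "a = norm w / \<rho>"
      have a: "0 \<le> a" "a < 1" "a * \<rho> = norm w" using that \<rho> by (auto simp: a_def)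
      have s: "norm (sgn w) = 1" using w by (simp add: norm_sgn)
      have "w = norm w *\<^sub>R sgn w" using w by (simp add: sgn_div_norm)
      then have "slice_mean 0 (g 1) w = slice_mean 0 (g 1) (norm w *\<^sub>R sgn w)" by simp
      also have "\<dots> = slice_mean 0 (g (a * \<rho>)) (sgn w)"
        unfolding slice_mean_def g_def dilate_def a(3) by (simp add: cscale_scaleR)
      \<comment> \<open>The mean with parameter \<open>a\<close> raises the radius from
        \<open>norm w\<close> to \<open>\<rho>\<close>, and the outer circular mean then absorbs it
        because \<open>0 * a = 0\<close>.\<close>
      also have "\<dots> \<le> slice_mean 0 (slice_mean a (g \<rho>)) (sgn w)"
        by (rule slice_mean_mono[OF s]) (use dilate_slice_mean(2)[OF h _ \<rho>(2) _ a(1,2)] \<rho> in \<open>simp add: g_def [abs_def]\<close>)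
      also have "\<dots> = slice_mean 0 (g \<rho>) (sgn w)"
        by (subst slice_mean_slice_mean) (use a in auto)
      finally show ?thesis .
    qed
    then show "slice_mean 0 (g 1) w * indicator (ball 0 \<rho>) w \<le> slice_mean 0 (g \<rho>) (sgn w) * indicator (ball 0 1) w"
      using \<rho> by (auto simp: indicator_def)
  qed
  also have "\<dots> = ball_vol TYPE(complex^'n) * (\<integral>\<^sup>+w. slice_mean 0 (g \<rho>) w \<partial>(sphere_measure :: (complex^'n) measure))"
    using ball_vol_finite_pos[where 'a = "complex^'n"]
    by (subst nn_integral_sphere_measure)
       (simp_all add: ennreal_times_divide mult_divide_eq_ennreal mult.commute[of "ball_vol TYPE(complex^'n)"])
  also have "(\<integral>\<^sup>+w. slice_mean 0 (g \<rho>) w \<partial>(sphere_measure :: (complex^'n) measure)) = (\<integral>\<^sup>+w. g \<rho> w \<partial>sphere_measure)"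
    by (rule nn_integral_slice_mean) auto
  also have "\<dots> = ennreal (dilate_mean h \<rho>)"
    unfolding g_def by (rule nn_integral_dilate[OF h]) (use \<rho> in auto)
  finally show ?thesis .
qed

text \<open>The value at \<open>z\<close> is bounded by a mean over a small ball, this ball lies in
  one about 0, and the integral over that one is controlled by a single quadratic mean.
  \<open>C\<close> depends on \<open>R\<close> only, so norm convergence will be locally
  uniform.\<close>

lemma hardy_point_evaluation:
  assumes R: "0 \<le> R" "R < 1"
  obtains C where "0 \<le> C" "\<And>h z. h \<in> hardy_space \<Longrightarrow> norm (z :: complex^'n) \<le> R \<Longrightarrow> cmod (h z) \<le> C * hardy_norm h"
proof -
  \<comment> \<open>Half of the distance to the sphere: then \<open>norm z + 2 * d \<le> 1\<close>,
    and the ball about \<open>z\<close> stays within radius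
    \<open>\<rho> = R + d < 1\<close>.\<close>
  define d where "d = (1 - R) / 2"
  define \<rho> where "\<rho> = (1 + R) / 2"
  have d: "0 < d" "R + d = \<rho>" "0 < \<rho>" "\<rho> < 1" using R by (auto simp: d_def \<rho>_def field_simps)
  define V where "V = measure lborel (ball (0 :: complex^'n) 1)"
  define W where "W = measure lborel (ball (0 :: complex^'n) d)"
  have fin: "emeasure lborel (ball (0 :: complex^'n) r) \<noteq> top" for r
    using emeasure_lborel_ball_finite[of "0 :: complex^'n" r] by (metis infinity_ennreal_def less_irrefl)
  have V: "ball_vol TYPE(complex^'n) = ennreal V" and W: "emeasure lborel (ball (0 :: complex^'n) d) = ennreal W"
    unfolding V_def W_def by (simp_all only: emeasure_eq_ennreal_measure[OF fin])
  have WV: "0 < W" "0 \<le> V" using content_ball_pos[OF d(1)] by (simp_all add: W_def V_def)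
  show ?thesis
  proof (rule that[of "sqrt (V / W)"])
    show "0 \<le> sqrt (V / W)" using WV by simp
    fix h :: "complex^'n \<Rightarrow> complex" and z :: "complex^'n" assume h: "h \<in> hardy_space" and z: "norm z \<le> R"
    have h': "ball_analytic h" using h by (rule hardy_space_ball_analytic)
    have "ennreal ((cmod (h z))\<^sup>2 * W) = ennreal ((cmod (h z))\<^sup>2) * emeasure lborel (ball (0 :: complex^'n) d)"
      using WV by (simp add: W ennreal_mult)
    also have "\<dots> \<le> (\<integral>\<^sup>+w. ennreal ((cmod (h w))\<^sup>2) * indicator (ball z d) w \<partial>lborel)"
      by (rule analytic_mean_value_le[OF h' _ d(1)]) (use z R in \<open>simp add: d_def field_simps\<close>)
    also have "\<dots> \<le> (\<integral>\<^sup>+w. ennreal ((cmod (h w))\<^sup>2) * indicator (ball 0 \<rho>) w \<partial>lborel)"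
    proof (rule nn_integral_mono)
      fix w
      have "w \<in> ball 0 \<rho>" if "w \<in> ball z d"
        using that norm_triangle_ineq2[of w z] d z by (auto simp: dist_norm norm_minus_commute)
      then show "ennreal ((cmod (h w))\<^sup>2) * indicator (ball z d) w \<le> ennreal ((cmod (h w))\<^sup>2) * indicator (ball 0 \<rho>) w"
        by (auto simp: indicator_def)
    qed
    also have "\<dots> \<le> ball_vol TYPE(complex^'n) * ennreal (dilate_mean h \<rho>)"
      by (rule nn_integral_ball_le_dilate_mean[OF h' d(3,4)])
    also have "\<dots> \<le> ennreal V * ennreal ((hardy_norm h)\<^sup>2)"
      unfolding V using dilate_mean_le_hardy_norm[OF h, of \<rho>] d by (intro mult_left_mono ennreal_leI) auto
    also have "\<dots> = ennreal (V * (hardy_norm h)\<^sup>2)" using WV by (simp add: ennreal_mult)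
    finally have "(cmod (h z))\<^sup>2 * W \<le> V * (hardy_norm h)\<^sup>2" using WV by (simp add: ennreal_le_iff)
    then have "(cmod (h z))\<^sup>2 \<le> (V / W) * (hardy_norm h)\<^sup>2" using WV by (simp add: field_simps)
    also have "\<dots> = (sqrt (V / W) * hardy_norm h)\<^sup>2" using WV by (simp add: power_mult_distrib)
    finally show "cmod (h z) \<le> sqrt (V / W) * hardy_norm h"
      by (rule power2_le_imp_le) (intro mult_nonneg_nonneg hardy_norm_nonneg, use WV in simp)
  qed
qed

section \<open>Locally uniform limits of analytic functions\<close>

lemma analytic_derivative_bound:
  fixes k :: "complex^'n \<Rightarrow> complex"
  assumes k: "analytic_on_ball k" and D: "Vector_Spaces.linear (*s) (*) D" "(k has_derivative D) (at x)"
    and x: "norm x + d < 1" "0 < d" and B: "\<And>y. norm y \<le> norm x + d \<Longrightarrow> cmod (k y) \<le> B"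
  shows "cmod (D w) \<le> B / d * norm w"
proof (cases "w = 0")
  case True
  have "D (0 *s 0) = 0 * D 0" using D(1) by (simp only: clinear_iff)
  with True show ?thesis by simp
next
  case False
  \<comment> \<open>The disc of radius \<open>r\<close> in direction \<open>w\<close> reaches
    distance \<open>d\<close> from \<open>x\<close>, so Cauchy's inequality on this complex line
    gives the bound.\<close>
  define r where "r = d / norm w"
  have r: "0 < r" "r * norm w = d" using x False by (auto simp: r_def)
  have nb: "norm (x + t *s w) \<le> norm x + d" if "cmod t \<le> r" for t
    using norm_triangle_ineq[of x "t *s w"] mult_right_mono[OF that, of "norm w"] r by (simp add: norm_cscale)
  have sub: "cball 0 r \<subseteq> {t. x + t *s w \<in> ball 0 1}"
    using nb x by fastforce
  have hol: "(\<lambda>t. k (x + t *s w)) holomorphic_on cball 0 r"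
    by (rule holomorphic_on_subset[OF holomorphic_slice[OF k] sub])
  have "((\<lambda>t. k (x + t *s w)) has_field_derivative D w) (at 0)"
    by (rule analytic_slice_derivative) (use D in auto)
  then have "deriv (\<lambda>t. k (x + t *s w)) 0 = D w" by (rule DERIV_imp_deriv)
  moreover have "cmod ((deriv ^^ 1) (\<lambda>t. k (x + t *s w)) 0) \<le> fact 1 * B / r ^ 1"
    by (rule Cauchy_inequality)
       (use hol holomorphic_on_subset[OF hol ball_subset_cball] holomorphic_on_imp_continuous_on[OF hol] r nb B in auto)
  ultimately have "cmod (D w) \<le> B / r" by simp
  also have "\<dots> = B / d * norm w" using False by (simp add: r_def)
  finally show ?thesis .
qed

text \<open>Cauchy's estimate turns the locally uniform convergence of the functions into that of
  their derivatives; the limit is then differentiable, and complex linearity of the derivatives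
  survives pointwise limits.\<close>

lemma analytic_sequence_limit:
  fixes f :: "nat \<Rightarrow> complex^'n \<Rightarrow> complex"
  assumes an: "\<And>n. analytic_on_ball (f n)" and lim: "\<And>z. z \<in> ball 0 1 \<Longrightarrow> (\<lambda>n. f n z) \<longlonglongrightarrow> h z"
    and unif: "\<And>R e. 0 \<le> R \<Longrightarrow> R < 1 \<Longrightarrow> 0 < e \<Longrightarrow> \<exists>N. \<forall>m\<ge>N. \<forall>n\<ge>N. \<forall>z. norm z \<le> R \<longrightarrow> cmod (f m z - f n z) \<le> e"
  shows "analytic_on_ball h"
  unfolding analytic_on_ball_def
proof
  fix x0 :: "complex^'n" assume x0: "x0 \<in> ball 0 1"
  define R where "R = (1 + norm x0) / 2"
  have R: "norm x0 < R" "R < 1" "0 \<le> R" using x0 by (auto simp: R_def)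
  \<comment> \<open>Margin between the ball \<open>S\<close> of radius \<open>R\<close> and the unit
    sphere, used by Cauchy's estimate at every point of \<open>S\<close>.\<close>
  define d where "d = (1 - R) / 2"
  have d: "0 < d" "R + d < 1" using R by (auto simp: d_def field_simps)
  define S where "S = ball (0 :: complex^'n) R"
  have S: "open S" "x0 \<in> S" "\<And>x. x \<in> S \<Longrightarrow> norm x < R" "\<And>x. x \<in> S \<Longrightarrow> x \<in> ball 0 1"
    using R by (auto simp: S_def)
  have "\<forall>n x. \<exists>D. x \<in> ball 0 1 \<longrightarrow> Vector_Spaces.linear (*s) (*) D \<and> (f n has_derivative D) (at x)"
    using an unfolding analytic_on_ball_def by blast
  then obtain D where D: "\<And>n x. x \<in> ball 0 1 \<Longrightarrow> Vector_Spaces.linear (*s) (*) (D n x)"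
    "\<And>n x. x \<in> ball 0 1 \<Longrightarrow> (f n has_derivative D n x) (at x)"
    by metis
  have DC: "\<exists>N. \<forall>m\<ge>N. \<forall>n\<ge>N. \<forall>x\<in>S. \<forall>w. cmod (D m x w - D n x w) \<le> e * norm w" if e: "0 < e" for e
  proof -
    have "0 < e * d" "0 \<le> R + d" using e d R by simp_all
    from unif[OF this(2) d(2) this(1)] obtain N where N: "\<And>m n z. N \<le> m \<Longrightarrow> N \<le> n \<Longrightarrow> norm z \<le> R + d \<Longrightarrow> cmod (f m z - f n z) \<le> e * d"
      by blast
    have "cmod (D m x w - D n x w) \<le> e * norm w" if mn: "N \<le> m" "N \<le> n" and x: "x \<in> S" for m n x w
    proof -
      have xb: "x \<in> ball 0 1" using S x by blast
      have "cmod ((\<lambda>w. D m x w - D n x w) w) \<le> e * d / d * norm w"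
      proof (rule analytic_derivative_bound[where k = "\<lambda>z. f m z - f n z" and x = x and d = d])
        show "analytic_on_ball (\<lambda>z. f m z - f n z)"
          using analytic_on_ball_add[OF an[of m] analytic_on_ball_mult[OF analytic_on_ball_const[of "-1"] an[of n]]] by simp
        show "Vector_Spaces.linear (*s) (*) (\<lambda>w. D m x w - D n x w)"
          using D(1)[OF xb, of m] D(1)[OF xb, of n] unfolding clinear_iff by (simp add: algebra_simps)
        show "((\<lambda>z. f m z - f n z) has_derivative (\<lambda>w. D m x w - D n x w)) (at x)"
          by (intro has_derivative_diff D xb)
        show "norm x + d < 1" using S(3)[OF x] d by linarith
        fix y :: "complex^'n" assume "norm y \<le> norm x + d"
        then show "cmod (f m y - f n y) \<le> e * d" using S(3)[OF x] by (intro N mn) auto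
      qed (rule d)
      then show ?thesis using d by simp
    qed
    then show ?thesis by blast
  qed
  define g' where "g' x w = lim (\<lambda>n. D n x w)" for x w
  have Dlim: "(\<lambda>n. D n x w) \<longlonglongrightarrow> g' x w" if x: "x \<in> S" for x w
  proof -
    have "Cauchy (\<lambda>n. D n x w)"
    proof (rule metric_CauchyI)
      fix e :: real assume e: "0 < e"
      then have "0 < e / (norm w + 1)" by (simp add: add_nonneg_pos)
      from DC[OF this] obtain N where N: "\<And>m n. N \<le> m \<Longrightarrow> N \<le> n \<Longrightarrow> cmod (D m x w - D n x w) \<le> e / (norm w + 1) * norm w"
        using x by blast
      have "0 < norm w + 1" by (simp add: add_nonneg_pos)
      then have "e / (norm w + 1) * norm w < e" using e by (simp add: pos_divide_less_eq algebra_simps)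
      then show "\<exists>M. \<forall>m\<ge>M. \<forall>n\<ge>M. dist (D m x w) (D n x w) < e"
        unfolding dist_norm by (intro exI[of _ N] allI impI le_less_trans[OF N])
    qed
    then show ?thesis unfolding g'_def by (simp add: Cauchy_convergent convergent_LIMSEQ_iff[symmetric])
  qed
  have "\<exists>g. \<forall>x\<in>S. (\<lambda>n. f n x) \<longlonglongrightarrow> g x \<and> (g has_derivative g' x) (at x within S)"
  proof (rule has_derivative_sequence[where f' = D])
    show "convex S" by (simp add: S_def)
    show "(f n has_derivative D n x) (at x within S)" if "x \<in> S" for n x
      using D(2)[OF S(4)[OF that]] by (rule has_derivative_at_withinI)
    show "x0 \<in> S" by (rule S)
    show "(\<lambda>n. f n x0) \<longlonglongrightarrow> h x0" by (rule lim[OF x0])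
    fix e :: real assume "0 < e"
    from DC[OF this] obtain N where N: "\<And>m n x w. N \<le> m \<Longrightarrow> N \<le> n \<Longrightarrow> x \<in> S \<Longrightarrow> cmod (D m x w - D n x w) \<le> e * norm w"
      by blast
    have "cmod (D n x w - g' x w) \<le> e * norm w" if n: "N \<le> n" and x: "x \<in> S" for n x w
    proof (rule tendsto_upperbound)
      show "(\<lambda>m. cmod (D n x w - D m x w)) \<longlonglongrightarrow> cmod (D n x w - g' x w)"
        by (intro tendsto_intros Dlim x)
      show "\<forall>\<^sub>F m in sequentially. cmod (D n x w - D m x w) \<le> e * norm w"
        using N[OF n _ x] by (auto simp: eventually_sequentially)
    qed simp
    then show "\<forall>\<^sub>F n in sequentially. \<forall>x\<in>S. \<forall>w. cmod (D n x w - g' x w) \<le> e * norm w"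
      unfolding eventually_sequentially by blast
  qed
  then obtain g where g: "\<And>x. x \<in> S \<Longrightarrow> (\<lambda>n. f n x) \<longlonglongrightarrow> g x" "\<And>x. x \<in> S \<Longrightarrow> (g has_derivative g' x) (at x within S)"
    by blast
  have gh: "g x = h x" if "x \<in> S" for x using LIMSEQ_unique[OF g(1) lim] S(4) that by blast
  have "(g has_derivative g' x0) (at x0)"
    using g(2)[OF S(2)] unfolding at_within_open[OF S(2,1)] .
  from has_derivative_transform_within_open[OF this S(1,2) gh]
  have "(h has_derivative g' x0) (at x0)" .
  moreover have "Vector_Spaces.linear (*s) (*) (g' x0)"
    unfolding clinear_iff
  proof (intro conjI allI)
    fix x y c
    have "(\<lambda>n. D n x0 x + D n x0 y) \<longlonglongrightarrow> g' x0 x + g' x0 y" by (intro tendsto_add Dlim S)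
    moreover have "D n x0 x + D n x0 y = D n x0 (x + y)" for n using D(1)[OF x0, of n] by (simp add: clinear_iff)
    ultimately show "g' x0 (x + y) = g' x0 x + g' x0 y" using LIMSEQ_unique[OF Dlim[OF S(2)]] by simp
    have "(\<lambda>n. c * D n x0 x) \<longlonglongrightarrow> c * g' x0 x" by (intro tendsto_mult tendsto_const Dlim S)
    moreover have "c * D n x0 x = D n x0 (c *s x)" for n using D(1)[OF x0, of n] by (simp add: clinear_iff)
    ultimately show "g' x0 (c *s x) = c * g' x0 x" using LIMSEQ_unique[OF Dlim[OF S(2)]] by simp
  qed
  ultimately show "\<exists>D. Vector_Spaces.linear (*s) (*) D \<and> (h has_derivative D) (at x0)" by blast
qed

text \<open>Point evaluations make a norm Cauchy sequence locally uniformly Cauchy, so its pointwise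
  limit is analytic; Fatou's lemma on each sphere carries the norm estimate over to the
  limit.\<close>

lemma hardy_complete:
  fixes f :: "nat \<Rightarrow> complex^'n \<Rightarrow> complex"
  assumes f: "\<And>n. f n \<in> hardy_space"
    and Cau: "\<And>e. 0 < e \<Longrightarrow> \<exists>N. \<forall>m\<ge>N. \<forall>n\<ge>N. hardy_norm (\<lambda>z. f m z - f n z) \<le> e"
  obtains h where "h \<in> hardy_space" "\<And>e. 0 < e \<Longrightarrow> \<exists>N. \<forall>n\<ge>N. hardy_norm (\<lambda>z. f n z - h z) \<le> e"
proof -
  have fb: "ball_analytic (f n)" for n using f hardy_space_ball_analytic by blast
  have unif: "\<exists>N. \<forall>m\<ge>N. \<forall>n\<ge>N. \<forall>z. norm z \<le> R \<longrightarrow> cmod (f m z - f n z) \<le> e" if R: "0 \<le> R" "R < 1" and e: "0 < e" for R e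
  proof -
    obtain C where C: "0 \<le> C" "\<And>h z. h \<in> hardy_space \<Longrightarrow> norm (z :: complex^'n) \<le> R \<Longrightarrow> cmod (h z) \<le> C * hardy_norm h"
      using hardy_point_evaluation[OF R] by blast
    have "0 < e / (C + 1)" using e C by (simp add: add_nonneg_pos)
    from Cau[OF this] obtain N where N: "\<And>m n. N \<le> m \<Longrightarrow> N \<le> n \<Longrightarrow> hardy_norm (\<lambda>z. f m z - f n z) \<le> e / (C + 1)" by blast
    have "cmod (f m z - f n z) \<le> e" if "N \<le> m" "N \<le> n" "norm z \<le> R" for m n z
    proof -
      have "cmod (f m z - f n z) \<le> C * hardy_norm (\<lambda>z. f m z - f n z)"
        by (rule C(2)[OF hardy_space_diff(1)[OF f f] that(3)])
      also have "\<dots> \<le> C * (e / (C + 1))" by (intro mult_left_mono N that C)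
      also have "\<dots> \<le> e" using C e by (simp add: pos_divide_le_eq algebra_simps)
      finally show ?thesis .
    qed
    then show ?thesis by blast
  qed
  define h where "h z = lim (\<lambda>n. f n z)" for z
  have lim: "(\<lambda>n. f n z) \<longlonglongrightarrow> h z" for z
  proof (cases "z \<in> ball 0 1")
    case True
    have "Cauchy (\<lambda>n. f n z)"
    proof (rule metric_CauchyI)
      fix e :: real assume "0 < e"
      then obtain N where "\<forall>m\<ge>N. \<forall>n\<ge>N. cmod (f m z - f n z) \<le> e / 2"
        using unif[of "norm z" "e / 2"] True by auto
      then show "\<exists>M. \<forall>m\<ge>M. \<forall>n\<ge>M. dist (f m z) (f n z) < e"
        unfolding dist_norm
      proof (intro exI[of _ N] allI impI)
        fix m n assume "N \<le> m" "N \<le> n"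
        then have "cmod (f m z - f n z) \<le> e / 2" using \<open>\<forall>m\<ge>N. \<forall>n\<ge>N. cmod (f m z - f n z) \<le> e / 2\<close> by blast
        then show "cmod (f m z - f n z) < e" using \<open>0 < e\<close> by linarith
      qed
    qed
    then show ?thesis unfolding h_def by (simp add: Cauchy_convergent convergent_LIMSEQ_iff[symmetric])
  next
    case False
    then have "f n z = 0" for n using fb by (auto simp: ball_analytic_def)
    then show ?thesis by (simp add: h_def)
  qed
  have hb: "ball_analytic h"
    unfolding ball_analytic_def
  proof (intro conjI allI impI)
    show "analytic_on_ball h"
      by (rule analytic_sequence_limit[of f, OF _ lim unif]) (use fb in \<open>auto simp: ball_analytic_def\<close>)
    fix z assume "z \<notin> ball (0 :: complex^'n) 1"
    then have "f n z = 0" for n using fb by (auto simp: ball_analytic_def)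
    then show "h z = 0" by (simp add: h_def)
  qed
  have est: "dilate_mean (\<lambda>z. f n z - h z) r \<le> e\<^sup>2"
    if e: "0 < e" and N: "\<And>m. N \<le> m \<Longrightarrow> hardy_norm (\<lambda>z. f m z - f n z) \<le> e" and r: "0 < r" "r < 1" for e N n r
  proof -
    have fh: "ball_analytic (\<lambda>z. f n z - h z)" by (rule ball_analytic_diff[OF fb hb])
    have ff: "ball_analytic (\<lambda>z. f m z - f n z)" for m by (rule ball_analytic_diff[OF fb fb])
    note [measurable] = dilate_measurable_sphere[OF ff]
    have "ennreal (dilate_mean (\<lambda>z. f n z - h z) r) = (\<integral>\<^sup>+z. ennreal ((cmod (dilate (\<lambda>z. f n z - h z) r z))\<^sup>2) \<partial>sphere_measure)"
      by (rule nn_integral_dilate[OF fh, symmetric]) (use r in auto)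
    also have "\<dots> = (\<integral>\<^sup>+z. liminf (\<lambda>m. ennreal ((cmod (dilate (\<lambda>z. f m z - f n z) r z))\<^sup>2)) \<partial>(sphere_measure :: (complex^'n) measure))"
    proof (rule nn_integral_cong)
      fix z :: "complex^'n"
      have "(\<lambda>m. ennreal ((cmod (dilate (\<lambda>z. f m z - f n z) r z))\<^sup>2)) \<longlonglongrightarrow> ennreal ((cmod (h (r *\<^sub>R z) - f n (r *\<^sub>R z)))\<^sup>2)"
        unfolding dilate_def by (intro tendsto_ennrealI tendsto_intros lim)
      then have "liminf (\<lambda>m. ennreal ((cmod (dilate (\<lambda>z. f m z - f n z) r z))\<^sup>2)) = ennreal ((cmod (h (r *\<^sub>R z) - f n (r *\<^sub>R z)))\<^sup>2)"
        by (rule lim_imp_Liminf[rotated]) simp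
      then show "ennreal ((cmod (dilate (\<lambda>z. f n z - h z) r z))\<^sup>2) = liminf (\<lambda>m. ennreal ((cmod (dilate (\<lambda>z. f m z - f n z) r z))\<^sup>2))"
        by (simp add: dilate_def norm_minus_commute)
    qed
    also have "\<dots> \<le> liminf (\<lambda>m. \<integral>\<^sup>+z. ennreal ((cmod (dilate (\<lambda>z. f m z - f n z) r z))\<^sup>2) \<partial>(sphere_measure :: (complex^'n) measure))"
      by (rule nn_integral_liminf) measurable
    also have "\<dots> \<le> limsup (\<lambda>m. \<integral>\<^sup>+z. ennreal ((cmod (dilate (\<lambda>z. f m z - f n z) r z))\<^sup>2) \<partial>(sphere_measure :: (complex^'n) measure))"
      by (rule Liminf_le_Limsup) simp
    also have "\<dots> \<le> ennreal (e\<^sup>2)"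
    proof (rule Limsup_bounded)
      have "(\<integral>\<^sup>+z. ennreal ((cmod (dilate (\<lambda>z. f m z - f n z) r z))\<^sup>2) \<partial>(sphere_measure :: (complex^'n) measure)) \<le> ennreal (e\<^sup>2)" if "N \<le> m" for m
      proof -
        have "dilate_mean (\<lambda>z. f m z - f n z) r \<le> (hardy_norm (\<lambda>z. f m z - f n z))\<^sup>2"
          by (rule dilate_mean_le_hardy_norm[OF hardy_space_diff(1)[OF f f]]) (use r in auto)
        also have "\<dots> \<le> e\<^sup>2" by (intro power_mono N that hardy_norm_nonneg)
        finally show ?thesis
          using nn_integral_dilate[OF ff, of r m] r by (simp add: ennreal_leI)
      qed
      then show "\<forall>\<^sub>F m in sequentially. (\<integral>\<^sup>+z. ennreal ((cmod (dilate (\<lambda>z. f m z - f n z) r z))\<^sup>2) \<partial>(sphere_measure :: (complex^'n) measure)) \<le> ennreal (e\<^sup>2)"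
        unfolding eventually_sequentially by blast
    qed
    finally show ?thesis by (simp add: ennreal_le_iff)
  qed
  have conv: "\<exists>N. \<forall>n\<ge>N. hardy_norm (\<lambda>z. f n z - h z) \<le> e \<and> (\<lambda>z. f n z - h z) \<in> hardy_space" if e: "0 < e" for e
  proof -
    obtain N where N: "\<And>m n. N \<le> m \<Longrightarrow> N \<le> n \<Longrightarrow> hardy_norm (\<lambda>z. f m z - f n z) \<le> e" using Cau[OF e] by blast
    have "hardy_norm (\<lambda>z. f n z - h z) \<le> e \<and> (\<lambda>z. f n z - h z) \<in> hardy_space" if "N \<le> n" for n
      using hardy_norm_leI[OF ball_analytic_diff[OF fb hb] est[OF e N[OF _ that]]]
        hardy_spaceI[OF ball_analytic_diff[OF fb hb] est[OF e N[OF _ that]]] e by auto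
    then show ?thesis by blast
  qed
  show ?thesis
  proof (rule that)
    obtain N where "(\<lambda>z. f N z - h z) \<in> hardy_space" using conv[of 1] by auto
    from hardy_space_diff(1)[OF f this, of N] show "h \<in> hardy_space" by simp
    show "\<exists>N. \<forall>n\<ge>N. hardy_norm (\<lambda>z. f n z - h z) \<le> e" if "0 < e" for e using conv[OF that] by blast
  qed
qed

subsection \<open>The projection onto the Hardy space\<close>

text \<open>Adding the best multiple \<open>t * g\<close> to \<open>k\<close> lowers the squared
  distance to \<open>F\<close> by \<open>(cmod c)\<^sup>2 / G\<close>, and this gain cannot exceed
  the excess over the lower bound \<open>d\<close>.\<close>

lemma near_minimal_inner:
  fixes F :: "complex^'n \<Rightarrow> complex"
  assumes F: "sq_integrable F" and d: "\<And>k. k \<in> hardy_space \<Longrightarrow> d \<le> l2_norm_sq (\<lambda>z. F z - radial_limit k z)"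
    and k: "k \<in> hardy_space" and g: "g \<in> hardy_space"
  shows "(cmod (l2_inner (\<lambda>z. F z - radial_limit k z) (radial_limit g)))\<^sup>2
    \<le> (l2_norm_sq (\<lambda>z. F z - radial_limit k z) - d) * (hardy_norm g)\<^sup>2"
proof -
  define u where "u = (\<lambda>z. F z - radial_limit k z)"
  define v where "v = radial_limit g"
  define c where "c = l2_inner u v"
  define G where "G = l2_norm_sq v"
  have v: "sq_integrable v" unfolding v_def by (rule sq_integrable_radial_limit[OF g])
  have u: "sq_integrable u" unfolding u_def by (rule sq_integrable_diff[OF F sq_integrable_radial_limit[OF k]])
  have G: "(hardy_norm g)\<^sup>2 = G" "0 \<le> G" by (simp_all add: G_def v_def hardy_norm_power2 g l2_norm_sq_nonneg)
  have "(cmod c)\<^sup>2 \<le> (l2_norm_sq u - d) * G"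
  proof (cases "G = 0")
    case True
    have "(cmod c)\<^sup>2 \<le> l2_norm_sq u * G" unfolding c_def G_def by (rule l2_Cauchy_Schwarz[OF u v])
    with True show ?thesis by simp
  next
    case False
    \<comment> \<open>The coefficient of the projection of \<open>u\<close> onto the line spanned by
      \<open>v\<close>.\<close>
    define t where "t = c / complex_of_real G"
    have tg: "(\<lambda>z. t * g z) \<in> hardy_space" "AE z in sphere_measure. radial_limit (\<lambda>z. t * g z) z = t * v z"
      using hardy_space_cmult[OF g] by (auto simp: v_def)
    have s: "(\<lambda>z. k z + t * g z) \<in> hardy_space" by (rule hardy_space_add(1)[OF k tg(1)])
    have "d \<le> l2_norm_sq (\<lambda>z. F z - radial_limit (\<lambda>z. k z + t * g z) z)" by (rule d[OF s])
    also have "\<dots> = l2_norm_sq (\<lambda>z. u z - t * v z)"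
    proof (rule l2_norm_sq_cong_AE)
      show "AE z in sphere_measure. F z - radial_limit (\<lambda>z. k z + t * g z) z = u z - t * v z"
        using hardy_space_add(2)[OF k tg(1)] tg(2) by eventually_elim (simp add: u_def)
      show "(\<lambda>z. F z - radial_limit (\<lambda>z. k z + t * g z) z) \<in> borel_measurable sphere_measure"
        using F by (intro borel_measurable_diff measurable_radial_limit[OF s]) (simp add: sq_integrable_def)
      show "(\<lambda>z. u z - t * v z) \<in> borel_measurable sphere_measure"
        using sq_integrable_diff[OF u sq_integrable_cmult[OF v]] by (simp add: sq_integrable_def)
    qed
    also have "\<dots> = l2_norm_sq u - 2 * Re (cnj t * c) + (cmod t)\<^sup>2 * G"
      unfolding c_def G_def by (rule l2_norm_sq_diff_cmult[OF u v])
    also have "Re (cnj t * c) = (cmod c)\<^sup>2 / G"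
      unfolding t_def cmod_power2 using False by (simp add: power2_eq_square field_simps)
    also have "(cmod t)\<^sup>2 * G = (cmod c)\<^sup>2 / G"
      unfolding t_def using False G by (simp add: norm_divide power_divide power2_eq_square)
    finally have "(cmod c)\<^sup>2 / G \<le> l2_norm_sq u - d" by simp
    then show ?thesis using False G by (simp add: pos_divide_le_eq)
  qed
  then show ?thesis by (simp add: u_def v_def c_def G)
qed

lemma hardy_space_zero: "(\<lambda>z :: complex^'n. 0) \<in> hardy_space"
  using hardy_space_sum[of "{}" "\<lambda>_ (_ :: complex^'n). 0"] by simp

lemma l2_inner_le_norms:
  assumes "sq_integrable f" "g \<in> hardy_space" "l2_norm_sq f \<le> e\<^sup>2" "0 \<le> e"
  shows "cmod (l2_inner f (radial_limit g)) \<le> e * hardy_norm g"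
proof (rule power2_le_imp_le)
  have "(cmod (l2_inner f (radial_limit g)))\<^sup>2 \<le> l2_norm_sq f * l2_norm_sq (radial_limit g)"
    by (rule l2_Cauchy_Schwarz[OF assms(1) sq_integrable_radial_limit[OF assms(2)]])
  also have "\<dots> \<le> e\<^sup>2 * (hardy_norm g)\<^sup>2"
    unfolding hardy_norm_power2[OF assms(2)] by (intro mult_right_mono assms l2_norm_sq_nonneg)
  finally show "(cmod (l2_inner f (radial_limit g)))\<^sup>2 \<le> (e * hardy_norm g)\<^sup>2" by (simp add: power_mult_distrib)
qed (intro mult_nonneg_nonneg hardy_norm_nonneg assms)

text \<open>Along a minimizing sequence \<open>k n\<close> the residues become orthogonal to the
  Hardy space, uniformly on its unit ball. Testing with the differences \<open>k m - k n\<close>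
  shows that the sequence is Cauchy, and the residue of its limit is exactly orthogonal.\<close>

lemma hardy_projection_exists:
  fixes F :: "complex^'n \<Rightarrow> complex"
  assumes F: "sq_integrable F"
  obtains h where "h \<in> hardy_space" "\<And>g. g \<in> hardy_space \<Longrightarrow> l2_inner (\<lambda>z. F z - radial_limit h z) (radial_limit g) = 0"
proof -
  let ?H = "hardy_space :: (complex^'n \<Rightarrow> complex) set"
  define N where "N k = l2_norm_sq (\<lambda>z. F z - radial_limit k z)" for k
  define d where "d = Inf (N ` ?H)"
  have bdd: "bdd_below (N ` ?H)" by (rule bdd_belowI[of _ 0]) (auto simp: N_def l2_norm_sq_nonneg)
  have d: "d \<le> N k" if "k \<in> hardy_space" for k
    unfolding d_def by (rule cInf_lower[OF _ bdd]) (use that in auto)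
  \<comment> \<open>The squared distances are taken within \<open>(?e n)\<^sup>2\<close> of the
    infimum, so that the inner products are at most \<open>?e n * hardy_norm g\<close>.\<close>
  let ?e = "\<lambda>n::nat. 1 / real (Suc n)"
  have "\<forall>n. \<exists>k. k \<in> hardy_space \<and> N k < d + (?e n)\<^sup>2"
  proof
    fix n
    have "Inf (N ` ?H) < d + (?e n)\<^sup>2" unfolding d_def by simp
    then show "\<exists>k. k \<in> hardy_space \<and> N k < d + (?e n)\<^sup>2"
      using cInf_lessD[of "N ` ?H"] hardy_space_zero by blast
  qed
  then obtain k where k: "\<And>n. k n \<in> hardy_space" "\<And>n. N (k n) < d + (?e n)\<^sup>2" by metis
  have u: "sq_integrable (\<lambda>z. F z - radial_limit (k n) z)" for n
    by (rule sq_integrable_diff[OF F sq_integrable_radial_limit[OF k(1)]])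
  have inner: "cmod (l2_inner (\<lambda>z. F z - radial_limit (k n) z) (radial_limit g)) \<le> ?e n * hardy_norm g" if g: "g \<in> hardy_space" for n g
  proof (rule power2_le_imp_le)
    have "(cmod (l2_inner (\<lambda>z. F z - radial_limit (k n) z) (radial_limit g)))\<^sup>2 \<le> (N (k n) - d) * (hardy_norm g)\<^sup>2"
      unfolding N_def by (rule near_minimal_inner[OF F d[unfolded N_def] k(1) g])
    also have "\<dots> \<le> (?e n)\<^sup>2 * (hardy_norm g)\<^sup>2" using k(2)[of n] by (intro mult_right_mono) auto
    finally show "(cmod (l2_inner (\<lambda>z. F z - radial_limit (k n) z) (radial_limit g)))\<^sup>2 \<le> (?e n * hardy_norm g)\<^sup>2"
      by (simp only: power_mult_distrib)
    show "0 \<le> ?e n * hardy_norm g" by (intro mult_nonneg_nonneg hardy_norm_nonneg) simp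
  qed
  have diff: "hardy_norm (\<lambda>z. k m z - k n z) \<le> ?e n + ?e m" for m n
  proof -
    define g where "g = (\<lambda>z. k m z - k n z)"
    have g: "g \<in> hardy_space" "AE z in sphere_measure. radial_limit g z = radial_limit (k m) z - radial_limit (k n) z"
      unfolding g_def using hardy_space_diff[OF k(1) k(1)] by auto
    note sg = sq_integrable_radial_limit[OF g(1)]
    have "complex_of_real ((hardy_norm g)\<^sup>2) = l2_inner (radial_limit g) (radial_limit g)"
      unfolding hardy_norm_power2[OF g(1)] by (rule l2_inner_self[OF sg, symmetric])
    also have "\<dots> = l2_inner (\<lambda>z. (F z - radial_limit (k n) z) - (F z - radial_limit (k m) z)) (radial_limit g)"
    proof (rule l2_inner_cong_AE)
      show "AE z in sphere_measure. radial_limit g z = (F z - radial_limit (k n) z) - (F z - radial_limit (k m) z)"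
        using g(2) by eventually_elim simp
      show "(\<lambda>z. (F z - radial_limit (k n) z) - (F z - radial_limit (k m) z)) \<in> borel_measurable sphere_measure"
        using sq_integrable_diff[OF u u] unfolding sq_integrable_def by blast
    qed (use measurable_radial_limit[OF g(1)] in auto)
    also have "\<dots> = l2_inner (\<lambda>z. F z - radial_limit (k n) z) (radial_limit g) - l2_inner (\<lambda>z. F z - radial_limit (k m) z) (radial_limit g)"
      by (rule l2_inner_diff_left[OF u u sg])
    finally have "cmod (complex_of_real ((hardy_norm g)\<^sup>2))
       \<le> cmod (l2_inner (\<lambda>z. F z - radial_limit (k n) z) (radial_limit g)) + cmod (l2_inner (\<lambda>z. F z - radial_limit (k m) z) (radial_limit g))"
      by (simp only: norm_triangle_ineq4)
    also have "\<dots> \<le> (?e n + ?e m) * hardy_norm g"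
      using inner[OF g(1), of n] inner[OF g(1), of m] by (simp only: distrib_right add_mono)
    finally have "hardy_norm g * hardy_norm g \<le> (?e n + ?e m) * hardy_norm g"
      by (simp only: norm_of_real power2_eq_square abs_mult abs_of_nonneg[OF hardy_norm_nonneg])
    moreover have "0 \<le> ?e n + ?e m" by (intro add_nonneg_nonneg) auto
    ultimately have "hardy_norm g \<le> ?e n + ?e m"
      using hardy_norm_nonneg[of g] by (cases "hardy_norm g = 0") (auto simp: mult_le_cancel_right simp del: of_nat_Suc)
    then show ?thesis by (simp add: g_def)
  qed
  have small: "\<exists>N. \<forall>n\<ge>N. ?e n < e" if "0 < e" for e
  proof -
    from reals_Archimedean[OF that] obtain N where N: "inverse (real (Suc N)) < e" by blast
    have "?e n < e" if "N \<le> n" for n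
    proof -
      have "?e n \<le> ?e N" using that by (intro divide_left_mono) auto
      then show ?thesis using N by (simp only: inverse_eq_divide)
    qed
    then show ?thesis by blast
  qed
  have Cau: "\<exists>N. \<forall>m\<ge>N. \<forall>n\<ge>N. hardy_norm (\<lambda>z. k m z - k n z) \<le> e" if "0 < e" for e
  proof -
    have "0 < e / 2" using that by simp
    from small[OF this] obtain N where N: "\<And>n. N \<le> n \<Longrightarrow> ?e n < e / 2" by blast
    have "hardy_norm (\<lambda>z. k m z - k n z) \<le> e" if "N \<le> m" "N \<le> n" for m n
      using diff[of m n] N[OF that(1)] N[OF that(2)] by linarith
    then show ?thesis by blast
  qed
  from hardy_complete[OF k(1) Cau] obtain h where h: "h \<in> hardy_space"
    "\<And>e. 0 < e \<Longrightarrow> \<exists>N. \<forall>n\<ge>N. hardy_norm (\<lambda>z. k n z - h z) \<le> e" by blast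
  show ?thesis
  proof (rule that[OF h(1)])
    fix g :: "complex^'n \<Rightarrow> complex" assume g: "g \<in> hardy_space"
    note sg = sq_integrable_radial_limit[OF g] and sh = sq_integrable_radial_limit[OF h(1)]
    define c where "c = l2_inner (\<lambda>z. F z - radial_limit h z) (radial_limit g)"
    have le: "cmod c \<le> 2 * e * hardy_norm g" if e: "0 < e" for e
    proof -
      obtain N where N: "\<And>n. N \<le> n \<Longrightarrow> ?e n < e" using small[OF e] by blast
      obtain M where M: "\<And>n. M \<le> n \<Longrightarrow> hardy_norm (\<lambda>z. k n z - h z) \<le> e" using h(2)[OF e] by blast
      define n where "n = max M N"
      note sk = sq_integrable_radial_limit[OF k(1)[of n]]
      have "c = l2_inner (\<lambda>z. (F z - radial_limit (k n) z) - (radial_limit h z - radial_limit (k n) z)) (radial_limit g)"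
        unfolding c_def by simp
      also have "\<dots> = l2_inner (\<lambda>z. F z - radial_limit (k n) z) (radial_limit g) - l2_inner (\<lambda>z. radial_limit h z - radial_limit (k n) z) (radial_limit g)"
        by (rule l2_inner_diff_left[OF u sq_integrable_diff[OF sh sk] sg])
      finally have "cmod c \<le> cmod (l2_inner (\<lambda>z. F z - radial_limit (k n) z) (radial_limit g))
         + cmod (l2_inner (\<lambda>z. radial_limit h z - radial_limit (k n) z) (radial_limit g))"
        by (simp only: norm_triangle_ineq4)
      moreover have "cmod (l2_inner (\<lambda>z. F z - radial_limit (k n) z) (radial_limit g)) \<le> e * hardy_norm g"
        using inner[OF g, of n] N[of n] by (intro order_trans[OF inner[OF g]] mult_right_mono hardy_norm_nonneg) (auto simp: n_def)
      moreover have "cmod (l2_inner (\<lambda>z. radial_limit h z - radial_limit (k n) z) (radial_limit g)) \<le> e * hardy_norm g"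
      proof (rule l2_inner_le_norms[OF sq_integrable_diff[OF sh sk] g])
        have "l2_norm_sq (\<lambda>z. radial_limit h z - radial_limit (k n) z) = l2_norm_sq (\<lambda>z. radial_limit (k n) z - radial_limit h z)"
          unfolding l2_norm_sq_def by (simp add: norm_minus_commute)
        also have "\<dots> = (hardy_norm (\<lambda>z. k n z - h z))\<^sup>2" by (rule l2_norm_sq_radial_diff[OF k(1) h(1), symmetric])
        also have "\<dots> \<le> e\<^sup>2" by (intro power_mono M hardy_norm_nonneg) (simp add: n_def)
        finally show "l2_norm_sq (\<lambda>z. radial_limit h z - radial_limit (k n) z) \<le> e\<^sup>2" .
      qed (use e in simp)
      ultimately show ?thesis by linarith
    qed
    have "cmod c \<le> 0"
    proof (rule field_le_epsilon)
      fix e :: real assume e: "0 < e"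
      have p: "0 < 2 * (hardy_norm g + 1)" using hardy_norm_nonneg[of g] by simp
      have "cmod c \<le> 2 * (e / (2 * (hardy_norm g + 1))) * hardy_norm g" by (rule le) (use e p in simp)
      also have "\<dots> \<le> e" using p e hardy_norm_nonneg[of g] by (simp add: field_simps)
      finally show "cmod c \<le> 0 + e" by simp
    qed
    then show "l2_inner (\<lambda>z. F z - radial_limit h z) (radial_limit g) = 0" by (simp add: c_def)
  qed
qed

text \<open>By point evaluations. Elements of norm zero vanish as functions, which is what
  uniqueness under \<open>THE\<close> demands.\<close>

lemma hardy_norm_zero_imp:
  assumes h: "h \<in> hardy_space" and "hardy_norm h = 0"
  shows "h z = 0"
proof (cases "z \<in> ball 0 1")
  case True
  then obtain C where "cmod (h z) \<le> C * hardy_norm h"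
    using hardy_point_evaluation[of "norm z"] h by (metis dist_0_norm mem_ball norm_ge_zero order_refl)
  then show ?thesis using assms(2) by simp
next
  case False
  then show ?thesis using h by (simp add: hardy_space_def)
qed

text \<open>Two candidates differ by an element that is orthogonal to itself, hence zero.\<close>

lemma hardy_projection_eqI:
  fixes F :: "complex^'n \<Rightarrow> complex"
  assumes F: "sq_integrable F" and h: "h \<in> hardy_space"
    and orth: "\<And>g. g \<in> hardy_space \<Longrightarrow> l2_inner (\<lambda>z. F z - radial_limit h z) (radial_limit g) = 0"
  shows "hardy_projection F = h"
  unfolding hardy_projection_def
proof (rule the_equality)
  fix k assume k: "k \<in> hardy_space \<and> (\<forall>g\<in>hardy_space. l2_inner (\<lambda>\<zeta>. F \<zeta> - radial_limit k \<zeta>) (radial_limit g) = 0)"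
  then have k': "k \<in> hardy_space" by blast
  note sh = sq_integrable_diff[OF F sq_integrable_radial_limit[OF h]]
    and sk = sq_integrable_diff[OF F sq_integrable_radial_limit[OF k']]
  define g where "g = (\<lambda>z. k z - h z)"
  have g: "g \<in> hardy_space" unfolding g_def by (rule hardy_space_diff(1)[OF k' h])
  have "complex_of_real ((hardy_norm g)\<^sup>2) = l2_inner (radial_limit g) (radial_limit g)"
    unfolding hardy_norm_power2[OF g] by (rule l2_inner_self[OF sq_integrable_radial_limit[OF g], symmetric])
  also have "\<dots> = l2_inner (\<lambda>z. (F z - radial_limit h z) - (F z - radial_limit k z)) (radial_limit g)"
  proof (rule l2_inner_cong_AE)
    show "AE z in sphere_measure. radial_limit g z = (F z - radial_limit h z) - (F z - radial_limit k z)"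
      using hardy_space_diff(2)[OF k' h] unfolding g_def by eventually_elim simp
    show "(\<lambda>z. (F z - radial_limit h z) - (F z - radial_limit k z)) \<in> borel_measurable sphere_measure"
      using sq_integrable_diff[OF sh sk] unfolding sq_integrable_def by blast
  qed (use measurable_radial_limit[OF g] in auto)
  also have "\<dots> = l2_inner (\<lambda>z. F z - radial_limit h z) (radial_limit g) - l2_inner (\<lambda>z. F z - radial_limit k z) (radial_limit g)"
    by (rule l2_inner_diff_left[OF sh sk sq_integrable_radial_limit[OF g]])
  also have "\<dots> = 0" using orth[OF g] k g by simp
  finally have "hardy_norm g = 0" by simp
  from hardy_norm_zero_imp[OF g this] show "k = h" by (auto simp: g_def fun_eq_iff)
qed (use h orth in auto)

lemma hardy_projection:
  fixes F :: "complex^'n \<Rightarrow> complex"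
  assumes F: "sq_integrable F"
  shows "hardy_projection F \<in> hardy_space"
    and "g \<in> hardy_space \<Longrightarrow> l2_inner (radial_limit (hardy_projection F)) (radial_limit g) = l2_inner F (radial_limit g)"
proof -
  obtain h where h: "h \<in> hardy_space" "\<And>g. g \<in> hardy_space \<Longrightarrow> l2_inner (\<lambda>z. F z - radial_limit h z) (radial_limit g) = 0"
    using hardy_projection_exists[OF F] by blast
  have eq: "hardy_projection F = h" by (rule hardy_projection_eqI[OF F h])
  show "hardy_projection F \<in> hardy_space" using eq h by simp
  assume "g \<in> hardy_space"
  then show "l2_inner (radial_limit (hardy_projection F)) (radial_limit g) = l2_inner F (radial_limit g)"
    using h(2)[of g] l2_inner_diff_left[OF F sq_integrable_radial_limit[OF h(1)] sq_integrable_radial_limit[of g]] eq by simp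
qed

lemma hardy_projection_eqI':
  fixes F :: "complex^'n \<Rightarrow> complex"
  assumes F: "sq_integrable F" and h: "h \<in> hardy_space"
    and "\<And>g. g \<in> hardy_space \<Longrightarrow> l2_inner (radial_limit h) (radial_limit g) = l2_inner F (radial_limit g)"
  shows "hardy_projection F = h"
  by (rule hardy_projection_eqI[OF F h])
     (simp add: l2_inner_diff_left[OF F sq_integrable_radial_limit[OF h] sq_integrable_radial_limit] assms(3))

lemma hardy_projection_cong:
  fixes F :: "complex^'n \<Rightarrow> complex"
  assumes F: "sq_integrable F" "sq_integrable G" "AE z in sphere_measure. F z = G z"
  shows "hardy_projection F = hardy_projection G"
proof (rule hardy_projection_eqI'[OF F(1) hardy_projection(1)[OF F(2)]])
  fix g :: "complex^'n \<Rightarrow> complex" assume g: "g \<in> hardy_space"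
  have "l2_inner G (radial_limit g) = l2_inner F (radial_limit g)"
    by (rule l2_inner_cong_AE) (use F measurable_radial_limit[OF g] in \<open>auto simp: sq_integrable_def elim: AE_mp\<close>)
  then show "l2_inner (radial_limit (hardy_projection G)) (radial_limit g) = l2_inner F (radial_limit g)"
    using hardy_projection(2)[OF F(2) g] by simp
qed

lemma hardy_projection_radial_limit: "h \<in> hardy_space \<Longrightarrow> hardy_projection (radial_limit h) = h"
  by (rule hardy_projection_eqI') (auto intro: sq_integrable_radial_limit)

text \<open>The squared norm of the projection equals its inner product with \<open>F\<close>;
  Cauchy-Schwarz and cancellation finish.\<close>

lemma hardy_norm_projection_le:
  fixes F :: "complex^'n \<Rightarrow> complex"
  assumes F: "sq_integrable F"
  shows "(hardy_norm (hardy_projection F))\<^sup>2 \<le> l2_norm_sq F"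
proof -
  let ?h = "hardy_projection F"
  note h = hardy_projection(1)[OF F]
  have "complex_of_real ((hardy_norm ?h)\<^sup>2) = l2_inner F (radial_limit ?h)"
    unfolding hardy_norm_power2[OF h] using l2_inner_self[OF sq_integrable_radial_limit[OF h]] hardy_projection(2)[OF F h] by simp
  then have "(hardy_norm ?h)\<^sup>2 = cmod (l2_inner F (radial_limit ?h))"
    by (metis abs_of_nonneg norm_of_real zero_le_power2)
  then have "((hardy_norm ?h)\<^sup>2)\<^sup>2 \<le> l2_norm_sq F * (hardy_norm ?h)\<^sup>2"
    using l2_Cauchy_Schwarz[OF F sq_integrable_radial_limit[OF h]] hardy_norm_power2[OF h] by simp
  then have le: "(hardy_norm ?h)\<^sup>2 * (hardy_norm ?h)\<^sup>2 \<le> l2_norm_sq F * (hardy_norm ?h)\<^sup>2"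
    by (simp only: power2_eq_square[of "(hardy_norm ?h)\<^sup>2"])
  show ?thesis
  proof (cases "hardy_norm ?h = 0")
    case True
    then show ?thesis using l2_norm_sq_nonneg[of F] by simp
  next
    case False
    then have "0 < (hardy_norm ?h)\<^sup>2" by simp
    from mult_right_le_imp_le[OF le this] show ?thesis .
  qed
qed

lemma l2_inner_sum_left:
  assumes "finite I" "\<And>i. i \<in> I \<Longrightarrow> sq_integrable (F i)" "sq_integrable g"
  shows "l2_inner (\<lambda>z. \<Sum>i\<in>I. F i z) g = (\<Sum>i\<in>I. l2_inner (F i) g)"
  unfolding l2_inner_def sum_distrib_right
  by (rule Bochner_Integration.integral_sum) (rule sq_integrable_product, use assms in auto)

lemma hardy_projection_sum:
  fixes F :: "'i \<Rightarrow> complex^'n \<Rightarrow> complex"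
  assumes I: "finite I" and F: "\<And>i. i \<in> I \<Longrightarrow> sq_integrable (F i)"
  shows "hardy_projection (\<lambda>z. \<Sum>i\<in>I. F i z) = (\<lambda>z. \<Sum>i\<in>I. hardy_projection (F i) z)"
proof (rule hardy_projection_eqI')
  have H: "hardy_projection (F i) \<in> hardy_space" if "i \<in> I" for i using hardy_projection(1)[OF F[OF that]] .
  note S = hardy_space_sum[OF I, of "\<lambda>i. hardy_projection (F i)", OF H]
  show sF: "sq_integrable (\<lambda>z. \<Sum>i\<in>I. F i z)" by (rule sq_integrable_sum[OF F])
  show h: "(\<lambda>z. \<Sum>i\<in>I. hardy_projection (F i) z) \<in> hardy_space" using S by blast
  fix g :: "complex^'n \<Rightarrow> complex" assume g: "g \<in> hardy_space"
  note sg = sq_integrable_radial_limit[OF g]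
  have sH: "sq_integrable (radial_limit (hardy_projection (F i)))" if "i \<in> I" for i
    by (rule sq_integrable_radial_limit[OF H[OF that]])
  have "l2_inner (radial_limit (\<lambda>z. \<Sum>i\<in>I. hardy_projection (F i) z)) (radial_limit g)
      = l2_inner (\<lambda>z. \<Sum>i\<in>I. radial_limit (hardy_projection (F i)) z) (radial_limit g)"
    by (rule l2_inner_cong_AE)
       (use S sq_integrable_sum[OF sH, of I] measurable_radial_limit[OF g] measurable_radial_limit[OF h] in \<open>auto simp: sq_integrable_def\<close>)
  also have "\<dots> = (\<Sum>i\<in>I. l2_inner (radial_limit (hardy_projection (F i))) (radial_limit g))"
    by (rule l2_inner_sum_left[OF I sH sg])
  also have "\<dots> = (\<Sum>i\<in>I. l2_inner (F i) (radial_limit g))"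
    by (rule sum.cong[OF refl], rule hardy_projection(2)[OF F g])
  also have "\<dots> = l2_inner (\<lambda>z. \<Sum>i\<in>I. F i z) (radial_limit g)"
    by (rule l2_inner_sum_left[OF I F sg, symmetric])
  finally show "l2_inner (radial_limit (\<lambda>z. \<Sum>i\<in>I. hardy_projection (F i) z)) (radial_limit g) = l2_inner (\<lambda>z. \<Sum>i\<in>I. F i z) (radial_limit g)" .
qed

lemma continuous_nth: "continuous_on S (\<lambda>z :: complex^'n. z $ j)"
  by (intro continuous_intros)

lemma hardy_space_coordinate_mult:
  assumes "h \<in> hardy_space"
  shows "(\<lambda>z. z $ j * h z) \<in> hardy_space" "AE z in sphere_measure. radial_limit (\<lambda>z. z $ j * h z) z = z $ j * radial_limit h z"
  using hardy_space_mult[OF assms analytic_on_ball_nth continuous_nth] by auto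

lemma measurable_nth_sphere: "(\<lambda>z :: complex^'n. z $ j) \<in> borel_measurable sphere_measure"
  by (intro measurable_sphere_measure borel_measurable_continuous_onI continuous_nth)

lemma nth_le_1: "norm (z :: complex^'n) = 1 \<Longrightarrow> cmod (z $ j) \<le> 1"
  using Finite_Cartesian_Product.norm_nth_le[of z j] by simp

lemma sq_integrable_coordinate:
  assumes "sq_integrable f"
  shows "sq_integrable (\<lambda>z. z $ j * f z)" "sq_integrable (\<lambda>z. cnj (z $ j) * f z)"
proof -
  note [measurable] = measurable_nth_sphere
  show "sq_integrable (\<lambda>z. z $ j * f z)"
    by (rule sq_integrable_mult[OF assms, where K = 1], measurable) (rule nth_le_1)
  show "sq_integrable (\<lambda>z. cnj (z $ j) * f z)"
    by (rule sq_integrable_mult[OF assms, where K = 1], measurable) (unfold complex_mod_cnj, rule nth_le_1)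
qed

text \<open>The product with a coordinate is already in the Hardy space, so the projection leaves it
  alone.\<close>

lemma toeplitz_coordinate:
  assumes h: "h \<in> hardy_space"
  shows "toeplitz (\<lambda>\<zeta>. \<zeta> $ j) h = (\<lambda>z. z $ j * h z)"
proof -
  note zh = hardy_space_coordinate_mult[OF h, of j]
  have "AE z in sphere_measure. z $ j * radial_limit h z = radial_limit (\<lambda>z. z $ j * h z) z"
    using zh(2) by eventually_elim simp
  from hardy_projection_cong[OF sq_integrable_coordinate(1)[OF sq_integrable_radial_limit[OF h]]
      sq_integrable_radial_limit[OF zh(1)] this]
  show ?thesis unfolding toeplitz_def hardy_projection_radial_limit[OF zh(1)] .
qed

text \<open>Multiplication by a coordinate maps the Hardy space into itself, so its adjoint ignores
  the part of \<open>F\<close> that the projection removes. Intermediate projections in the iterates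
  of \<open>toeplitz_shift\<close> can thus be dropped.\<close>

lemma toeplitz_cnj_coordinate_projection:
  fixes F :: "complex^'n \<Rightarrow> complex"
  assumes F: "sq_integrable F"
  shows "toeplitz (\<lambda>\<zeta>. cnj (\<zeta> $ j)) (hardy_projection F) = hardy_projection (\<lambda>\<zeta>. cnj (\<zeta> $ j) * F \<zeta>)"
  unfolding toeplitz_def
proof (rule hardy_projection_eqI')
  note PF = hardy_projection(1)[OF F]
  show "sq_integrable (\<lambda>\<zeta>. cnj (\<zeta> $ j) * radial_limit (hardy_projection F) \<zeta>)"
    by (rule sq_integrable_coordinate(2)[OF sq_integrable_radial_limit[OF PF]])
  show "hardy_projection (\<lambda>\<zeta>. cnj (\<zeta> $ j) * F \<zeta>) \<in> hardy_space"
    by (rule hardy_projection(1)[OF sq_integrable_coordinate(2)[OF F]])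
  fix g :: "complex^'n \<Rightarrow> complex" assume g: "g \<in> hardy_space"
  have move: "l2_inner (\<lambda>\<zeta>. cnj (\<zeta> $ j) * u \<zeta>) (radial_limit g) = l2_inner u (radial_limit (\<lambda>z. z $ j * g z))" if u: "sq_integrable u" for u
  proof -
    have "l2_inner (\<lambda>\<zeta>. cnj (\<zeta> $ j) * u \<zeta>) (radial_limit g) = l2_inner u (\<lambda>\<zeta>. \<zeta> $ j * radial_limit g \<zeta>)"
      unfolding l2_inner_def by (simp add: mult_ac)
    also have "\<dots> = l2_inner u (radial_limit (\<lambda>z. z $ j * g z))"
    proof (rule l2_inner_cong_AE)
      show "AE z in sphere_measure. z $ j * radial_limit g z = radial_limit (\<lambda>z. z $ j * g z) z"
        using hardy_space_coordinate_mult(2)[OF g, of j] by eventually_elim simp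
      show "(\<lambda>z. z $ j * radial_limit g z) \<in> borel_measurable sphere_measure"
        using sq_integrable_coordinate(1)[OF sq_integrable_radial_limit[OF g]] by (simp add: sq_integrable_def)
    qed (use u measurable_radial_limit[OF hardy_space_coordinate_mult(1)[OF g]] in \<open>auto simp: sq_integrable_def\<close>)
    finally show ?thesis .
  qed
  show "l2_inner (radial_limit (hardy_projection (\<lambda>\<zeta>. cnj (\<zeta> $ j) * F \<zeta>))) (radial_limit g)
    = l2_inner (\<lambda>\<zeta>. cnj (\<zeta> $ j) * radial_limit (hardy_projection F) \<zeta>) (radial_limit g)"
    using hardy_projection(2)[OF sq_integrable_coordinate(2)[OF F] g] move[OF F]
      move[OF sq_integrable_radial_limit[OF PF]] hardy_projection(2)[OF F hardy_space_coordinate_mult(1)[OF g]] by simp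
qed

subsection \<open>Asymptotic Toeplitz operators of linear composition operators\<close>

text \<open>The Hermitian product, conjugate-linear in the second argument; its real part is the
  Euclidean \<open>inner\<close>.\<close>

definition cinner :: "complex^'n \<Rightarrow> complex^'n \<Rightarrow> complex" where
  "cinner z w = (\<Sum>i\<in>UNIV. z $ i * cnj (w $ i))"

lemma Re_cinner: "Re (cinner z w) = z \<bullet> w"
  unfolding cinner_def inner_vec_def by (simp add: inner_complex_def)

lemma cinner_add_left: "cinner (x + y) w = cinner x w + cinner y w"
  by (simp add: cinner_def distrib_right sum.distrib)

lemma cinner_add_right: "cinner x (y + w) = cinner x y + cinner x w"
  by (simp add: cinner_def distrib_left sum.distrib)

lemma cinner_diff_left: "cinner (x - y) w = cinner x w - cinner y w"
  by (simp add: cinner_def left_diff_distrib sum_subtractf)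

lemma cinner_diff_right: "cinner x (y - w) = cinner x y - cinner x w"
  by (simp add: cinner_def right_diff_distrib sum_subtractf)

lemma cinner_scale_left: "cinner (c *s x) w = c * cinner x w"
  by (simp add: cinner_def sum_distrib_left mult_ac)

lemma cinner_scale_right: "cinner x (c *s w) = cnj c * cinner x w"
  by (simp add: cinner_def sum_distrib_left mult_ac)

lemma cinner_commute: "cinner w z = cnj (cinner z w)"
  by (simp add: cinner_def mult.commute)

lemma cinner_self: "cinner z z = complex_of_real ((norm z)\<^sup>2)"
proof (rule complex_eqI)
  show "Re (cinner z z) = Re (complex_of_real ((norm z)\<^sup>2))"
    by (simp add: Re_cinner power2_norm_eq_inner)
  have "cinner z z = cnj (cinner z z)" by (rule cinner_commute)
  then show "Im (cinner z z) = Im (complex_of_real ((norm z)\<^sup>2))"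
    by (simp add: complex_eq_iff)
qed

text \<open>A unimodular factor \<open>u\<close> makes the product real and nonnegative, which
  reduces the claim to the real Cauchy-Schwarz inequality.\<close>

lemma norm_cinner_le: "cmod (cinner z w) \<le> norm z * norm w"
proof (cases "cinner z w = 0")
  case False
  define u where "u = cnj (cinner z w) / complex_of_real (cmod (cinner z w))"
  have u: "cmod u = 1" using False by (simp add: u_def norm_divide)
  have "cinner (u *s z) w = complex_of_real (cmod (cinner z w))"
    unfolding cinner_scale_left u_def using False complex_norm_square[of "cinner z w"]
    by (simp add: field_simps power2_eq_square)
  then have "cmod (cinner z w) = (u *s z) \<bullet> w" by (simp flip: Re_cinner)
  also have "\<dots> \<le> norm (u *s z) * norm w" by (rule norm_cauchy_schwarz)
  finally show ?thesis by (simp add: norm_cscale u)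
qed simp

lemma norm_add_sq: "(norm (x + y))\<^sup>2 = (norm x)\<^sup>2 + (norm y)\<^sup>2 + 2 * Re (cinner x y)"
  unfolding Re_cinner power2_norm_eq_inner by (simp add: inner_add_left inner_add_right inner_commute)

lemma norm_diff_sq: "(norm (x - y))\<^sup>2 = (norm x)\<^sup>2 + (norm y)\<^sup>2 - 2 * Re (cinner x y)"
  unfolding Re_cinner power2_norm_eq_inner by (simp add: inner_diff_left inner_diff_right inner_commute)

lemma continuous_on_cinner [continuous_intros]:
  fixes f g :: "'a::topological_space \<Rightarrow> complex^'n"
  assumes "continuous_on S f" "continuous_on S g"
  shows "continuous_on S (\<lambda>x. cinner (f x) (g x))"
  unfolding cinner_def by (intro continuous_intros assms)

section \<open>The symbol of a contraction and the iterates of the shift\<close>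

locale linear_contraction =
  fixes A :: "complex^'n \<Rightarrow> complex^'n"
  assumes lin: "Vector_Spaces.linear (*s) (*s) A" and contr: "norm (A z) \<le> norm z"
begin

text \<open>The \<open>f\<close> of the overview; its values on the sphere form the numerical range
  of \<open>A\<close>.\<close>

definition symb :: "complex^'n \<Rightarrow> complex" where
  "symb z = cinner (A z) z"

lemma continuous_A: "continuous_on S A"
  by (rule linear_continuous_on[OF clinear_bounded[OF lin]])

lemma continuous_symb: "continuous_on S symb"
  unfolding symb_def [abs_def] by (intro continuous_intros continuous_A)

lemma norm_symb_le: "norm z = 1 \<Longrightarrow> cmod (symb z) \<le> 1"
  using norm_cinner_le[of "A z" z] contr[of z] by (simp add: symb_def)

lemma measurable_symb: "symb \<in> borel_measurable sphere_measure"
  by (intro measurable_sphere_measure borel_measurable_continuous_onI continuous_symb)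

lemma sq_integrable_symb_power:
  "sq_integrable f \<Longrightarrow> sq_integrable (\<lambda>z. symb z ^ m * f z)"
proof (rule sq_integrable_mult[where K = 1])
  show "(\<lambda>z. symb z ^ m) \<in> borel_measurable sphere_measure"
    using measurable_symb by measurable
  show "cmod (symb z ^ m) \<le> 1" if "norm z = 1" for z
    using norm_symb_le[OF that] by (simp add: norm_power power_le_one)
qed

lemma analytic_A_nth: "analytic_on_ball (\<lambda>z. A z $ j)"
proof (rule analytic_on_ball_clinear)
  interpret Vector_Spaces.linear "(*s)" "(*s)" A by (rule lin)
  show "Vector_Spaces.linear (*s) (*) (\<lambda>z. A z $ j)" by (simp add: clinear_iff add scale)
qed

text \<open>One step of the iteration multiplies by a coordinate before the composition, which
  becomes the component \<open>A z $ j\<close> after it, and by the conjugate coordinate at the end;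
  summation over \<open>j\<close> gives one more factor \<open>symb\<close>. The induction needs
  arbitrary \<open>h\<close>, as its hypothesis is applied to \<open>h\<close> times a
  coordinate.\<close>

lemma toeplitz_shift_power_composition:
  assumes bdd: "\<And>h. h \<in> hardy_space \<Longrightarrow> composition_op A h \<in> hardy_space" and h: "h \<in> hardy_space"
  shows "(toeplitz_shift ^^ m) (composition_op A) h
    = hardy_projection (\<lambda>\<zeta>. symb \<zeta> ^ m * radial_limit (composition_op A h) \<zeta>)"
  using h
proof (induction m arbitrary: h)
  case 0
  then show ?case by (simp add: hardy_projection_radial_limit bdd)
next
  case (Suc m)
  let ?C = "composition_op A"
  let ?r = "radial_limit (?C h)"
  have Ch: "?C h \<in> hardy_space" by (rule bdd[OF Suc.prems])
  note sr = sq_integrable_radial_limit[OF Ch]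
  note [measurable] = measurable_symb measurable_nth_sphere
  have [measurable]: "(\<lambda>z. A z $ j) \<in> borel_measurable sphere_measure" for j
    by (intro measurable_sphere_measure borel_measurable_continuous_onI continuous_intros continuous_A)
  have sA: "sq_integrable (\<lambda>\<zeta>. A \<zeta> $ j * f \<zeta>)" if "sq_integrable f" for f j
  proof (rule sq_integrable_mult[OF that, where K = 1])
    show "cmod (A z $ j) \<le> 1" if "norm z = 1" for z
      using Finite_Cartesian_Product.norm_nth_le[of "A z" j] contr[of z] that by simp
  qed measurable
  have summand: "toeplitz (\<lambda>\<zeta>. cnj (\<zeta> $ j)) ((toeplitz_shift ^^ m) ?C (toeplitz (\<lambda>\<zeta>. \<zeta> $ j) h))
     = hardy_projection (\<lambda>\<zeta>. cnj (\<zeta> $ j) * (symb \<zeta> ^ m * (A \<zeta> $ j * ?r \<zeta>)))" for j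
  proof -
    define k where "k = (\<lambda>z. z $ j * h z)"
    have k: "k \<in> hardy_space" unfolding k_def by (rule hardy_space_coordinate_mult(1)[OF Suc.prems])
    have Ck: "?C k = (\<lambda>z. A z $ j * ?C h z)" by (auto simp: composition_op_def k_def)
    have "continuous_on (cball 0 1) (\<lambda>z. A z $ j)" by (intro continuous_intros continuous_A)
    note mA = hardy_space_mult[OF Ch analytic_A_nth[of j] this]
    have "AE z in sphere_measure. symb z ^ m * radial_limit (?C k) z = symb z ^ m * (A z $ j * ?r z)"
      using mA(2) unfolding Ck by eventually_elim simp
    then have "hardy_projection (\<lambda>\<zeta>. symb \<zeta> ^ m * radial_limit (?C k) \<zeta>) = hardy_projection (\<lambda>\<zeta>. symb \<zeta> ^ m * (A \<zeta> $ j * ?r \<zeta>))"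
      by (intro hardy_projection_cong sq_integrable_symb_power sA sr sq_integrable_radial_limit bdd k)
    moreover have "toeplitz (\<lambda>\<zeta>. \<zeta> $ j) h = k" unfolding k_def by (rule toeplitz_coordinate[OF Suc.prems])
    ultimately show ?thesis
      using toeplitz_cnj_coordinate_projection[OF sq_integrable_symb_power[OF sA[OF sr]]] by (simp add: Suc.IH[OF k])
  qed
  have "(toeplitz_shift ^^ Suc m) ?C h = (\<lambda>z. \<Sum>j\<in>UNIV. hardy_projection (\<lambda>\<zeta>. cnj (\<zeta> $ j) * (symb \<zeta> ^ m * (A \<zeta> $ j * ?r \<zeta>))) z)"
    by (simp add: toeplitz_shift_def summand)
  also have "\<dots> = hardy_projection (\<lambda>\<zeta>. \<Sum>j\<in>UNIV. cnj (\<zeta> $ j) * (symb \<zeta> ^ m * (A \<zeta> $ j * ?r \<zeta>)))"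
    by (rule hardy_projection_sum[symmetric]) (auto intro!: sq_integrable_coordinate sq_integrable_symb_power sA sr)
  also have "(\<lambda>\<zeta>. \<Sum>j\<in>UNIV. cnj (\<zeta> $ j) * (symb \<zeta> ^ m * (A \<zeta> $ j * ?r \<zeta>))) = (\<lambda>\<zeta>. symb \<zeta> ^ Suc m * ?r \<zeta>)"
  proof
    fix \<zeta>
    have "symb \<zeta> ^ Suc m * ?r \<zeta> = (\<Sum>j\<in>UNIV. A \<zeta> $ j * cnj (\<zeta> $ j)) * (symb \<zeta> ^ m * ?r \<zeta>)"
      by (simp add: symb_def cinner_def mult_ac)
    also have "\<dots> = (\<Sum>j\<in>UNIV. cnj (\<zeta> $ j) * (symb \<zeta> ^ m * (A \<zeta> $ j * ?r \<zeta>)))"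
      unfolding sum_distrib_right by (intro sum.cong refl) (simp add: mult_ac)
    finally show "(\<Sum>j\<in>UNIV. cnj (\<zeta> $ j) * (symb \<zeta> ^ m * (A \<zeta> $ j * ?r \<zeta>))) = symb \<zeta> ^ Suc m * ?r \<zeta>" by simp
  qed
  finally show ?case .
qed

end

subsection \<open>Boundedness of linear composition operators\<close>

definition adjoint_matrix :: "complex^'n^'n \<Rightarrow> complex^'n^'n" where
  "adjoint_matrix B = (\<chi> i j. cnj (B $ j $ i))"

lemma cinner_adjoint_matrix: "cinner (B *v z) w = cinner z (adjoint_matrix B *v w)"
proof -
  have "cinner (B *v z) w = (\<Sum>i\<in>UNIV. \<Sum>j\<in>UNIV. B $ i $ j * z $ j * cnj (w $ i))"
    by (simp add: cinner_def matrix_vector_mult_def sum_distrib_right)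
  also have "\<dots> = (\<Sum>j\<in>UNIV. \<Sum>i\<in>UNIV. B $ i $ j * z $ j * cnj (w $ i))" by (rule sum.swap)
  also have "\<dots> = cinner z (adjoint_matrix B *v w)"
    by (simp add: cinner_def matrix_vector_mult_def adjoint_matrix_def sum_distrib_left mult_ac)
  finally show ?thesis .
qed

lemma cinner_adjoint_matrix': "cinner (adjoint_matrix B *v z) w = cinner z (B *v w)"
  using cinner_adjoint_matrix[of B w z] cinner_commute[of z "B *v w"] cinner_commute[of "adjoint_matrix B *v z" w] by simp

text \<open>Matrices are used in place of maps so that this set is compact in a Euclidean space and
  perturbations run along complex lines.\<close>

definition contractions :: "(complex^'n^'n) set" where
  "contractions = {B. \<forall>z. norm (B *v z) \<le> norm z}"

text \<open>With \<open>s\<close> the image of \<open>w\<close> under the adjoint, the square of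
  \<open>norm s\<close> is the product of \<open>w\<close> with \<open>B *v s\<close>, hence at most
  \<open>norm w * norm s\<close>.\<close>

lemma norm_adjoint_le:
  assumes "B \<in> contractions"
  shows "norm (adjoint_matrix B *v w) \<le> norm w"
proof (cases "norm (adjoint_matrix B *v w) = 0")
  case False
  let ?s = "adjoint_matrix B *v w"
  have "cinner ?s ?s = cinner w (B *v ?s)" by (rule cinner_adjoint_matrix')
  then have "complex_of_real ((norm ?s)\<^sup>2) = cinner w (B *v ?s)" by (simp only: cinner_self)
  then have "(norm ?s)\<^sup>2 = cmod (cinner w (B *v ?s))" by (metis abs_of_nonneg norm_of_real zero_le_power2)
  also have "\<dots> \<le> norm w * norm (B *v ?s)" by (rule norm_cinner_le)
  also have "\<dots> \<le> norm w * norm ?s" using assms by (intro mult_left_mono) (auto simp: contractions_def)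
  finally have "norm ?s * norm ?s \<le> norm w * norm ?s" by (simp only: power2_eq_square)
  moreover have "0 < norm ?s" using False by simp
  ultimately show ?thesis by (rule mult_right_le_imp_le)
qed simp

definition matrix_scale :: "complex \<Rightarrow> complex^'n^'n \<Rightarrow> complex^'n^'n" where
  "matrix_scale c B = (\<chi> i. c *s B $ i)"

lemma matrix_scale_mult_vec: "matrix_scale c B *v z = c *s (B *v z)"
  by (simp add: vec_eq_iff matrix_scale_def matrix_vector_mult_def sum_distrib_left mult_ac)

lemma norm_matrix_scale: "norm (matrix_scale c B) = cmod c * norm B"
  unfolding norm_vec_def[of "matrix_scale c B"] norm_vec_def[of B]
  by (simp add: matrix_scale_def norm_cscale L2_set_right_distrib)

text \<open>
  With \<open>Q = I - B\<^sup>*B\<close> and \<open>Q\<^sub>* = I - BB\<^sup>*\<close> one has \<open>B Q = Q\<^sub>* B\<close>, so that for \<open>C = Q\<^sub>* X Q / 6\<close> both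
  \<open>\<langle>Bz, Cz\<rangle>\<close> and \<open>|Cz|\<^sup>2\<close> are controlled by \<open>|Qz|\<^sup>2 \<le> |z|\<^sup>2 - |Bz|\<^sup>2\<close>.
\<close>

lemma contraction_perturbation:
  fixes B :: "complex^'n^'n"
  assumes B: "B \<in> contractions" and ni: "norm (B *v z0) \<noteq> norm z0"
  obtains C where "C \<noteq> 0" "\<And>c. cmod c < 2 \<Longrightarrow> B + matrix_scale c C \<in> contractions"
proof -
  define S where "S = adjoint_matrix B"
  have Bc: "norm (B *v z) \<le> norm z" for z using B by (simp add: contractions_def)
  have Sc: "norm (S *v z) \<le> norm z" for z unfolding S_def by (rule norm_adjoint_le[OF B])
  have BS: "cinner (B *v z) w = cinner z (S *v w)" and SB: "cinner (S *v z) w = cinner z (B *v w)" for z w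
    unfolding S_def by (rule cinner_adjoint_matrix, rule cinner_adjoint_matrix')
  define Q where "Q z = z - S *v (B *v z)" for z
  define Qs where "Qs z = z - B *v (S *v z)" for z
  have BQ: "B *v (Q z) = Qs (B *v z)" for z
    by (simp add: Q_def Qs_def matrix_vector_mult_diff_distrib)
  have Qs_adj: "cinner (Qs z) w = cinner z (Qs w)" for z w
    by (simp add: Qs_def cinner_diff_left cinner_diff_right BS SB)
  have Qz: "(norm (Q z))\<^sup>2 \<le> (norm z)\<^sup>2 - (norm (B *v z))\<^sup>2" for z
  proof -
    have "(norm (Q z))\<^sup>2 = (norm z)\<^sup>2 + (norm (S *v (B *v z)))\<^sup>2 - 2 * Re (cinner z (S *v (B *v z)))"
      unfolding Q_def by (rule norm_diff_sq)
    also have "cinner z (S *v (B *v z)) = complex_of_real ((norm (B *v z))\<^sup>2)"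
      by (simp only: BS[symmetric] cinner_self)
    finally show ?thesis using power_mono[OF Sc[of "B *v z"], of 2] by simp
  qed
  have Qs_le: "norm (Qs z) \<le> norm z" for z
  proof (rule power2_le_imp_le)
    have "(norm (Qs z))\<^sup>2 = (norm z)\<^sup>2 + (norm (B *v (S *v z)))\<^sup>2 - 2 * Re (cinner z (B *v (S *v z)))"
      unfolding Qs_def by (rule norm_diff_sq)
    also have "cinner z (B *v (S *v z)) = complex_of_real ((norm (S *v z))\<^sup>2)"
      by (simp only: SB[symmetric] cinner_self)
    finally have "(norm (Qs z))\<^sup>2 = (norm z)\<^sup>2 + (norm (B *v (S *v z)))\<^sup>2 - 2 * (norm (S *v z))\<^sup>2"
      by (simp only: Re_complex_of_real)
    moreover have "(norm (B *v (S *v z)))\<^sup>2 \<le> (norm (S *v z))\<^sup>2" by (rule power_mono[OF Bc]) simp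
    moreover have "0 \<le> (norm (S *v z))\<^sup>2" by simp
    ultimately show "(norm (Qs z))\<^sup>2 \<le> (norm z)\<^sup>2" by linarith
  qed simp
  have "Q z0 \<noteq> 0"
  proof
    assume "Q z0 = 0"
    then have "z0 = S *v (B *v z0)" by (simp add: Q_def)
    then have "cinner z0 z0 = cinner z0 (S *v (B *v z0))" by simp
    then have "complex_of_real ((norm z0)\<^sup>2) = complex_of_real ((norm (B *v z0))\<^sup>2)" by (simp only: BS[symmetric] cinner_self)
    then have "(norm z0)\<^sup>2 = (norm (B *v z0))\<^sup>2" by (simp only: of_real_eq_iff)
    then show False using ni by simp
  qed
  \<comment> \<open>If \<open>Qs\<close> vanished, \<open>S\<close> would be a right inverse of the
    square matrix \<open>B\<close>, hence a left inverse, and \<open>Q\<close> would vanish at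
    \<open>z0\<close>.\<close>
  have "\<exists>u0. Qs u0 \<noteq> 0"
  proof (rule ccontr)
    assume "\<nexists>u0. Qs u0 \<noteq> 0"
    then have "B *v (S *v w) = w" for w by (simp add: Qs_def)
    then have "(B ** S) *v w = mat 1 *v w" for w by (simp add: matrix_vector_mul_assoc[symmetric])
    then have "B ** S = mat 1" by (simp add: matrix_eq)
    then have "S ** B = mat 1" by (simp add: matrix_left_right_inverse)
    then have "S *v (B *v z0) = z0" by (simp add: matrix_vector_mul_assoc)
    then show False using \<open>Q z0 \<noteq> 0\<close> by (simp add: Q_def)
  qed
  then obtain u0 where u0: "Qs u0 \<noteq> 0" by blast
  then have u0n: "norm u0 \<noteq> 0" using Qs_le[of u0] by auto
  \<comment> \<open>A rank-one contraction sending \<open>Q z0\<close> to a nonzero multiple of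
    \<open>u0\<close>, so that \<open>Qs (X (Q z0))\<close> does not vanish.\<close>
  define X where "X w = (cinner w (Q z0) / (complex_of_real (norm (Q z0) * norm u0))) *s u0" for w
  have X_le: "norm (X w) \<le> norm w" for w
  proof -
    have "norm (X w) = cmod (cinner w (Q z0)) / norm (Q z0)"
      using u0n \<open>Q z0 \<noteq> 0\<close> by (simp add: X_def norm_cscale norm_divide norm_mult)
    also have "\<dots> \<le> (norm w * norm (Q z0)) / norm (Q z0)" by (intro divide_right_mono norm_cinner_le) simp
    finally show ?thesis using \<open>Q z0 \<noteq> 0\<close> by simp
  qed
  \<comment> \<open>For \<open>cmod c < 2\<close> the factor 1/6 keeps the two perturbation terms
    below \<open>4 * (q / 36) + 2 * 2 * (q / 6) = 7 * q / 9\<close>, within the available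
    \<open>q\<close>. Radius 2 leaves room around the closed unit disc for the mean value
    inequality.\<close>
  define f where "f z = (1/6) *s Qs (X (Q z))" for z
  have Q_add: "Q (x + y) = Q x + Q y" "Q (c *s x) = c *s Q x" for x y c
    by (simp_all add: Q_def matrix_vector_right_distrib vector_scalar_commute[symmetric] vector_ssub_ldistrib)
  have Qs_add: "Qs (x + y) = Qs x + Qs y" "Qs (c *s x) = c *s Qs x" for x y c
    by (simp_all add: Qs_def matrix_vector_right_distrib vector_scalar_commute[symmetric] vector_ssub_ldistrib)
  have X_add: "X (x + y) = X x + X y" "X (c *s x) = c *s X x" for x y c
    by (simp_all add: X_def cinner_add_left cinner_scale_left add_divide_distrib vector_sadd_rdistrib)
  have lin: "Vector_Spaces.linear (*s) (*s) f"
    by (simp add: Vector_Spaces.linear_iff vec.vector_space_axioms f_def Q_add Qs_add X_add vector_add_ldistrib mult.commute)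
  define C where "C = matrix f"
  have C: "C *v z = f z" for z unfolding C_def by (rule matrix_works[OF lin])
  show ?thesis
  proof (rule that[of C])
    show "C \<noteq> 0"
    proof
      assume "C = 0"
      then have "f z0 = 0" using C[of z0] by simp
      moreover have "f z0 = (cinner (Q z0) (Q z0) / (6 * complex_of_real (norm (Q z0) * norm u0))) *s Qs u0"
        unfolding f_def X_def Qs_add by simp
      ultimately have "cinner (Q z0) (Q z0) / (6 * complex_of_real (norm (Q z0) * norm u0)) = 0"
        using u0 by simp
      then show False using \<open>Q z0 \<noteq> 0\<close> u0n by (simp add: cinner_self)
    qed
    fix c :: complex assume c: "cmod c < 2"
    show "B + matrix_scale c C \<in> contractions"
      unfolding contractions_def
    proof (intro CollectI allI)
      fix z :: "complex^'n"
      define q where "q = (norm (Q z))\<^sup>2"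
      have q0: "0 \<le> q" by (simp add: q_def)
      have Cz: "(norm (C *v z))\<^sup>2 \<le> q / 36"
      proof -
        have "norm (C *v z) \<le> norm (Q z) / 6"
          unfolding C f_def norm_cscale using order_trans[OF Qs_le X_le, of "Q z"] by (simp add: norm_divide)
        then have "(norm (C *v z))\<^sup>2 \<le> (norm (Q z) / 6)\<^sup>2" by (rule power_mono) simp
        then show ?thesis by (simp add: q_def power_divide)
      qed
      have BC: "cmod (cinner (B *v z) (C *v z)) \<le> q / 6"
      proof -
        have "cinner (B *v z) (C *v z) = (1/6) * cinner (Qs (B *v z)) (X (Q z))"
          unfolding C f_def cinner_scale_right Qs_adj by simp
        then have "cmod (cinner (B *v z) (C *v z)) = cmod (cinner (B *v Q z) (X (Q z))) / 6"
          by (simp only: norm_mult BQ) simp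
        also have "\<dots> \<le> (norm (B *v Q z) * norm (X (Q z))) / 6" by (intro divide_right_mono norm_cinner_le) simp
        also have "\<dots> \<le> (norm (Q z) * norm (Q z)) / 6" by (intro divide_right_mono mult_mono Bc X_le) auto
        finally show ?thesis by (simp add: q_def power2_eq_square)
      qed
      have eq: "(B + matrix_scale c C) *v z = B *v z + c *s (C *v z)"
        by (simp add: matrix_vector_mult_add_rdistrib matrix_scale_mult_vec)
      have "(norm ((B + matrix_scale c C) *v z))\<^sup>2 = (norm (B *v z))\<^sup>2 + (cmod c)\<^sup>2 * (norm (C *v z))\<^sup>2 + 2 * Re (cnj c * cinner (B *v z) (C *v z))"
        unfolding eq norm_add_sq cinner_scale_right norm_cscale power_mult_distrib ..
      also have "Re (cnj c * cinner (B *v z) (C *v z)) \<le> cmod c * cmod (cinner (B *v z) (C *v z))"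
        using complex_Re_le_cmod[of "cnj c * cinner (B *v z) (C *v z)"] by (simp only: norm_mult complex_mod_cnj)
      also have "cmod c * cmod (cinner (B *v z) (C *v z)) \<le> 2 * (q / 6)"
        using c BC by (intro mult_mono) auto
      also have "(cmod c)\<^sup>2 * (norm (C *v z))\<^sup>2 \<le> 2\<^sup>2 * (q / 36)"
        using c Cz by (intro mult_mono power_mono) auto
      finally have "(norm ((B + matrix_scale c C) *v z))\<^sup>2 \<le> (norm (B *v z))\<^sup>2 + q" using q0 by simp
      also have "\<dots> \<le> (norm z)\<^sup>2" using Qz[of z] by (simp add: q_def)
      finally show "norm ((B + matrix_scale c C) *v z) \<le> norm z" by (rule power2_le_imp_le) simp
    qed
  qed
qed

section \<open>Quadratic means as functions on the contractive matrices\<close>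

lemma compact_contractions: "compact (contractions :: (complex^'n^'n) set)"
  unfolding compact_eq_bounded_closed
proof
  show "closed (contractions :: (complex^'n^'n) set)"
  proof -
    have eq: "(contractions :: (complex^'n^'n) set) = (\<Inter>z. {B. norm (B *v z) \<le> norm z})"
      by (auto simp: contractions_def)
    have "closed {B :: complex^'n^'n. norm (B *v z) \<le> norm z}" for z
      unfolding matrix_vector_mult_def by (intro closed_Collect_le continuous_intros)
    then show ?thesis unfolding eq by (intro closed_INT ballI)
  qed
  show "bounded (contractions :: (complex^'n^'n) set)"
    unfolding bounded_iff
  proof (intro exI ballI)
    fix B :: "complex^'n^'n" assume B: "B \<in> contractions"
    have e: "cmod (B $ i $ j) \<le> 1" for i j
    proof -
      have "B $ i $ j = (B *v axis j 1) $ i" by (simp add: matrix_vector_mult_def axis_def if_distrib cong: if_cong)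
      then have "cmod (B $ i $ j) \<le> norm (B *v axis j 1)" by (simp add: Finite_Cartesian_Product.norm_nth_le)
      also have "\<dots> \<le> norm (axis j 1 :: complex^'n)" using B unfolding contractions_def by blast
      finally show ?thesis by (simp add: norm_axis_1)
    qed
    have "norm B \<le> (\<Sum>i\<in>UNIV. norm (B $ i))" unfolding norm_vec_def[of B] by (rule L2_set_le_sum) simp
    also have "\<dots> \<le> (\<Sum>i\<in>(UNIV::'n set). \<Sum>j\<in>(UNIV::'n set). cmod (B $ i $ j))"
      unfolding norm_vec_def[of "B $ _"] by (intro sum_mono L2_set_le_sum) simp
    also have "\<dots> \<le> (\<Sum>i\<in>(UNIV::'n set). \<Sum>j\<in>(UNIV::'n set). 1)" by (intro sum_mono e)
    finally show "norm B \<le> (\<Sum>i\<in>(UNIV::'n set). \<Sum>j\<in>(UNIV::'n set). 1)" .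
  qed
qed

text \<open>The norm of a matrix is here the Euclidean one, which comes from an inner product. Its
  square is therefore strictly subharmonic on complex lines, with the explicit gain
  \<open>(cmod c)\<^sup>2 * (norm C)\<^sup>2\<close> on average.\<close>

lemma matrix_parallelogram:
  fixes B C :: "complex^'n^'n"
  shows "(norm (B + matrix_scale c C))\<^sup>2 + (norm (B + matrix_scale (- c) C))\<^sup>2 = 2 * (norm B)\<^sup>2 + 2 * (cmod c)\<^sup>2 * (norm C)\<^sup>2"
proof -
  have "matrix_scale (- c) C = - matrix_scale c C" by (simp add: matrix_scale_def vec_eq_iff)
  then have "(norm (B + matrix_scale c C))\<^sup>2 + (norm (B + matrix_scale (- c) C))\<^sup>2 = 2 * (norm B)\<^sup>2 + 2 * (norm (matrix_scale c C))\<^sup>2"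
    unfolding power2_norm_eq_inner by (simp add: inner_add_left inner_add_right inner_diff_left inner_diff_right inner_commute)
  then show ?thesis by (simp add: norm_matrix_scale power_mult_distrib)
qed

definition matrix_mean :: "(complex^'n \<Rightarrow> complex) \<Rightarrow> real \<Rightarrow> complex^'n^'n \<Rightarrow> real" where
  "matrix_mean h s B = (LINT z|sphere_measure. (cmod (dilate h s (B *v z)))\<^sup>2)"

lemma continuous_matrix_vector: "continuous_on S (\<lambda>z :: complex^'n. (B :: complex^'n^'n) *v z)"
  unfolding matrix_vector_mult_def by (intro continuous_intros)

lemma measurable_matrix_dilate:
  fixes B :: "complex^'n^'n"
  assumes "ball_analytic h"
  shows "(\<lambda>z. dilate h s (B *v z)) \<in> borel_measurable borel"
  by (rule measurable_compose[OF borel_measurable_continuous_onI[OF continuous_matrix_vector]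
        borel_measurable_dilate[OF ball_analytic_measurable[OF assms]]])

lemma matrix_mean_nn:
  fixes B :: "complex^'n^'n"
  assumes h: "ball_analytic h" and s: "0 \<le> s" "s < 1" and B: "B \<in> contractions"
  shows "(\<integral>\<^sup>+z. ennreal ((cmod (dilate h s (B *v z)))\<^sup>2) \<partial>sphere_measure) = ennreal (matrix_mean h s B)"
proof -
  obtain K where K: "\<And>z. norm z \<le> 1 \<Longrightarrow> cmod (dilate h s z) \<le> K" using dilate_bounded[OF h s] by blast
  note [measurable] = measurable_sphere_measure[OF measurable_matrix_dilate[OF h]]
  have "integrable sphere_measure (\<lambda>z. (cmod (dilate h s (B *v z)))\<^sup>2)"
  proof (rule integrable_sphere_bounded[where K = "K\<^sup>2"])
    fix z :: "complex^'n" assume "norm z = 1"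
    then have "norm (B *v z) \<le> 1" using B by (metis (mono_tags, lifting) contractions_def mem_Collect_eq)
    then have "(cmod (dilate h s (B *v z)))\<^sup>2 \<le> K\<^sup>2" by (intro power_mono K) auto
    then show "norm ((cmod (dilate h s (B *v z)))\<^sup>2) \<le> K\<^sup>2" by simp
  qed measurable
  then show ?thesis unfolding matrix_mean_def by (rule nn_integral_eq_integral) auto
qed

lemma matrix_mean_nonneg: "0 \<le> matrix_mean h s B"
  unfolding matrix_mean_def by (rule integral_nonneg_AE) auto

lemma continuous_matrix_mean:
  fixes h :: "complex^'n \<Rightarrow> complex"
  assumes h: "ball_analytic h" and s: "0 \<le> s" "s < 1"
  shows "continuous_on contractions (matrix_mean h s)"
  unfolding continuous_on_sequentially
proof (intro allI ballI impI, elim conjE)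
  fix B0 and B :: "nat \<Rightarrow> complex^'n^'n"
  assume B: "B0 \<in> contractions" "\<forall>n. B n \<in> contractions" "B \<longlonglongrightarrow> B0"
  obtain K where K: "\<And>z. norm z \<le> 1 \<Longrightarrow> cmod (dilate h s z) \<le> K" using dilate_bounded[OF h s] by blast
  note [measurable] = measurable_sphere_measure[OF measurable_matrix_dilate[OF h]]
  have le: "norm (C *v z) \<le> 1" if "C \<in> contractions" "norm z = 1" for C :: "complex^'n^'n" and z
    using that by (metis (mono_tags, lifting) contractions_def mem_Collect_eq)
  have cont: "continuous_on (cball 0 1) (dilate h s)"
    unfolding dilate_def
    by (rule continuous_on_compose2[OF ball_analytic_continuous[OF h]])
       (use s in \<open>auto intro!: continuous_intros simp: intro: le_less_trans[OF mult_left_le]\<close>)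
  have "(\<lambda>n. matrix_mean h s (B n)) \<longlonglongrightarrow> matrix_mean h s B0"
    unfolding matrix_mean_def
  proof (rule integral_dominated_convergence[where w = "\<lambda>_. K\<^sup>2"])
    show "integrable sphere_measure (\<lambda>_ :: complex^'n. K\<^sup>2)"
      by (rule integrable_sphere_bounded[where K = "K\<^sup>2"]) auto
    show "AE z in sphere_measure. (\<lambda>n. (cmod (dilate h s (B n *v z)))\<^sup>2) \<longlonglongrightarrow> (cmod (dilate h s (B0 *v z)))\<^sup>2"
    proof (rule AE_I2)
      fix z :: "complex^'n" assume "z \<in> space sphere_measure"
      then have z: "norm z = 1" by simp
      have "(\<lambda>n. B n *v z) \<longlonglongrightarrow> B0 *v z"
        unfolding matrix_vector_mult_def by (intro tendsto_intros B)
      then have "(\<lambda>n. dilate h s (B n *v z)) \<longlonglongrightarrow> dilate h s (B0 *v z)"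
        by (rule continuous_on_tendsto_compose[OF cont]) (use le[OF _ z] B in auto)
      then show "(\<lambda>n. (cmod (dilate h s (B n *v z)))\<^sup>2) \<longlonglongrightarrow> (cmod (dilate h s (B0 *v z)))\<^sup>2"
        by (intro tendsto_intros)
    qed
    show "AE z in sphere_measure. norm ((cmod (dilate h s (B n *v z)))\<^sup>2) \<le> K\<^sup>2" for n
    proof (rule AE_I2)
      fix z :: "complex^'n" assume "z \<in> space sphere_measure"
      then have "(cmod (dilate h s (B n *v z)))\<^sup>2 \<le> K\<^sup>2" using B by (intro power_mono K le) auto
      then show "norm ((cmod (dilate h s (B n *v z)))\<^sup>2) \<le> K\<^sup>2" by simp
    qed
  qed measurable
  then show "(matrix_mean h s \<circ> B) \<longlonglongrightarrow> matrix_mean h s B0" by (simp add: comp_def)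
qed

text \<open>\<open>matrix_mean\<close> along a complex line as an \<open>ennreal\<close> integral,
  which is Borel in \<open>c\<close> on the whole plane, also where the matrix leaves
  \<open>contractions\<close>.\<close>

definition line_mean :: "(complex^'n \<Rightarrow> complex) \<Rightarrow> real \<Rightarrow> complex^'n^'n \<Rightarrow> complex^'n^'n \<Rightarrow> complex \<Rightarrow> ennreal" where
  "line_mean h s B C c = (\<integral>\<^sup>+z. ennreal ((cmod (dilate h s (B *v z + c *s (C *v z))))\<^sup>2) \<partial>sphere_measure)"

lemma matrix_line: "(B + matrix_scale c C) *v z = B *v z + c *s (C *v z)"
  by (simp add: matrix_vector_mult_add_rdistrib matrix_scale_mult_vec)

lemma line_mean_eq:
  assumes "ball_analytic h" "0 \<le> s" "s < 1" "B + matrix_scale c C \<in> contractions"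
  shows "line_mean h s B C c = ennreal (matrix_mean h s (B + matrix_scale c C))"
  unfolding line_mean_def matrix_mean_nn[OF assms, symmetric] matrix_line ..

lemma borel_measurable_line_mean:
  fixes B C :: "complex^'n^'n"
  assumes h: "ball_analytic h"
  shows "line_mean h s B C \<in> borel_measurable borel"
proof -
  note [measurable] = borel_measurable_dilate[OF ball_analytic_measurable[OF h]]
    borel_measurable_continuous_onI[OF continuous_matrix_vector]
  interpret sigma_finite_measure "sphere_measure :: (complex^'n) measure" by (rule sigma_finite_sphere)
  show ?thesis unfolding line_mean_def [abs_def] by measurable
qed

text \<open>For each fixed \<open>z\<close> the integrand is the squared modulus of a function
  holomorphic in \<open>c\<close> on the disc of radius 2; the mean value inequality at 0 is
  integrated over the sphere.\<close>

lemma matrix_mean_subharmonic: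
  fixes B C :: "complex^'n^'n"
  assumes h: "ball_analytic h" and s: "0 \<le> s" "s < 1" and C: "\<And>c. cmod c < 2 \<Longrightarrow> B + matrix_scale c C \<in> contractions"
  shows "ennreal (matrix_mean h s B) \<le> (\<integral>\<^sup>+c. line_mean h s B C c \<partial>circle_measure)"
proof -
  note [measurable] = borel_measurable_dilate[OF ball_analytic_measurable[OF h]]
    borel_measurable_continuous_onI[OF continuous_matrix_vector]
  have "B + matrix_scale 0 C = B" by (simp add: matrix_scale_def vec_eq_iff)
  then have B: "B \<in> contractions" using C[of 0] by simp
  have "ennreal (matrix_mean h s B) = (\<integral>\<^sup>+z. ennreal ((cmod (dilate h s (B *v z)))\<^sup>2) \<partial>sphere_measure)"
    by (rule matrix_mean_nn[OF h s B, symmetric])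
  also have "\<dots> \<le> (\<integral>\<^sup>+z. \<integral>\<^sup>+c. ennreal ((cmod (dilate h s (B *v z + c *s (C *v z))))\<^sup>2) \<partial>circle_measure \<partial>(sphere_measure :: (complex^'n) measure))"
  proof (rule nn_integral_mono)
    fix z :: "complex^'n" assume "z \<in> space sphere_measure"
    then have z: "norm z = 1" by simp
    have sub: "ball 0 2 \<subseteq> {t. s *\<^sub>R (B *v z) + t *s (s *\<^sub>R (C *v z)) \<in> ball 0 1}"
    proof
      fix t :: complex assume "t \<in> ball 0 2"
      then have "norm ((B + matrix_scale t C) *v z) \<le> norm z" using C[of t] by (simp add: contractions_def)
      then have "s * norm (B *v z + t *s (C *v z)) \<le> s * 1" using z s by (intro mult_left_mono) (simp_all add: matrix_line)
      moreover have "s *\<^sub>R (B *v z) + t *s (s *\<^sub>R (C *v z)) = s *\<^sub>R (B *v z + t *s (C *v z))"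
        by (simp add: cscale_scaleR scaleR_add_right)
      ultimately show "t \<in> {t. s *\<^sub>R (B *v z) + t *s (s *\<^sub>R (C *v z)) \<in> ball 0 1}" using s by simp
    qed
    have "analytic_on_ball h" using h by (simp add: ball_analytic_def)
    from holomorphic_on_subset[OF holomorphic_slice[OF this] sub]
    have "(\<lambda>t. dilate h s (B *v z + t *s (C *v z))) holomorphic_on ball 0 2"
      by (simp add: dilate_def cscale_scaleR scaleR_add_right)
    from poisson_subharmonic(2)[OF this, of 0]
    show "ennreal ((cmod (dilate h s (B *v z)))\<^sup>2) \<le> (\<integral>\<^sup>+c. ennreal ((cmod (dilate h s (B *v z + c *s (C *v z))))\<^sup>2) \<partial>circle_measure)"
      by simp
  qed
  also have "\<dots> = (\<integral>\<^sup>+c. \<integral>\<^sup>+z. ennreal ((cmod (dilate h s (B *v z + c *s (C *v z))))\<^sup>2) \<partial>(sphere_measure :: (complex^'n) measure) \<partial>circle_measure)"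
    by (rule nn_integral_circle_sphere_swap) measurable
  finally show ?thesis unfolding line_mean_def .
qed

text \<open>
  A maximizer of \<open>B \<mapsto> matrix_mean h s B + \<epsilon> \<parallel>B\<parallel>\<^sup>2\<close> on the contractions is an isometry, since this
  function is strictly subharmonic on complex lines.
\<close>

lemma matrix_mean_le_dilate_mean:
  fixes A :: "complex^'n^'n"
  assumes h: "ball_analytic h" and s: "0 \<le> s" "s < 1" and A: "A \<in> contractions"
  shows "matrix_mean h s A \<le> dilate_mean h s"
proof -
  obtain R where R: "\<And>B. B \<in> contractions \<Longrightarrow> norm (B :: complex^'n^'n) \<le> R"
    using compact_imp_bounded[OF compact_contractions] unfolding bounded_iff by blast
  have R0: "0 \<le> R" using order_trans[OF norm_ge_zero R[OF A]] .
  have "matrix_mean h s A \<le> dilate_mean h s + e * R\<^sup>2" if e: "0 < e" for e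
  proof -
    define g where "g B = matrix_mean h s B + e * (norm B)\<^sup>2" for B :: "complex^'n^'n"
    have cont: "continuous_on contractions g"
      unfolding g_def by (intro continuous_intros continuous_matrix_mean h s)
    obtain B where B: "B \<in> contractions" "\<And>C. C \<in> contractions \<Longrightarrow> g C \<le> g B"
      using continuous_attains_sup[OF compact_contractions _ cont] A by blast
    have iso: "norm (B *v z) = norm z" for z
    proof (rule ccontr)
      assume "norm (B *v z) \<noteq> norm z"
      then obtain C where C: "C \<noteq> 0" "\<And>c. cmod c < 2 \<Longrightarrow> B + matrix_scale c C \<in> contractions"
        using contraction_perturbation[OF B(1)] by blast
      \<comment> \<open>Maximality of \<open>B\<close> and the parallelogram identity bound the sum
        of two opposite values on the line by \<open>v\<close>, whereas subharmonicity makes the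
        average of that sum at least \<open>2 * matrix_mean h s B\<close>. The term with
        \<open>norm C\<close> is the contradiction.\<close>
      define v where "v = 2 * matrix_mean h s B - 2 * e * (norm C)\<^sup>2"
      have le: "matrix_mean h s (B + matrix_scale c C) + matrix_mean h s (B + matrix_scale (- c) C) \<le> v" if c: "cmod c = 1" for c
      proof -
        have "g (B + matrix_scale c C) + g (B + matrix_scale (- c) C) \<le> 2 * g B"
          using B(2)[OF C(2)[of c]] B(2)[OF C(2)[of "- c"]] c by simp
        moreover have "e * (norm (B + matrix_scale c C))\<^sup>2 + e * (norm (B + matrix_scale (- c) C))\<^sup>2 = 2 * (e * (norm B)\<^sup>2) + 2 * (e * (norm C)\<^sup>2)"
        proof -
          have "(norm (B + matrix_scale c C))\<^sup>2 + (norm (B + matrix_scale (- c) C))\<^sup>2 = 2 * (norm B)\<^sup>2 + 2 * (norm C)\<^sup>2"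
            using matrix_parallelogram[of B c C] c by simp
          from arg_cong[OF this, of "\<lambda>x. e * x"] show ?thesis by (simp only: distrib_left mult.left_commute[of e])
        qed
        ultimately show ?thesis unfolding g_def v_def mult.assoc distrib_left by linarith
      qed
      have v0: "0 \<le> v" using le[of 1] matrix_mean_nonneg[of h s "B + matrix_scale 1 C"] matrix_mean_nonneg[of h s "B + matrix_scale (- 1) C"] by simp
      let ?W = "line_mean h s B C"
      note [measurable] = borel_measurable_line_mean[OF h]
      have m: "?W \<in> borel_measurable circle_measure" "(\<lambda>c. ?W (-1 * c)) \<in> borel_measurable circle_measure"
        by measurable
      have "ennreal (2 * matrix_mean h s B) = ennreal (matrix_mean h s B) + ennreal (matrix_mean h s B)"
        by (simp add: matrix_mean_nonneg flip: ennreal_plus)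
      also have "\<dots> \<le> (\<integral>\<^sup>+c. ?W c \<partial>circle_measure) + (\<integral>\<^sup>+c. ?W c \<partial>circle_measure)"
        by (intro add_mono matrix_mean_subharmonic h s C(2))
      \<comment> \<open>Rotation by -1 pairs each \<open>c\<close> with \<open>- c\<close>.\<close>
      also have "\<dots> = (\<integral>\<^sup>+c. ?W c \<partial>circle_measure) + (\<integral>\<^sup>+c. ?W (-1 * c) \<partial>circle_measure)"
        by (subst nn_integral_circle_rotate[of ?W "-1"]) (simp_all add: borel_measurable_line_mean[OF h])
      also have "\<dots> = (\<integral>\<^sup>+c. ?W c + ?W (-1 * c) \<partial>circle_measure)"
        by (rule nn_integral_add[OF m, symmetric])
      also have "\<dots> \<le> (\<integral>\<^sup>+c. ennreal v \<partial>circle_measure)"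
      proof (rule nn_integral_mono_AE, rule AE_mp[OF AE_circle_measure], intro AE_I2 impI)
        fix c :: complex assume c: "cmod c = 1"
        have "?W c + ?W (-1 * c) = ennreal (matrix_mean h s (B + matrix_scale c C) + matrix_mean h s (B + matrix_scale (- c) C))"
          using c by (simp add: line_mean_eq[OF h s C(2)] matrix_mean_nonneg)
        also have "\<dots> \<le> ennreal v" by (intro ennreal_leI le c)
        finally show "?W c + ?W (-1 * c) \<le> ennreal v" .
      qed
      also have "\<dots> = ennreal v" by (simp add: emeasure_circle_measure)
      finally have "2 * matrix_mean h s B \<le> v" using v0 by (simp add: ennreal_le_iff)
      moreover have "0 < e * (norm C)\<^sup>2" using e C(1) by simp
      ultimately show False by (simp add: v_def)
    qed
    have "matrix_mean h s B = dilate_mean h s"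
    proof -
      note [measurable] = borel_measurable_dilate[OF ball_analytic_measurable[OF h]]
      have "ennreal (matrix_mean h s B) = (\<integral>\<^sup>+z. ennreal ((cmod (dilate h s (B *v z)))\<^sup>2) \<partial>sphere_measure)"
        by (rule matrix_mean_nn[OF h s B(1), symmetric])
      also have "\<dots> = (\<integral>\<^sup>+z. ennreal ((cmod (dilate h s z))\<^sup>2) \<partial>sphere_measure)"
        by (rule nn_integral_sphere_measure_isometry[where T = "\<lambda>z. B *v z"])
           (auto simp: iso intro!: linearI matrix_vector_right_distrib scaleR_matrix_vector_assoc[symmetric])
      also have "\<dots> = ennreal (dilate_mean h s)" by (rule nn_integral_dilate[OF h s])
      finally show ?thesis by (simp add: matrix_mean_nonneg dilate_mean_nonneg)
    qed
    moreover have "g A \<le> g B" by (rule B(2)[OF A])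
    moreover have "e * (norm B)\<^sup>2 \<le> e * R\<^sup>2" using e R[OF B(1)] by (intro mult_left_mono power_mono) auto
    moreover have "0 \<le> e * (norm A)\<^sup>2" using e by simp
    ultimately show ?thesis by (simp add: g_def)
  qed
  note main = this
  show ?thesis
  proof (rule field_le_epsilon)
    fix e :: real assume e: "0 < e"
    have p: "0 < R\<^sup>2 + 1" by (simp add: add_nonneg_pos)
    then have "matrix_mean h s A \<le> dilate_mean h s + e / (R\<^sup>2 + 1) * R\<^sup>2" using e by (intro main) simp
    also have "e / (R\<^sup>2 + 1) * R\<^sup>2 \<le> e" using p e by (simp add: pos_divide_le_eq algebra_simps)
    finally show "matrix_mean h s A \<le> dilate_mean h s + e" by simp
  qed
qed

text \<open>The quadratic mean of the composition at radius \<open>r\<close> is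
  \<open>matrix_mean h r (matrix A)\<close>, so the comparison holds radius by radius and passes to
  the norm.\<close>

lemma contraction_composition_hardy:
  fixes A :: "complex^'n \<Rightarrow> complex^'n"
  assumes A: "Vector_Spaces.linear (*s) (*s) A" "\<And>z. norm (A z) \<le> norm z" and h: "h \<in> hardy_space"
  shows "composition_op A h \<in> hardy_space" "hardy_norm (composition_op A h) \<le> hardy_norm h"
proof -
  have h': "ball_analytic h" by (rule hardy_space_ball_analytic[OF h])
  have Ah: "ball_analytic (composition_op A h)" by (rule ball_analytic_composition[OF A h'])
  interpret Vector_Spaces.linear "(*s)" "(*s)" A by (rule A(1))
  have M: "matrix A \<in> contractions" using A by (simp add: contractions_def matrix_works)
  have le: "dilate_mean (composition_op A h) r \<le> (hardy_norm h)\<^sup>2" if r: "0 < r" "r < 1" for r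
  proof -
    have "dilate_mean (composition_op A h) r = matrix_mean h r (matrix A)"
      unfolding dilate_mean_def matrix_mean_def
    proof (rule Bochner_Integration.integral_cong[OF refl])
      fix z :: "complex^'n" assume "z \<in> space sphere_measure"
      then have "dilate (composition_op A h) r z = h (A (r *\<^sub>R z))" using r by (simp add: dilate_def composition_op_def)
      also have "A (r *\<^sub>R z) = r *\<^sub>R A z" by (simp only: scale flip: of_real_cscale)
      finally show "(cmod (dilate (composition_op A h) r z))\<^sup>2 = (cmod (dilate h r (matrix A *v z)))\<^sup>2"
        by (simp add: dilate_def matrix_works[OF A(1)])
    qed
    also have "\<dots> \<le> dilate_mean h r" by (rule matrix_mean_le_dilate_mean[OF h' _ r(2) M]) (use r in simp)
    also have "\<dots> \<le> (hardy_norm h)\<^sup>2" by (rule dilate_mean_le_hardy_norm[OF h]) (use r in auto)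
    finally show ?thesis .
  qed
  show "composition_op A h \<in> hardy_space" by (rule hardy_spaceI[OF Ah le])
  show "hardy_norm (composition_op A h) \<le> hardy_norm h" by (rule hardy_norm_leI[OF Ah le hardy_norm_nonneg])
qed

subsection \<open>Peak functions and the spectrum\<close>

lemma hardy_norm_zero: "hardy_norm (\<lambda>z :: complex^'n. 0) = 0"
proof (rule antisym)
  show "hardy_norm (\<lambda>z :: complex^'n. 0) \<le> 0"
    by (rule hardy_norm_leI) (auto simp: ball_analytic_def analytic_on_ball_const dilate_mean_def dilate_def)
qed (rule hardy_norm_nonneg)

lemma bounded_hardy_op_zero: "bounded_hardy_op (\<lambda>h z. 0)"
  unfolding bounded_hardy_op_def
  using hardy_space_zero by (auto simp: hardy_norm_zero intro!: exI[of _ 0])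

text \<open>The constant 1 in the representation by functions vanishing off the ball; multiplying a
  polynomial by it gives an element of \<open>hardy_space\<close>.\<close>

definition ball_one :: "complex^'n \<Rightarrow> complex" where
  "ball_one z = (if z \<in> ball 0 1 then 1 else 0)"

lemma ball_one_hardy: "(ball_one :: complex^'n \<Rightarrow> complex) \<in> hardy_space"
proof (rule hardy_spaceI)
  have "analytic_on_ball (ball_one :: complex^'n \<Rightarrow> complex)"
    by (rule analytic_on_ball_cong[OF _ analytic_on_ball_const[of 1]]) (simp add: ball_one_def)
  then show "ball_analytic (ball_one :: complex^'n \<Rightarrow> complex)"
    by (simp add: ball_analytic_def ball_one_def)
  fix r :: real assume r: "0 < r" "r < 1"
  have "dilate_mean (ball_one :: complex^'n \<Rightarrow> complex) r = (LINT z|(sphere_measure :: (complex^'n) measure). 1)"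
    unfolding dilate_mean_def
    by (rule Bochner_Integration.integral_cong) (use r in \<open>auto simp: dilate_def ball_one_def\<close>)
  also have "\<dots> = 1" by (simp add: measure_def emeasure_sphere_measure_sphere)
  finally show "dilate_mean (ball_one :: complex^'n \<Rightarrow> complex) r \<le> 1" by simp
qed

lemma radial_limit_ball_one:
  assumes "norm z = 1" shows "radial_limit ball_one z = 1"
proof (rule radial_limit_eq)
  have "\<forall>\<^sub>F r in at_left (1::real). ball_one (r *\<^sub>R z) = 1"
    unfolding eventually_at_left_field using assms by (intro exI[of _ 0]) (auto simp: ball_one_def)
  then show "((\<lambda>r. ball_one (r *\<^sub>R z)) \<longlongrightarrow> 1) (at_left 1)" by (rule tendsto_eventually)
qed

section \<open>Powers of a linear functional and their mass near its maximum\<close>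

lemma analytic_on_ball_power: "analytic_on_ball p \<Longrightarrow> analytic_on_ball (\<lambda>z. p z ^ k)"
  by (induction k) (auto intro: analytic_on_ball_const analytic_on_ball_mult)

lemma analytic_on_ball_cinner: "analytic_on_ball (\<lambda>z. cinner z w)"
  by (rule analytic_on_ball_clinear) (simp add: clinear_iff cinner_add_left cinner_scale_left)

lemma measurable_sphere_continuous:
  "continuous_on UNIV f \<Longrightarrow> f \<in> borel_measurable sphere_measure"
  by (intro measurable_sphere_measure borel_measurable_continuous_onI)

text \<open>The squared norm of the \<open>k\<close>-th power of the functional
  \<open>cinner z w\<close> in the Hardy space.\<close>

definition peak_mass :: "complex^'n \<Rightarrow> nat \<Rightarrow> real" where
  "peak_mass w k = (LINT z|sphere_measure. ((cmod (cinner z w))\<^sup>2) ^ k)"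

lemma cinner_sq_le_1: "norm z = 1 \<Longrightarrow> norm w = 1 \<Longrightarrow> (cmod (cinner z w))\<^sup>2 \<le> 1"
  using norm_cinner_le[of z w] by (simp add: power_le_one)

lemma integrable_peak:
  assumes "norm w = 1"
  shows "integrable sphere_measure (\<lambda>z. ((cmod (cinner z w))\<^sup>2) ^ k)"
  by (rule integrable_sphere_bounded[where K = 1], intro measurable_sphere_continuous continuous_intros)
     (use cinner_sq_le_1[OF _ assms] in \<open>auto intro: power_le_one\<close>)

text \<open>The condition \<open>q * (norm z)\<^sup>2 < (cmod (cinner z w))\<^sup>2\<close> is open
  and homogeneous, and it holds at half of \<open>w\<close>; the cone over the cap therefore
  contains a ball.\<close>

lemma sphere_cap_measure_pos:
  fixes w :: "complex^'n"
  assumes w: "norm w = 1" and q: "0 \<le> q" "q < 1"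
  shows "0 < measure sphere_measure {z \<in> sphere 0 1. q < (cmod (cinner z w))\<^sup>2}"
proof -
  define E where "E = {z \<in> sphere 0 1. q < (cmod (cinner z w))\<^sup>2}"
  have E: "E \<in> sets borel" "E \<subseteq> sphere 0 1"
  proof -
    have "open {z. q < (cmod (cinner z w))\<^sup>2}" by (intro open_Collect_less continuous_intros)
    then have "sphere 0 1 \<inter> {z. q < (cmod (cinner z w))\<^sup>2} \<in> sets borel" by (intro sets.Int) auto
    then show "E \<in> sets borel" by (simp add: E_def Int_def)
  qed (auto simp: E_def)
  define W where "W = {z. q * (norm z)\<^sup>2 < (cmod (cinner z w))\<^sup>2} \<inter> ball 0 1"
  have "open W" unfolding W_def by (intro open_Int open_Collect_less continuous_intros open_ball)
  moreover have "(1/2) *s w \<in> W"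
    using w q by (auto simp: W_def cinner_scale_left norm_cscale cinner_self norm_mult norm_divide power_divide power_mult_distrib)
  ultimately obtain r where r: "0 < r" "ball ((1/2) *s w) r \<subseteq> W" using open_contains_ball by blast
  have sub: "ball ((1/2) *s w) r \<subseteq> {z \<in> ball 0 1. sgn z \<in> E}"
  proof
    fix z assume "z \<in> ball ((1/2) *s w) r"
    then have z: "z \<in> W" using r by blast
    have z0: "z \<noteq> 0" using z by (auto simp: W_def cinner_def)
    have "sgn z = (1 / complex_of_real (norm z)) *s z"
      by (simp add: sgn_div_norm of_real_cscale[symmetric] inverse_eq_divide)
    then have "(cmod (cinner (sgn z) w))\<^sup>2 = (cmod (cinner z w))\<^sup>2 / (norm z)\<^sup>2"
      using z0 by (simp add: cinner_scale_left norm_mult norm_divide power_mult_distrib power_divide)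
    also have "\<dots> > q" using z z0 by (simp add: W_def pos_less_divide_eq)
    finally show "z \<in> {z \<in> ball 0 1. sgn z \<in> E}" using z z0 by (simp add: E_def W_def norm_sgn)
  qed
  have "0 < emeasure lborel (ball ((1/2) *s w) r)"
    using r by (simp add: emeasure_ball unit_ball_vol_pos ennreal_zero_less_mult_iff zero_less_power)
  also have "\<dots> \<le> emeasure lborel {z \<in> ball 0 1. sgn z \<in> E}"
  proof (rule emeasure_mono[OF sub])
    have "ball 0 1 \<inter> sgn -` E \<in> sets borel"
      using measurable_sets[OF borel_measurable_sgn_vec E(1)] by (intro sets.Int) auto
    then show "{z \<in> ball 0 1. sgn z \<in> E} \<in> sets lborel" by (simp add: Int_def vimage_def)
  qed
  finally have "0 < emeasure sphere_measure E"
    unfolding emeasure_sphere_measure[OF E] using ball_vol_finite_pos[where 'a = "complex^'n"]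
    by (simp add: ennreal_zero_less_divide less_top)
  then show ?thesis
    unfolding E_def[symmetric] measure_def
    using finite_measure.emeasure_finite[OF finite_measure_sphere_measure, of E]
    by (simp add: enn2real_positive_iff less_top)
qed

text \<open>Markov's inequality on the cap; positivity of the mass is the case
  \<open>q = 1/2\<close>.\<close>

lemma
  assumes w: "norm w = 1"
  shows peak_mass_pos: "0 < peak_mass w k"
    and peak_mass_ge: "0 \<le> q \<Longrightarrow> q < 1 \<Longrightarrow> q ^ k * measure sphere_measure {z \<in> sphere 0 1. q < (cmod (cinner z w))\<^sup>2} \<le> peak_mass w k"
proof -
  have ge: "q ^ k * measure sphere_measure {z \<in> sphere 0 1. q < (cmod (cinner z w))\<^sup>2} \<le> peak_mass w k" if q: "0 \<le> q" "q < 1" for q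
  proof -
    define E where "E = {z \<in> sphere 0 1. q < (cmod (cinner z w))\<^sup>2}"
    have "open {z. q < (cmod (cinner z w))\<^sup>2}" by (intro open_Collect_less continuous_intros)
    then have "sphere 0 1 \<inter> {z. q < (cmod (cinner z w))\<^sup>2} \<in> sets (restrict_space borel (sphere 0 1))"
      by (auto simp: sets_restrict_space)
    then have E: "E \<in> sets sphere_measure" by (simp add: E_def sets_sphere_measure Int_def)
    have ES: "E \<inter> sphere 0 1 = E" by (auto simp: E_def)
    have fin: "emeasure sphere_measure E < top"
      using finite_measure.emeasure_finite[OF finite_measure_sphere_measure, of E] by (simp add: less_top)
    have "q ^ k * measure sphere_measure E = (LINT z|sphere_measure. q ^ k * indicator E z)"
      using E fin ES by simp
    also have "\<dots> \<le> peak_mass w k"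
      unfolding peak_mass_def
    proof (rule integral_mono)
      show "integrable sphere_measure (\<lambda>z. q ^ k * indicator E z)"
        using E fin by simp
      show "q ^ k * indicator E z \<le> ((cmod (cinner z w))\<^sup>2) ^ k" for z
        using q by (auto simp: indicator_def E_def intro!: power_mono)
    qed (rule integrable_peak[OF w])
    finally show ?thesis unfolding E_def .
  qed
  then show "0 \<le> q \<Longrightarrow> q < 1 \<Longrightarrow> q ^ k * measure sphere_measure {z \<in> sphere 0 1. q < (cmod (cinner z w))\<^sup>2} \<le> peak_mass w k" .
  have "0 < (1/2) ^ k * measure sphere_measure {z \<in> sphere 0 1. 1/2 < (cmod (cinner z w))\<^sup>2}"
    by (intro mult_pos_pos sphere_cap_measure_pos w) auto
  also have "\<dots> \<le> peak_mass w k" by (rule ge) auto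
  finally show "0 < peak_mass w k" .
qed

text \<open>
  If the ratios of consecutive masses stayed below \<open>1 - \<eta>\<close>, the masses would decay faster than the
  mass of a cap allows.
\<close>

lemma peak_concentration:
  assumes w: "norm w = 1" and eta: "0 < \<eta>"
  obtains k where "peak_mass w k - peak_mass w (Suc k) \<le> \<eta> * peak_mass w k"
proof (rule ccontr)
  assume "\<not> thesis"
  then have H: "\<eta> * peak_mass w k < peak_mass w k - peak_mass w (Suc k)" for k
    using that[of k] \<open>\<not> thesis\<close> by (meson not_le)
  define e where "e = min \<eta> (1/2)"
  have e: "0 < e" "e < 1" "e \<le> \<eta>" using eta by (auto simp: e_def)
  have step: "peak_mass w (Suc k) \<le> (1 - e) * peak_mass w k" for k
    using H[of k] mult_right_mono[OF e(3) less_imp_le[OF peak_mass_pos[OF w]], of k] by (simp add: algebra_simps)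
  have up: "peak_mass w k \<le> (1 - e) ^ k * peak_mass w 0" for k
  proof (induction k)
    case (Suc k)
    have "peak_mass w (Suc k) \<le> (1 - e) * peak_mass w k" by (rule step)
    also have "\<dots> \<le> (1 - e) * ((1 - e) ^ k * peak_mass w 0)" using e by (intro mult_left_mono Suc.IH) auto
    finally show ?case by (simp add: mult.assoc)
  qed simp
  \<comment> \<open>Strictly between \<open>1 - e\<close> and 1: the cap still has positive measure,
    while the powers of \<open>(1 - e) / q\<close> tend to 0.\<close>
  define q where "q = 1 - e / 2"
  define p where "p = measure sphere_measure {z \<in> sphere 0 1. q < (cmod (cinner z w))\<^sup>2}"
  have q: "0 < q" "q < 1" using e by (auto simp: q_def)
  have p: "0 < p" unfolding p_def by (rule sphere_cap_measure_pos[OF w]) (use q in auto)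
  have "p \<le> ((1 - e) / q) ^ k * peak_mass w 0" for k
  proof -
    have "q ^ k * p \<le> (1 - e) ^ k * peak_mass w 0"
      using peak_mass_ge[OF w, of q k] up[of k] q by (simp add: p_def)
    then show ?thesis using q by (simp add: power_divide field_simps)
  qed
  moreover have "(\<lambda>k. ((1 - e) / q) ^ k * peak_mass w 0) \<longlonglongrightarrow> 0 * peak_mass w 0"
    using e q by (intro tendsto_mult LIMSEQ_realpow_zero tendsto_const) (auto simp: q_def)
  ultimately have "p \<le> 0 * peak_mass w 0" by (intro LIMSEQ_le_const) auto
  then show False using p by simp
qed

section \<open>Boundedness, and sufficiency of the spectral condition\<close>

context linear_contraction
begin

lemma A_scale: "A (c *s z) = c *s A z" and A_add: "A (x + y) = A x + A y"
proof -
  interpret Vector_Spaces.linear "(*s)" "(*s)" A by (rule lin)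
  show "A (c *s z) = c *s A z" "A (x + y) = A x + A y"
    by (rule scale, rule add)
qed

lemma bounded_hardy_op_composition: "bounded_hardy_op (composition_op A)"
  unfolding bounded_hardy_op_def
proof (intro conjI ballI allI exI[of _ 1])
  show "composition_op A h \<in> hardy_space" if "h \<in> hardy_space" for h
    by (rule contraction_composition_hardy(1)[OF lin contr that])
  show "hardy_norm (composition_op A h) \<le> 1 * hardy_norm h" if "h \<in> hardy_space" for h
    using contraction_composition_hardy(2)[OF lin contr that] by simp
qed (auto simp: composition_op_def fun_eq_iff)

lemma shift_power:
  assumes "h \<in> hardy_space"
  shows "(toeplitz_shift ^^ m) (composition_op A) h = hardy_projection (\<lambda>\<zeta>. symb \<zeta> ^ m * radial_limit (composition_op A h) \<zeta>)"
    and "sq_integrable (\<lambda>\<zeta>. symb \<zeta> ^ m * radial_limit (composition_op A h) \<zeta>)"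
  using toeplitz_shift_power_composition[OF contraction_composition_hardy(1)[OF lin contr] assms]
    sq_integrable_symb_power[OF sq_integrable_radial_limit[OF contraction_composition_hardy(1)[OF lin contr assms]]]
  by auto

text \<open>The equality case of Cauchy-Schwarz, read off by expanding the square of the difference:
  it is at most 1 + 1 - 2.\<close>

lemma unimodular_symb_eigenvector:
  assumes z: "norm z = 1" and s: "cmod (symb z) = 1"
  shows "A z = symb z *s z"
proof -
  have "(norm (A z - symb z *s z))\<^sup>2 = (norm (A z))\<^sup>2 + (norm (symb z *s z))\<^sup>2 - 2 * Re (cinner (A z) (symb z *s z))"
    by (rule norm_diff_sq)
  also have "norm (symb z *s z) = 1" using z s by (simp add: norm_cscale)
  also have "cinner (A z) (symb z *s z) = cnj (symb z) * symb z" by (simp add: cinner_scale_right symb_def)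
  also have "\<dots> = 1" using s complex_norm_square[of "symb z"] by (simp add: mult.commute)
  also have "(norm (A z))\<^sup>2 \<le> 1" using contr[of z] z by (simp add: power_le_one)
  finally have "(norm (A z - symb z *s z))\<^sup>2 \<le> 0" by simp
  then show ?thesis by simp
qed

lemma uat_if_spectrum_inside:
  assumes ev: "\<And>c v. v \<noteq> 0 \<Longrightarrow> A v = c *s v \<Longrightarrow> cmod c < 1"
  shows "uniformly_asymptotically_toeplitz (composition_op A)"
proof -
  \<comment> \<open>Compactness of the sphere turns the pointwise strict bound on the symbol into a
    uniform \<open>q < 1\<close>.\<close>
  obtain z0 where z0: "z0 \<in> sphere 0 1" "\<And>z. z \<in> sphere 0 1 \<Longrightarrow> cmod (symb z) \<le> cmod (symb z0)"
  proof -
    have "axis undefined 1 \<in> sphere (0 :: complex^'n) 1" by (simp add: norm_axis_1)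
    then have ne: "sphere (0 :: complex^'n) 1 \<noteq> {}" by blast
    have "continuous_on (sphere 0 1) (\<lambda>z. cmod (symb z))" by (intro continuous_intros continuous_symb)
    from continuous_attains_sup[OF _ ne this] that show ?thesis by (auto simp: compact_sphere)
  qed
  define q where "q = cmod (symb z0)"
  have q0: "0 \<le> q" by (simp add: q_def)
  have q1: "q < 1"
  proof (rule ccontr)
    assume "\<not> q < 1"
    then have s: "cmod (symb z0) = 1" using norm_symb_le[of z0] z0(1) by (simp add: q_def)
    have "A z0 = symb z0 *s z0" by (rule unimodular_symb_eigenvector) (use z0 s in auto)
    moreover have "z0 \<noteq> 0" using z0 by auto
    ultimately show False using ev[of z0 "symb z0"] s by simp
  qed
  have bound: "hardy_op_norm (\<lambda>h z. (toeplitz_shift ^^ m) (composition_op A) h z - 0) \<le> ennreal (q ^ m)" for m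
    unfolding hardy_op_norm_def
  proof (rule SUP_least)
    fix h :: "complex^'n \<Rightarrow> complex" assume "h \<in> {h \<in> hardy_space. hardy_norm h \<le> 1}"
    then have h: "h \<in> hardy_space" "hardy_norm h \<le> 1" by auto
    note Ch = contraction_composition_hardy[OF lin contr h(1)]
    let ?r = "radial_limit (composition_op A h)"
    have "(hardy_norm ((toeplitz_shift ^^ m) (composition_op A) h))\<^sup>2 \<le> l2_norm_sq (\<lambda>\<zeta>. symb \<zeta> ^ m * ?r \<zeta>)"
      unfolding shift_power(1)[OF h(1)] by (rule hardy_norm_projection_le[OF shift_power(2)[OF h(1)]])
    also have "\<dots> \<le> (LINT z|sphere_measure. (q ^ m)\<^sup>2 * (cmod (?r z))\<^sup>2)"
      unfolding l2_norm_sq_def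
    proof (rule integral_mono)
      show "integrable sphere_measure (\<lambda>z. (cmod (symb z ^ m * ?r z))\<^sup>2)"
        using shift_power(2)[OF h(1)] by (simp add: sq_integrable_def)
      show "integrable sphere_measure (\<lambda>z. (q ^ m)\<^sup>2 * (cmod (?r z))\<^sup>2)"
        using sq_integrable_radial_limit[OF Ch(1)] by (simp add: sq_integrable_def)
      fix z :: "complex^'n" assume "z \<in> space sphere_measure"
      then have "cmod (symb z) ^ m \<le> q ^ m" using z0(2)[of z] by (intro power_mono) (auto simp: q_def)
      then have "(cmod (symb z) ^ m)\<^sup>2 \<le> (q ^ m)\<^sup>2" by (rule power_mono) simp
      then show "(cmod (symb z ^ m * ?r z))\<^sup>2 \<le> (q ^ m)\<^sup>2 * (cmod (?r z))\<^sup>2"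
        by (simp add: norm_mult norm_power power_mult_distrib mult_right_mono)
    qed
    also have "\<dots> = (q ^ m)\<^sup>2 * (hardy_norm (composition_op A h))\<^sup>2"
      by (simp add: hardy_norm_power2[OF Ch(1)] l2_norm_sq_def)
    also have "\<dots> \<le> (q ^ m)\<^sup>2 * 1"
      using Ch(2) h(2) hardy_norm_nonneg[of "composition_op A h"] by (intro mult_left_mono power_le_one) auto
    finally have "hardy_norm ((toeplitz_shift ^^ m) (composition_op A) h) \<le> q ^ m"
      using q0 by (auto intro: power2_le_imp_le)
    then show "ennreal (hardy_norm (\<lambda>z. (toeplitz_shift ^^ m) (composition_op A) h z - 0)) \<le> ennreal (q ^ m)"
      by (simp add: ennreal_leI)
  qed
  have "(\<lambda>m. ennreal (q ^ m)) \<longlonglongrightarrow> ennreal 0"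
    by (intro tendsto_ennrealI LIMSEQ_realpow_zero q0 q1)
  then have lim: "(\<lambda>m. ennreal (q ^ m)) \<longlonglongrightarrow> 0" by simp
  have "(\<lambda>m. hardy_op_norm (\<lambda>h z. (toeplitz_shift ^^ m) (composition_op A) h z - 0)) \<longlonglongrightarrow> 0"
  proof (rule tendsto_sandwich[OF _ _ tendsto_const lim])
    show "\<forall>\<^sub>F m in sequentially. 0 \<le> hardy_op_norm (\<lambda>h z. (toeplitz_shift ^^ m) (composition_op A) h z - 0)"
      by (rule always_eventually) simp
    show "\<forall>\<^sub>F m in sequentially. hardy_op_norm (\<lambda>h z. (toeplitz_shift ^^ m) (composition_op A) h z - 0) \<le> ennreal (q ^ m)"
      by (rule always_eventually, rule allI, rule bound)
  qed
  then have "bounded_hardy_op (\<lambda>h z. 0) \<and> (\<lambda>m. hardy_op_norm (\<lambda>h z. (toeplitz_shift ^^ m) (composition_op A) h z - (\<lambda>h z. 0) h z)) \<longlonglongrightarrow> 0"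
    using bounded_hardy_op_zero by (intro conjI)
  then show ?thesis
    unfolding uniformly_asymptotically_toeplitz_def
    by (intro conjI[OF bounded_hardy_op_composition] exI[of _ "\<lambda>h z. 0"])
qed

end

section \<open>Necessity of the spectral condition\<close>

context linear_contraction
begin

text \<open>\<open>M\<close> does not depend on \<open>h\<close> and \<open>g\<close>, which is
  where convergence in operator norm enters. The projection disappears because \<open>g\<close> lies
  in the Hardy space, and the unknown limit \<open>L\<close> by the triangle inequality.\<close>

lemma uat_Cauchy:
  assumes uat: "uniformly_asymptotically_toeplitz (composition_op A)" and \<delta>: "0 < \<delta>"
  obtains M where "\<And>m m' h g. M \<le> m \<Longrightarrow> M \<le> m' \<Longrightarrow> h \<in> hardy_space \<Longrightarrow> hardy_norm h \<le> 1 \<Longrightarrow> g \<in> hardy_space \<Longrightarrow> hardy_norm g \<le> 1 \<Longrightarrow>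
    cmod (l2_inner (\<lambda>\<zeta>. symb \<zeta> ^ m * radial_limit (composition_op A h) \<zeta>) (radial_limit g)
        - l2_inner (\<lambda>\<zeta>. symb \<zeta> ^ m' * radial_limit (composition_op A h) \<zeta>) (radial_limit g)) \<le> 2 * \<delta>"
proof -
  obtain L where L: "bounded_hardy_op L"
    "(\<lambda>m. hardy_op_norm (\<lambda>h z. (toeplitz_shift ^^ m) (composition_op A) h z - L h z)) \<longlonglongrightarrow> 0"
    using uat unfolding uniformly_asymptotically_toeplitz_def by blast
  have "(0 :: ennreal) < ennreal \<delta>" using \<delta> by simp
  from order_tendstoD(2)[OF L(2) this]
  obtain M where M: "\<And>m. M \<le> m \<Longrightarrow> hardy_op_norm (\<lambda>h z. (toeplitz_shift ^^ m) (composition_op A) h z - L h z) < ennreal \<delta>"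
    unfolding eventually_sequentially by blast
  have close: "cmod (l2_inner (\<lambda>\<zeta>. symb \<zeta> ^ m * radial_limit (composition_op A h) \<zeta>) (radial_limit g) - l2_inner (radial_limit (L h)) (radial_limit g)) \<le> \<delta>"
    if m: "M \<le> m" and h: "h \<in> hardy_space" "hardy_norm h \<le> 1" and g: "g \<in> hardy_space" "hardy_norm g \<le> 1" for m h g
  proof -
    let ?P = "(toeplitz_shift ^^ m) (composition_op A) h"
    have Lh: "L h \<in> hardy_space" using L(1) h(1) by (simp add: bounded_hardy_op_def)
    have P: "?P \<in> hardy_space" unfolding shift_power(1)[OF h(1)] by (rule hardy_projection(1)[OF shift_power(2)[OF h(1)]])
    note sP = sq_integrable_radial_limit[OF P] and sL = sq_integrable_radial_limit[OF Lh] and sg = sq_integrable_radial_limit[OF g(1)]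
    have "ennreal (hardy_norm (\<lambda>z. ?P z - L h z)) \<le> hardy_op_norm (\<lambda>h z. (toeplitz_shift ^^ m) (composition_op A) h z - L h z)"
      unfolding hardy_op_norm_def by (rule SUP_upper) (use h in simp)
    also have "\<dots> < ennreal \<delta>" by (rule M[OF m])
    finally have "hardy_norm (\<lambda>z. ?P z - L h z) \<le> \<delta>" using \<delta> by (simp add: ennreal_less_iff hardy_norm_nonneg)
    then have "(hardy_norm (\<lambda>z. ?P z - L h z))\<^sup>2 \<le> \<delta>\<^sup>2" by (intro power_mono hardy_norm_nonneg)
    then have "l2_norm_sq (\<lambda>z. radial_limit ?P z - radial_limit (L h) z) \<le> \<delta>\<^sup>2"
      by (simp only: l2_norm_sq_radial_diff[OF P Lh])
    from l2_inner_le_norms[OF sq_integrable_diff[OF sP sL] g(1) this less_imp_le[OF \<delta>]]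
    have "cmod (l2_inner (\<lambda>z. radial_limit ?P z - radial_limit (L h) z) (radial_limit g)) \<le> \<delta> * hardy_norm g" .
    also have "\<dots> \<le> \<delta> * 1" using g(2) \<delta> by (intro mult_left_mono) auto
    also have "l2_inner (\<lambda>z. radial_limit ?P z - radial_limit (L h) z) (radial_limit g)
        = l2_inner (radial_limit ?P) (radial_limit g) - l2_inner (radial_limit (L h)) (radial_limit g)"
      by (rule l2_inner_diff_left[OF sP sL sg])
    also have "l2_inner (radial_limit ?P) (radial_limit g) = l2_inner (\<lambda>\<zeta>. symb \<zeta> ^ m * radial_limit (composition_op A h) \<zeta>) (radial_limit g)"
      unfolding shift_power(1)[OF h(1)] by (rule hardy_projection(2)[OF shift_power(2)[OF h(1)] g(1)])
    finally show ?thesis by simp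
  qed
  show ?thesis
  proof (rule that[of M])
    fix m m' :: nat and h g :: "complex^'n \<Rightarrow> complex"
    assume "M \<le> m" "M \<le> m'" "h \<in> hardy_space" "hardy_norm h \<le> 1" "g \<in> hardy_space" "hardy_norm g \<le> 1"
    then show "cmod (l2_inner (\<lambda>\<zeta>. symb \<zeta> ^ m * radial_limit (composition_op A h) \<zeta>) (radial_limit g)
        - l2_inner (\<lambda>\<zeta>. symb \<zeta> ^ m' * radial_limit (composition_op A h) \<zeta>) (radial_limit g)) \<le> 2 * \<delta>"
      using close[of m h g] close[of m' h g]
        norm_triangle_ineq4[of "l2_inner (\<lambda>\<zeta>. symb \<zeta> ^ m * radial_limit (composition_op A h) \<zeta>) (radial_limit g) - l2_inner (radial_limit (L h)) (radial_limit g)"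
          "l2_inner (\<lambda>\<zeta>. symb \<zeta> ^ m' * radial_limit (composition_op A h) \<zeta>) (radial_limit g) - l2_inner (radial_limit (L h)) (radial_limit g)"]
      by simp
  qed
qed

text \<open>A unimodular eigenvector of a contraction spans a reducing subspace.\<close>

lemma cinner_unimodular_eigenvector:
  assumes w: "norm w = 1" and ev: "A w = c *s w" "cmod c = 1"
  shows "cinner (A z) w = c * cinner z w"
proof -
  let ?B = "matrix A"
  have B: "?B \<in> contractions" using contr by (simp add: contractions_def matrix_works[OF lin])
  let ?S = "adjoint_matrix ?B"
  have cc: "c * cnj c = 1" using ev(2) by (simp add: complex_norm_square[symmetric])
  \<comment> \<open>The claim behind this expansion is that \<open>w\<close> is an eigenvector of
    the adjoint with eigenvalue \<open>cnj c\<close>: the square is at most 1 + 1 - 2.\<close>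
  have "(norm (?S *v w - cnj c *s w))\<^sup>2 = (norm (?S *v w))\<^sup>2 + (norm (cnj c *s w))\<^sup>2 - 2 * Re (cinner (?S *v w) (cnj c *s w))"
    by (rule norm_diff_sq)
  also have "cinner (?S *v w) (cnj c *s w) = c * cnj c * cinner w w"
    by (simp add: cinner_scale_right cinner_adjoint_matrix' matrix_works[OF lin] ev(1))
  also have "\<dots> = 1" by (simp add: cc cinner_self w)
  also have "norm (cnj c *s w) = 1" by (simp add: norm_cscale ev w)
  also have "(norm (?S *v w))\<^sup>2 \<le> 1" using norm_adjoint_le[OF B, of w] w by (simp add: power_le_one)
  finally have "(norm (?S *v w - cnj c *s w))\<^sup>2 \<le> 0" by simp
  then have "?S *v w = cnj c *s w" by simp
  moreover have "cinner (A z) w = cinner z (?S *v w)"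
    using cinner_adjoint_matrix[of ?B z w] by (simp add: matrix_works[OF lin])
  ultimately show ?thesis by (simp add: cinner_scale_right)
qed

text \<open>Write \<open>z = u *s w + y\<close> with \<open>y\<close> orthogonal to
  \<open>w\<close>. The mixed terms vanish because \<open>A\<close> preserves this orthogonality,
  leaving \<open>c\<close> times the square of \<open>cmod u\<close> plus
  \<open>cinner (A y) y\<close>; replacing the former by \<open>c\<close> and dropping the latter
  costs \<open>1 - (cmod u)\<^sup>2\<close> each.\<close>

lemma symb_near_eigenvector:
  assumes w: "norm w = 1" and ev: "A w = c *s w" "cmod c = 1" and z: "norm z = 1"
  shows "cmod (symb z - c) \<le> 2 * (1 - (cmod (cinner z w))\<^sup>2)"
proof -
  define u where "u = cinner z w"
  define y where "y = z - u *s w"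
  have zy: "z = u *s w + y" by (simp add: y_def)
  have uu: "complex_of_real ((cmod u)\<^sup>2) = u * cnj u" by (rule complex_norm_square)
  have yw: "cinner y w = 0" by (simp add: y_def cinner_diff_left cinner_scale_left cinner_self w u_def)
  have ny: "(norm y)\<^sup>2 = 1 - (cmod u)\<^sup>2"
  proof -
    have "(norm y)\<^sup>2 = (norm z)\<^sup>2 + (norm (u *s w))\<^sup>2 - 2 * Re (cinner z (u *s w))"
      unfolding y_def by (rule norm_diff_sq)
    also have "cinner z (u *s w) = complex_of_real ((cmod u)\<^sup>2)"
      unfolding uu by (simp add: cinner_scale_right u_def mult.commute)
    finally show ?thesis by (simp add: z norm_cscale w)
  qed
  have wz: "cinner w z = cnj u" unfolding u_def by (rule cinner_commute)
  have Ay: "cinner (A y) w = 0" by (simp add: cinner_unimodular_eigenvector[OF w ev] yw)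
  have "symb z = cinner (u *s (c *s w) + A y) z"
    unfolding symb_def by (subst (1) zy) (simp only: A_add A_scale ev(1))
  also have "\<dots> = c * (u * cnj u) + cinner (A y) z" by (simp add: cinner_add_left cinner_scale_left wz)
  also have "cinner (A y) z = cinner (A y) y"
    by (subst zy) (simp add: cinner_add_right cinner_scale_right Ay)
  finally have "symb z - c = c * complex_of_real ((cmod u)\<^sup>2 - 1) + cinner (A y) y"
    by (simp add: algebra_simps flip: uu)
  then have "cmod (symb z - c) \<le> cmod (c * complex_of_real ((cmod u)\<^sup>2 - 1)) + cmod (cinner (A y) y)"
    by (simp only: norm_triangle_ineq)
  also have "cmod (c * complex_of_real ((cmod u)\<^sup>2 - 1)) = 1 - (cmod u)\<^sup>2"
  proof -
    have "(cmod u)\<^sup>2 \<le> 1" unfolding u_def by (rule cinner_sq_le_1[OF z w])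
    then show ?thesis by (simp only: norm_mult ev(2) norm_of_real) simp
  qed
  also have "cmod (cinner (A y) y) \<le> 1 - (cmod u)\<^sup>2"
  proof -
    have "cmod (cinner (A y) y) \<le> norm y * norm y"
      by (rule order_trans[OF norm_cinner_le mult_right_mono[OF contr]]) simp
    also have "\<dots> = 1 - (cmod u)\<^sup>2" by (simp only: ny flip: power2_eq_square)
    finally show ?thesis .
  qed
  finally show ?thesis by (simp add: u_def)
qed

text \<open>Up to normalization and the unimodular factor \<open>c ^ k\<close>, the diagonal matrix
  coefficient of the \<open>m\<close>-th iterate at the \<open>k\<close>-th power of
  \<open>cinner z w\<close>, for \<open>w\<close> a unimodular eigenvector.\<close>

definition symb_moment :: "complex^'n \<Rightarrow> nat \<Rightarrow> nat \<Rightarrow> complex" where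
  "symb_moment w k m = (LINT z|sphere_measure. symb z ^ m * complex_of_real (((cmod (cinner z w))\<^sup>2) ^ k))"

lemma integrable_symb_moment:
  assumes w: "norm w = 1"
  shows "integrable sphere_measure (\<lambda>z. symb z ^ m * complex_of_real (((cmod (cinner z w))\<^sup>2) ^ k))"
proof (rule integrable_sphere_bounded[where K = 1])
  show "(\<lambda>z. symb z ^ m * complex_of_real (((cmod (cinner z w))\<^sup>2) ^ k)) \<in> borel_measurable sphere_measure"
    by (intro measurable_sphere_continuous continuous_intros continuous_symb)
  fix z :: "complex^'n" assume z: "norm z = 1"
  have "cmod (symb z) ^ m * ((cmod (cinner z w))\<^sup>2) ^ k \<le> 1 * 1"
    using norm_symb_le[OF z] norm_cinner_le[of z w] z w by (intro mult_mono power_le_one) auto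
  then show "norm (symb z ^ m * complex_of_real (((cmod (cinner z w))\<^sup>2) ^ k)) \<le> 1"
    by (simp add: norm_mult norm_power)
qed

text \<open>Taking \<open>m\<close>-th powers multiplies the deviation of \<open>symb\<close> from
  \<open>c\<close> by at most \<open>m\<close>, and the factor
  \<open>1 - (cmod (cinner z w))\<^sup>2\<close> in that deviation turns the mass into a difference
  of consecutive masses.\<close>

lemma symb_moment_near:
  assumes w: "norm w = 1" and ev: "A w = c *s w" "cmod c = 1"
  shows "cmod (symb_moment w k m - c ^ m * complex_of_real (peak_mass w k)) \<le> 2 * real m * (peak_mass w k - peak_mass w (Suc k))"
proof -
  let ?t = "\<lambda>z. (cmod (cinner z w))\<^sup>2"
  have i: "integrable sphere_measure (\<lambda>z. c ^ m * complex_of_real (?t z ^ k))"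
    using integrable_peak[OF w, of k] by (intro integrable_mult_right integrable_of_real)
  have "symb_moment w k m - c ^ m * complex_of_real (peak_mass w k)
     = (LINT z|sphere_measure. symb z ^ m * complex_of_real (?t z ^ k) - c ^ m * complex_of_real (?t z ^ k))"
    unfolding symb_moment_def peak_mass_def
    by (simp only: Bochner_Integration.integral_diff[OF integrable_symb_moment[OF w] i]
        integral_mult_right_zero integral_complex_of_real)
  then have "cmod (symb_moment w k m - c ^ m * complex_of_real (peak_mass w k))
     \<le> (LINT z|sphere_measure. cmod (symb z ^ m * complex_of_real (?t z ^ k) - c ^ m * complex_of_real (?t z ^ k)))"
    by (simp only: integral_norm_bound)
  also have "\<dots> \<le> (LINT z|sphere_measure. 2 * real m * (?t z ^ k - ?t z ^ Suc k))"
  proof (rule integral_mono)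
    show "integrable sphere_measure (\<lambda>z. cmod (symb z ^ m * complex_of_real (?t z ^ k) - c ^ m * complex_of_real (?t z ^ k)))"
      by (intro integrable_norm Bochner_Integration.integrable_diff integrable_symb_moment w i)
    show "integrable sphere_measure (\<lambda>z. 2 * real m * (?t z ^ k - ?t z ^ Suc k))"
      by (intro integrable_mult_right Bochner_Integration.integrable_diff integrable_peak w)
    fix z :: "complex^'n" assume "z \<in> space sphere_measure"
    then have z: "norm z = 1" by simp
    have "cmod (symb z ^ m - c ^ m) \<le> real m * cmod (symb z - c)"
      by (rule norm_power_diff) (use norm_symb_le[OF z] ev in auto)
    also have "\<dots> \<le> real m * (2 * (1 - ?t z))" by (intro mult_left_mono symb_near_eigenvector w ev z) simp
    finally have le: "cmod (symb z ^ m - c ^ m) \<le> real m * (2 * (1 - ?t z))" .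
    have "cmod (symb z ^ m * complex_of_real (?t z ^ k) - c ^ m * complex_of_real (?t z ^ k)) = cmod (symb z ^ m - c ^ m) * ?t z ^ k"
      by (simp only: left_diff_distrib[symmetric] norm_mult norm_of_real) simp
    also have "\<dots> \<le> real m * (2 * (1 - ?t z)) * ?t z ^ k" by (rule mult_right_mono[OF le]) simp
    finally show "cmod (symb z ^ m * complex_of_real (?t z ^ k) - c ^ m * complex_of_real (?t z ^ k)) \<le> 2 * real m * (?t z ^ k - ?t z ^ Suc k)"
      by (simp add: algebra_simps)
  qed
  also have "\<dots> = 2 * real m * (peak_mass w k - peak_mass w (Suc k))"
    unfolding peak_mass_def using integrable_peak[OF w, of k] integrable_peak[OF w, of "Suc k"] by (simp del: power_Suc)
  finally show ?thesis .
qed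

text \<open>\<open>uat_Cauchy\<close> is tested on the normalized powers of
  \<open>cinner z w\<close>. That \<open>M\<close> serves all \<open>k\<close> simultaneously is the
  point, since \<open>k\<close> will be chosen after \<open>M\<close>.\<close>

lemma uat_symb_moment_Cauchy:
  assumes uat: "uniformly_asymptotically_toeplitz (composition_op A)" and \<delta>: "0 < \<delta>"
    and w: "norm w = 1" and ev: "A w = c *s w" "cmod c = 1"
  obtains M where "\<And>m m' k. M \<le> m \<Longrightarrow> M \<le> m' \<Longrightarrow> cmod (symb_moment w k m - symb_moment w k m') \<le> 2 * \<delta> * peak_mass w k"
proof -
  obtain M where M: "\<And>m m' h g. M \<le> m \<Longrightarrow> M \<le> m' \<Longrightarrow> h \<in> hardy_space \<Longrightarrow> hardy_norm h \<le> 1 \<Longrightarrow> g \<in> hardy_space \<Longrightarrow> hardy_norm g \<le> 1 \<Longrightarrow>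
    cmod (l2_inner (\<lambda>\<zeta>. symb \<zeta> ^ m * radial_limit (composition_op A h) \<zeta>) (radial_limit g)
        - l2_inner (\<lambda>\<zeta>. symb \<zeta> ^ m' * radial_limit (composition_op A h) \<zeta>) (radial_limit g)) \<le> 2 * \<delta>"
    using uat_Cauchy[OF uat \<delta>] by blast
  show ?thesis
  proof (rule that[of M])
    fix m m' k assume mm: "M \<le> m" "M \<le> m'"
    define J where "J = peak_mass w k"
    have J: "0 < J" unfolding J_def by (rule peak_mass_pos[OF w])
    define \<alpha> where "\<alpha> = complex_of_real (1 / sqrt J)"
    have \<alpha>2: "\<alpha> * cnj \<alpha> = complex_of_real (1 / J)" "(cmod \<alpha>)\<^sup>2 = 1 / J"
      using J by (simp_all add: \<alpha>_def norm_divide power_divide flip: of_real_mult)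
    define p where "p z = \<alpha> * cinner z w ^ k" for z
    have pp: "p z * cnj (p z) = complex_of_real (1 / J) * complex_of_real (((cmod (cinner z w))\<^sup>2) ^ k)" for z
    proof -
      have "p z * cnj (p z) = (\<alpha> * cnj \<alpha>) * (cinner z w * cnj (cinner z w)) ^ k"
        by (simp add: p_def power_mult_distrib mult_ac)
      then show ?thesis by (simp only: \<alpha>2 complex_norm_square[symmetric] of_real_power)
    qed
    define h where "h = (\<lambda>z. p z * ball_one z)"
    have pa: "analytic_on_ball p" unfolding p_def [abs_def]
      by (intro analytic_on_ball_mult analytic_on_ball_const analytic_on_ball_power analytic_on_ball_cinner)
    have pc: "continuous_on S p" for S unfolding p_def [abs_def] by (intro continuous_intros)
    note hm = hardy_space_mult[OF ball_one_hardy pa pc, folded h_def]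
    have h: "h \<in> hardy_space" by (rule hm(1))
    have rh: "AE z in sphere_measure. radial_limit h z = p z"
      using hm(2) AE_sphere_norm by eventually_elim (simp add: radial_limit_ball_one)
    have pm: "p \<in> borel_measurable sphere_measure" by (rule measurable_sphere_continuous[OF pc])
    have "(hardy_norm h)\<^sup>2 = l2_norm_sq p"
      unfolding hardy_norm_power2[OF h] by (rule l2_norm_sq_cong_AE[OF rh measurable_radial_limit[OF h] pm])
    also have "\<dots> = (LINT z|sphere_measure. 1 / J * ((cmod (cinner z w))\<^sup>2) ^ k)"
      unfolding l2_norm_sq_def p_def by (simp add: norm_mult norm_power power_mult_distrib \<alpha>2 power_mult[symmetric] mult.commute[of k])
    also have "\<dots> = 1" using J by (simp add: J_def peak_mass_def)
    finally have hn: "hardy_norm h = 1" using hardy_norm_nonneg[of h] by (simp add: power2_eq_1_iff)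
    \<comment> \<open>An eigenvector of the composition operator; its eigenvalue
      \<open>c ^ k\<close> has modulus 1 and drops out of the final estimate.\<close>
    have Ch: "composition_op A h = (\<lambda>z. c ^ k * h z)"
    proof
      fix z
      have "A z \<in> ball 0 1" if "z \<in> ball 0 1" using contr[of z] that by simp
      then show "composition_op A h z = c ^ k * h z"
        by (auto simp: composition_op_def h_def p_def ball_one_def cinner_unimodular_eigenvector[OF w ev] power_mult_distrib)
    qed
    have rC: "AE z in sphere_measure. radial_limit (composition_op A h) z = c ^ k * p z"
      unfolding Ch using hardy_space_cmult(2)[OF h, of "c ^ k"] rh by eventually_elim simp
    have inner: "l2_inner (\<lambda>\<zeta>. symb \<zeta> ^ m * radial_limit (composition_op A h) \<zeta>) (radial_limit h) = c ^ k * complex_of_real (1 / J) * symb_moment w k m" for m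
    proof -
      have "l2_inner (\<lambda>\<zeta>. symb \<zeta> ^ m * radial_limit (composition_op A h) \<zeta>) (radial_limit h) = l2_inner (\<lambda>\<zeta>. symb \<zeta> ^ m * (c ^ k * p \<zeta>)) p"
      proof (rule l2_inner_cong_AE)
        show "AE z in sphere_measure. symb z ^ m * radial_limit (composition_op A h) z = symb z ^ m * (c ^ k * p z)"
          using rC by eventually_elim simp
        show "(\<lambda>\<zeta>. symb \<zeta> ^ m * radial_limit (composition_op A h) \<zeta>) \<in> borel_measurable sphere_measure"
          using shift_power(2)[OF h] by (simp add: sq_integrable_def)
        show "(\<lambda>\<zeta>. symb \<zeta> ^ m * (c ^ k * p \<zeta>)) \<in> borel_measurable sphere_measure"
          by (intro measurable_sphere_continuous continuous_intros continuous_symb pc)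
      qed (use rh pm measurable_radial_limit[OF h] in auto)
      also have "\<dots> = (LINT z|sphere_measure. (c ^ k * complex_of_real (1 / J)) * (symb z ^ m * complex_of_real (((cmod (cinner z w))\<^sup>2) ^ k)))"
        unfolding l2_inner_def
      proof (rule Bochner_Integration.integral_cong[OF refl])
        fix z
        have "symb z ^ m * (c ^ k * p z) * cnj (p z) = symb z ^ m * c ^ k * (p z * cnj (p z))" by (simp only: mult_ac)
        then show "symb z ^ m * (c ^ k * p z) * cnj (p z) = (c ^ k * complex_of_real (1 / J)) * (symb z ^ m * complex_of_real (((cmod (cinner z w))\<^sup>2) ^ k))"
          unfolding pp by (simp only: mult_ac)
      qed
      also have "\<dots> = c ^ k * complex_of_real (1 / J) * symb_moment w k m"
        unfolding symb_moment_def by (rule integral_mult_right_zero)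
      finally show ?thesis .
    qed
    have "cmod (c ^ k * complex_of_real (1 / J) * symb_moment w k m - c ^ k * complex_of_real (1 / J) * symb_moment w k m') \<le> 2 * \<delta>"
      using M[OF mm h _ h] hn unfolding inner by simp
    moreover have "c ^ k * complex_of_real (1 / J) * symb_moment w k m - c ^ k * complex_of_real (1 / J) * symb_moment w k m'
       = c ^ k * complex_of_real (1 / J) * (symb_moment w k m - symb_moment w k m')"
      by (simp only: right_diff_distrib)
    ultimately have "cmod (c ^ k * complex_of_real (1 / J) * (symb_moment w k m - symb_moment w k m')) \<le> 2 * \<delta>" by (simp only:)
    then have "cmod (symb_moment w k m - symb_moment w k m') / J \<le> 2 * \<delta>"
      using J ev(2) by (simp add: norm_mult norm_power norm_divide)
    then show "cmod (symb_moment w k m - symb_moment w k m') \<le> 2 * \<delta> * peak_mass w k"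
      using J by (simp add: pos_divide_le_eq J_def)
  qed
qed

text \<open>Where the symbol is unimodular, \<open>z\<close> is an eigenvector with eigenvalue 1, so
  it lies in the fixed space \<open>V\<close> of \<open>A\<close>. As \<open>A\<close> is not the
  identity, \<open>V\<close> is a proper subspace and has Lebesgue measure zero.\<close>

lemma AE_symb_less_1:
  assumes "A \<noteq> id" and one: "\<And>c v. v \<noteq> 0 \<Longrightarrow> A v = c *s v \<Longrightarrow> cmod c = 1 \<Longrightarrow> c = 1"
  shows "AE z in sphere_measure. cmod (symb z) < 1"
proof -
  define V where "V = {z. A z = z}"
  have sub: "subspace V"
    using A_scale[of "complex_of_real _"] A_scale[of 0 0] unfolding subspace_def V_def by (simp add: A_add of_real_cscale)
  have cl: "closed V" unfolding V_def by (intro closed_Collect_eq continuous_A continuous_intros)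
  have "V \<noteq> UNIV" using assms(1) by (auto simp: V_def fun_eq_iff)
  then have "dim V \<noteq> DIM(complex^'n)" using sub by (metis dim_eq_full span_eq_iff)
  then have "dim V < DIM(complex^'n)" using dim_subset_UNIV[of V] by linarith
  then have "negligible V" by (rule negligible_lowdim)
  then have "V \<in> null_sets lebesgue" by (simp add: negligible_iff_null_sets)
  moreover have Vb: "V \<in> sets borel" using cl by simp
  ultimately have V0: "emeasure lborel V = 0" by (auto simp: null_sets_def)
  \<comment> \<open>The fixed space is a cone, so the cone over its trace on the sphere is contained
    in it.\<close>
  have "(\<integral>\<^sup>+z. indicator V (sgn z) * indicator (ball 0 1) z \<partial>lborel) \<le> (\<integral>\<^sup>+z. indicator V z \<partial>lborel)"
  proof (rule nn_integral_mono_AE, rule AE_mp[OF AE_lborel_singleton[of "0 :: complex^'n"]], intro AE_I2 impI)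
    fix z :: "complex^'n" assume "z \<noteq> 0"
    then have zz: "complex_of_real (norm z) *s sgn z = z" by (simp add: of_real_cscale sgn_div_norm)
    have "z \<in> V" if "sgn z \<in> V"
    proof -
      have "A (sgn z) = sgn z" using that by (simp add: V_def)
      then have "A (complex_of_real (norm z) *s sgn z) = complex_of_real (norm z) *s sgn z"
        by (simp only: A_scale)
      then show ?thesis unfolding zz V_def by simp
    qed
    then show "indicator V (sgn z) * indicator (ball 0 1) z \<le> (indicator V z :: ennreal)" by (auto simp: indicator_def)
  qed
  also have "\<dots> = 0" using V0 Vb by simp
  finally have "(\<integral>\<^sup>+z. indicator V z \<partial>(sphere_measure :: (complex^'n) measure)) = 0"
    using Vb by (subst nn_integral_sphere_measure) simp_all
  moreover have "(indicator V :: complex^'n \<Rightarrow> ennreal) \<in> borel_measurable sphere_measure"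
    by (rule measurable_sphere_measure) (use Vb in simp)
  ultimately have "AE z in sphere_measure. indicator V z = (0 :: ennreal)"
    by (simp add: nn_integral_0_iff_AE)
  then show ?thesis using AE_sphere_norm
  proof eventually_elim
    fix z :: "complex^'n" assume V: "indicator V z = (0 :: ennreal)" and z: "norm z = 1"
    show "cmod (symb z) < 1"
    proof (rule ccontr)
      assume "\<not> cmod (symb z) < 1"
      then have s: "cmod (symb z) = 1" using norm_symb_le[OF z] by simp
      have e: "A z = symb z *s z" by (rule unimodular_symb_eigenvector[OF z s])
      have "z \<noteq> 0" using z by auto
      from one[OF this e s] e have "z \<in> V" by (simp add: V_def)
      then show False using V by simp
    qed
  qed
qed

text \<open>In both cases \<open>M\<close> comes from the Cauchy condition and \<open>k\<close> from
  \<open>peak_concentration\<close> for that \<open>M\<close>, so that the moments of order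
  \<open>M\<close> are known up to a small fraction of the mass.\<close>

lemma spectrum_inside_if_uat:
  assumes nid: "A \<noteq> id" and uat: "uniformly_asymptotically_toeplitz (composition_op A)"
    and v: "v \<noteq> 0" "A v = c *s v"
  shows "cmod c < 1"
proof -
  have le1: "cmod c \<le> 1" if "v \<noteq> 0" "A v = c *s v" for c v
    using contr[of v] that by (simp add: norm_cscale)
  \<comment> \<open>The alternative \<open>ne\<close> covers both contradictions: either
    \<open>c \<noteq> 1\<close>, or 1 is the only unimodular eigenvalue. If \<open>c = 1\<close> is
    accompanied by another unimodular eigenvalue, the first one is applied to that
    eigenvalue.\<close>
  have not1: False if v: "v \<noteq> 0" "A v = c *s v" and c: "cmod c = 1" and ne: "c \<noteq> 1 \<or> (\<forall>c v. v \<noteq> 0 \<longrightarrow> A v = c *s v \<longrightarrow> cmod c = 1 \<longrightarrow> c = 1)" for c v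
  proof -
    define w where "w = (1 / complex_of_real (norm v)) *s v"
    have w: "norm w = 1" using v by (simp add: w_def norm_cscale norm_divide)
    have ev: "A w = c *s w" "cmod c = 1" using v c by (simp_all add: w_def A_scale mult.commute)
    have conc: "\<exists>k. 2 * real m * (peak_mass w k - peak_mass w (Suc k)) \<le> \<eta> * peak_mass w k" if \<eta>: "0 < \<eta>" for m \<eta>
    proof -
      have "0 < \<eta> / (2 * real m + 1)" using \<eta> by simp
      from peak_concentration[OF w this] obtain k where k: "peak_mass w k - peak_mass w (Suc k) \<le> \<eta> / (2 * real m + 1) * peak_mass w k" by blast
      have "2 * real m * (peak_mass w k - peak_mass w (Suc k)) \<le> 2 * real m * (\<eta> / (2 * real m + 1) * peak_mass w k)"
        by (rule mult_left_mono[OF k]) simp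
      also have "\<dots> = (2 * real m * (\<eta> / (2 * real m + 1))) * peak_mass w k" by simp
      also have "\<dots> \<le> \<eta> * peak_mass w k"
        using \<eta> peak_mass_pos[OF w, of k] by (intro mult_right_mono) (simp_all add: pos_divide_le_eq algebra_simps)
      finally show ?thesis by blast
    qed
    show False
    proof (cases "c = 1")
      case False
      \<comment> \<open>The moments of orders \<open>M\<close> and \<open>Suc M\<close> differ by at
        most \<open>2 * \<delta>\<close> times the mass, and each approximation by
        \<open>c ^ M\<close> and \<open>c ^ Suc M\<close> costs \<open>\<delta>\<close>: in total
        \<open>4 * \<delta>\<close>, against the true distance \<open>8 * \<delta>\<close>.\<close>
      define \<delta> where "\<delta> = cmod (c - 1) / 8"
      have \<delta>: "0 < \<delta>" "cmod (c - 1) = 8 * \<delta>" using False by (auto simp: \<delta>_def)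
      obtain M where M: "\<And>m m' k. M \<le> m \<Longrightarrow> M \<le> m' \<Longrightarrow> cmod (symb_moment w k m - symb_moment w k m') \<le> 2 * \<delta> * peak_mass w k"
        using uat_symb_moment_Cauchy[OF uat \<delta>(1) w ev] by blast
      \<comment> \<open>The weight \<open>Suc M\<close> covers both exponents, since the difference
        of consecutive masses is nonnegative.\<close>
      obtain k where k: "2 * real (Suc M) * (peak_mass w k - peak_mass w (Suc k)) \<le> \<delta> * peak_mass w k"
        using conc[OF \<delta>(1)] by blast
      let ?J = "peak_mass w k"
      have J: "0 < ?J" by (rule peak_mass_pos[OF w])
      have dpos: "0 \<le> peak_mass w k - peak_mass w (Suc k)"
        using order_trans[OF norm_ge_zero symb_moment_near[OF w ev, of k 1]] by simp
      have "cmod (symb_moment w k M - c ^ M * ?J) \<le> \<delta> * ?J"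
      proof -
        have "2 * real M * (peak_mass w k - peak_mass w (Suc k)) \<le> 2 * real (Suc M) * (peak_mass w k - peak_mass w (Suc k))"
          by (intro mult_right_mono dpos) simp
        then show ?thesis using symb_moment_near[OF w ev, of k M] k by linarith
      qed
      moreover have "cmod (symb_moment w k (Suc M) - c ^ Suc M * ?J) \<le> \<delta> * ?J"
        using symb_moment_near[OF w ev, of k "Suc M"] k by linarith
      moreover have "cmod (symb_moment w k M - symb_moment w k (Suc M)) \<le> 2 * \<delta> * ?J" by (rule M) auto
      ultimately have "dist (c ^ M * complex_of_real ?J) (c ^ Suc M * complex_of_real ?J) \<le> 4 * \<delta> * ?J"
        using dist_triangle3[of "c ^ M * complex_of_real ?J" "c ^ Suc M * complex_of_real ?J" "symb_moment w k M"]
          dist_triangle[of "symb_moment w k M" "c ^ Suc M * complex_of_real ?J" "symb_moment w k (Suc M)"]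
        unfolding dist_norm by linarith
      moreover have "dist (c ^ M * complex_of_real ?J) (c ^ Suc M * complex_of_real ?J) = 8 * \<delta> * ?J"
      proof -
        have "c ^ M * complex_of_real ?J - c ^ Suc M * complex_of_real ?J = - (c ^ M * (c - 1) * complex_of_real ?J)"
          by (simp add: algebra_simps)
        then show ?thesis unfolding dist_norm using J c \<delta>(2) by (simp add: norm_mult norm_power)
      qed
      ultimately have "8 * \<delta> * ?J \<le> 4 * \<delta> * ?J" by simp
      moreover have "0 < \<delta> * ?J" using \<delta>(1) J by simp
      ultimately show False by linarith
    next
      case True
      then have one: "\<And>c v. v \<noteq> 0 \<Longrightarrow> A v = c *s v \<Longrightarrow> cmod c = 1 \<Longrightarrow> c = 1" using ne by blast
      \<comment> \<open>With \<open>m'\<close> tending to infinity this bounds the moment of order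
        \<open>M\<close> by a quarter of the mass, while it lies within another quarter of a number
        whose modulus is the whole mass.\<close>
      obtain M where M: "\<And>m m' k. M \<le> m \<Longrightarrow> M \<le> m' \<Longrightarrow> cmod (symb_moment w k m - symb_moment w k m') \<le> 2 * (1/8) * peak_mass w k"
        using uat_symb_moment_Cauchy[OF uat _ w ev, of "1/8"] by auto
      obtain k where k: "2 * real M * (peak_mass w k - peak_mass w (Suc k)) \<le> 1/4 * peak_mass w k"
        using conc[of "1/4"] by auto
      let ?J = "peak_mass w k"
      have J: "0 < ?J" by (rule peak_mass_pos[OF w])
      have lt1: "AE z in sphere_measure. cmod (symb z) < 1"
        by (rule AE_symb_less_1[OF nid]) (rule one)
      have "(\<lambda>m. symb_moment w k m) \<longlonglongrightarrow> (LINT z|(sphere_measure :: (complex^'n) measure). 0)"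
        unfolding symb_moment_def
      proof (rule integral_dominated_convergence[where w = "\<lambda>_. 1"])
        show "integrable sphere_measure (\<lambda>_ :: complex^'n. 1 :: real)"
          by (rule integrable_sphere_bounded[where K = 1]) auto
        show "(\<lambda>z. symb z ^ m * complex_of_real (((cmod (cinner z w))\<^sup>2) ^ k)) \<in> borel_measurable sphere_measure" for m
          by (rule borel_measurable_integrable[OF integrable_symb_moment[OF w]])
        show "AE z in sphere_measure. norm (symb z ^ m * complex_of_real (((cmod (cinner z w))\<^sup>2) ^ k)) \<le> 1" for m
        proof (rule AE_I2)
          fix z :: "complex^'n" assume "z \<in> space sphere_measure"
          then have z: "norm z = 1" by simp
          have "cmod (symb z) ^ m * ((cmod (cinner z w))\<^sup>2) ^ k \<le> 1 * 1"
            using norm_symb_le[OF z] norm_cinner_le[of z w] z w by (intro mult_mono power_le_one) auto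
          then show "norm (symb z ^ m * complex_of_real (((cmod (cinner z w))\<^sup>2) ^ k)) \<le> 1"
            by (simp add: norm_mult norm_power)
        qed
        show "AE z in sphere_measure. (\<lambda>m. symb z ^ m * complex_of_real (((cmod (cinner z w))\<^sup>2) ^ k)) \<longlonglongrightarrow> 0"
          using lt1
        proof eventually_elim
          fix z assume "cmod (symb z) < 1"
          then have "(\<lambda>m. symb z ^ m) \<longlonglongrightarrow> 0" by (rule LIMSEQ_power_zero)
          then show "(\<lambda>m. symb z ^ m * complex_of_real (((cmod (cinner z w))\<^sup>2) ^ k)) \<longlonglongrightarrow> 0"
            by (rule tendsto_mult_left_zero)
        qed
      qed simp
      then have lim: "(\<lambda>m. symb_moment w k m) \<longlonglongrightarrow> 0" by simp
      \<comment> \<open>Here \<open>k\<close> stays fixed while \<open>m'\<close> grows, so the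
        limit of the moments may be inserted in the Cauchy estimate.\<close>
      have "(\<lambda>m'. cmod (symb_moment w k M - symb_moment w k m')) \<longlonglongrightarrow> cmod (symb_moment w k M - 0)"
        by (intro tendsto_norm tendsto_diff tendsto_const lim)
      moreover have "\<forall>\<^sub>F m' in sequentially. cmod (symb_moment w k M - symb_moment w k m') \<le> 2 * (1/8) * ?J"
        unfolding eventually_sequentially using M[of M] by blast
      ultimately have "cmod (symb_moment w k M - 0) \<le> 2 * (1/8) * ?J"
        by (rule tendsto_upperbound) simp
      moreover have "cmod (symb_moment w k M - c ^ M * complex_of_real ?J) \<le> 1/4 * ?J"
        using symb_moment_near[OF w ev, of k M] k by linarith
      moreover have "cmod (c ^ M * complex_of_real ?J) = ?J" using J c by (simp add: norm_mult norm_power)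
      ultimately show False
        using norm_triangle_ineq4[of "symb_moment w k M" "symb_moment w k M - c ^ M * complex_of_real ?J"] J by simp
    qed
  qed
  show ?thesis
  proof (rule ccontr)
    assume "\<not> cmod c < 1"
    then have c: "cmod c = 1" using le1[OF v] by simp
    show False
    proof (cases "\<forall>c v. v \<noteq> 0 \<longrightarrow> A v = c *s v \<longrightarrow> cmod c = 1 \<longrightarrow> c = 1")
      case True
      then show False using not1[OF v c] by blast
    next
      case False
      then obtain c' v' where "v' \<noteq> 0" "A v' = c' *s v'" "cmod c' = 1" "c' \<noteq> 1" by blast
      then show False using not1[of v' c'] by blast
    qed
  qed
qed

end

theorem theorem3p6:
  fixes A :: "complex ^ 'n \<Rightarrow> complex ^ 'n"
  assumes "Vector_Spaces.linear (*s) (*s) A"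
    and "A \<noteq> id"
    and "onorm A \<le> 1"
  shows "uniformly_asymptotically_toeplitz (composition_op A) \<longleftrightarrow>
           (\<forall>c v. v \<noteq> 0 \<and> A v = c *s v \<longrightarrow> cmod c < 1)"
proof -
  have contr: "norm (A z) \<le> norm z" for z
  proof -
    have "norm (A z) \<le> onorm A * norm z" by (rule onorm[OF clinear_bounded[OF assms(1)]])
    also have "\<dots> \<le> 1 * norm z" by (rule mult_right_mono[OF assms(3)]) simp
    finally show ?thesis by simp
  qed
  interpret linear_contraction A by (rule linear_contraction.intro[OF assms(1) contr])
  show ?thesis
    using uat_if_spectrum_inside spectrum_inside_if_uat[OF assms(2)] by blast
qed

end
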